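(* Let $\alpha,\beta\in\mathbb{R}$ and assume $(\mathrm{A}_1)$–$(\mathrm{A}_4)$ (stated in the context). Then for each $\varepsilon>0$ the microscopic problem $$\nabla\cdot(-\mathbf{A}(x/\varepsilon)\nabla u_\varepsilon)+\varepsilon^\alpha\mathcal{R}(u_\varepsilon)=f\ \text{in }\Omega^\varepsilon,\qquad -\mathbf{A}(x/\varepsilon)\nabla u_\varepsilon\cdot\mathrm{n}=\varepsilon^\beta\mathcal{S}(u_\varepsilon)\ \text{on }\Gamma^\varepsilon,\qquad u_\varepsilon=0\ \text{on }\Gamma^{\mathrm{ext}},$$ has a unique weak solution; that is, there is a unique $u_\varepsilon\in\widetilde{\mathcal{W}}_\varepsilon$ such that $$a(u_\varepsilon,\varphi)+\varepsilon^\beta\langle\mathcal{S}(u_\varepsilon),\varphi\rangle_{L^2(\Gamma^\varepsilon)}+\varepsilon^\alpha\langle\mathcal{R}(u_\varepsilon),\varphi\rangle_{L^2(\Omega^\varepsilon)}=\langle f,\varphi\rangle_{L^2(\Omega^\varepsilon)}\quad\text{for all }\varphi\in\widetilde{\mathcal{W}}_\varepsilon.$$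
   Context: Geometry. $\Omega\subset\mathbb{R}^d$ is a bounded, open, connected domain with Lipschitz boundary $\partial\Omega=\Gamma^{\mathrm{ext}}$. $Y=(0,1)^d$ is the unit cell; $Y_l,Y_s$ are disjoint open subsets of $Y$ with $\bar Y_l\cup\bar Y_s=\bar Y$, $\bar Y_l\cap\bar Y_s=\Gamma$ of non-zero $(d-1)$-dimensional measure; $Y_s$ lies totally inside $Y$ (it does not meet $\partial Y$) and $Y_l$ is connected. For $k\in\mathbb{Z}^d$, $X^k:=X+\sum_i k_i\vec e_i$. For $\varepsilon>0$, $\Omega$ is completely covered by the $\varepsilon$-scaled cells $\varepsilon Y^k$; $\Omega_0^\varepsilon$ is the union of the solid parts $\varepsilon Y_s^k$, $\Omega^\varepsilon$ (the perforated domain) is the union of the liquid parts $\varepsilon Y_l^k$ of these cells, and $\Gamma^\varepsilon:=\partial\Omega_0^\varepsilon$. $\Omega^\varepsilon$ is bounded, connected and has $C^2$ internal boundary $\Gamma^\varepsilon$; $\mathrm{n}$ is the unit outward normal on $\Gamma^\varepsilon$. Function spaces. $V^\varepsilon:=\{v\in H^1(\Omega^\varepsilon): v=0\text{ on }\Gamma^{\mathrm{ext}}\}$. $\mathcal{W}_\varepsilon:=L^2(\Gamma^\varepsilon)\cap L^2(\Omega^\varepsilon)$ with $\|u\|_{\mathcal{W}_\varepsilon}^2=\|u\|_{L^2(\Gamma^\varepsilon)}^2+\|u\|_{L^2(\Omega^\varepsilon)}^2$ (values on $\Gamma^\varepsilon$ in the sense of traces). $\widetilde{\mathcal{W}}_\varepsilon$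 is the intersection of $V^\varepsilon$ and the scaled $\mathcal{W}_\varepsilon$, a Hilbert space with norm $\|u\|_{\widetilde{\mathcal{W}}_\varepsilon}^2=\|\nabla u\|_{L^2(\Omega^\varepsilon)}^2+(\varepsilon^\alpha+\varepsilon^\beta)\|u\|_{\mathcal{W}_\varepsilon}^2$ and the corresponding inner product. $\mathbf{A}_\varepsilon(x):=\mathbf{A}(x/\varepsilon)$ and $a(u,\varphi):=\int_{\Omega^\varepsilon}\mathbf{A}_\varepsilon(x)\nabla u\cdot\nabla\varphi\,dx$. Assumptions. $(\mathrm{A}_1)$: $\mathbf{A}\in L^\infty(\mathbb{R}^d)$ (matrix-valued, $d\times d$) is $Y$-periodic and symmetric, and there are constants $\underline\gamma,\overline\gamma>0$ independent of $\varepsilon$ with $\underline\gamma|\xi|^2\le\sum_{i,j}\mathbf{A}_{ij}(y)\xi_i\xi_j\le\overline\gamma|\xi|^2$ for all $\xi\in\mathbb{R}^d$. $(\mathrm{A}_2)$: $\mathcal{S},\mathcal{R}:\mathbb{R}\to\mathbb{R}$ are Carathéodory functions and globally Lipschitz. $(\mathrm{A}_3)$: there are constants $\delta_0,\delta_1>0$ independent of $\varepsilon$ with $0<\delta_0\le\mathcal{S}',\mathcal{R}'\le\delta_1$ a.e. in $\mathbb{R}$. $(\mathrm{A}_4)$: the source $f$ is a smooth function in $\Omega$ (with $f\in L^2(\Omega^\varepsilon)$). *)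

theory Defs
  imports "HOL-Analysis.Analysis"
begin

section \<open>Function spaces\<close>

text \<open>Functions are not quotiented: elements of the spaces below are representatives, to be
  identified when they agree almost everywhere.\<close>

definition L2_space :: "'a measure \<Rightarrow> ('a \<Rightarrow> 'b::euclidean_space) set" where
  "L2_space M = {u \<in> borel_measurable M. integrable M (\<lambda>x. (norm (u x))\<^sup>2)}"

definition L2_tendsto ::
  "'a measure \<Rightarrow> (nat \<Rightarrow> 'a \<Rightarrow> 'b::euclidean_space) \<Rightarrow> ('a \<Rightarrow> 'b) \<Rightarrow> bool" where
  "L2_tendsto M v u \<longleftrightarrow> (\<forall>n. v n \<in> L2_space M) \<and> u \<in> L2_space M \<and>
     (\<lambda>n. LINT x|M. (norm (v n x - u x))\<^sup>2) \<longlonglongrightarrow> 0"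

definition partial_deriv :: "'n \<Rightarrow> (real^'n \<Rightarrow> real) \<Rightarrow> real^'n \<Rightarrow> real" where
  "partial_deriv i f x = frechet_derivative f (at x) (axis i 1)"

definition grad :: "(real^'n \<Rightarrow> real) \<Rightarrow> real^'n \<Rightarrow> real^'n" where
  "grad f x = (\<chi> i. partial_deriv i f x)"

text \<open>Only used for open sets \<open>U\<close>, since derivatives are taken in a full neighbourhood.\<close>

primrec Ck_on :: "nat \<Rightarrow> (real^'n) set \<Rightarrow> (real^'n \<Rightarrow> real) \<Rightarrow> bool" where
  "Ck_on 0 U f \<longleftrightarrow> continuous_on U f"
| "Ck_on (Suc k) U f \<longleftrightarrow>
     (\<forall>x\<in>U. f differentiable (at x)) \<and> (\<forall>i. Ck_on k U (partial_deriv i f))"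

definition smooth_on :: "(real^'n) set \<Rightarrow> (real^'n \<Rightarrow> real) \<Rightarrow> bool" where
  "smooth_on U f \<longleftrightarrow> (\<forall>k. Ck_on k U f)"

definition test_function :: "(real^'n) set \<Rightarrow> (real^'n \<Rightarrow> real) \<Rightarrow> bool" where
  "test_function D \<psi> \<longleftrightarrow>
     smooth_on UNIV \<psi> \<and> compact (closure {x. \<psi> x \<noteq> 0}) \<and> closure {x. \<psi> x \<noteq> 0} \<subseteq> D"

definition has_weak_gradient ::
  "(real^'n) set \<Rightarrow> (real^'n \<Rightarrow> real) \<Rightarrow> (real^'n \<Rightarrow> real^'n) \<Rightarrow> bool" where
  "has_weak_gradient D u G \<longleftrightarrow> (\<forall>\<psi> i. test_function D \<psi> \<longrightarrow>
     (LINT x|lebesgue_on D. u x * partial_deriv i \<psi> x) =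
     - (LINT x|lebesgue_on D. (G x $ i) * \<psi> x))"

definition H1_space :: "(real^'n) set \<Rightarrow> (real^'n \<Rightarrow> real) set" where
  "H1_space D = {u \<in> L2_space (lebesgue_on D).
     \<exists>G \<in> L2_space (lebesgue_on D). has_weak_gradient D u G}"

text \<open>For \<open>u \<in> H1_space D\<close> this is determined up to a null set.\<close>

definition weak_grad :: "(real^'n) set \<Rightarrow> (real^'n \<Rightarrow> real) \<Rightarrow> real^'n \<Rightarrow> real^'n" where
  "weak_grad D u = (SOME G. G \<in> L2_space (lebesgue_on D) \<and> has_weak_gradient D u G)"


section \<open>Surface measure and traces\<close>

text \<open>The \<open>s\<close>-dimensional Hausdorff measure, normalised so that it is the surface area on
  \<open>s\<close>-dimensional surfaces. The empty set is treated separately because \<open>0 ^ 0 = 1\<close>;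
  boundedness is required because \<^const>\<open>diameter\<close> is unspecified on unbounded sets.\<close>

definition hausdorff_pre :: "nat \<Rightarrow> real \<Rightarrow> 'a::metric_space set \<Rightarrow> ennreal" where
  "hausdorff_pre s \<delta> A =
     (INF C \<in> {C :: nat \<Rightarrow> 'a set. A \<subseteq> (\<Union>i. C i) \<and> (\<forall>i. bounded (C i) \<and> diameter (C i) \<le> \<delta>)}.
        \<Sum>i. if C i = {} then 0
             else ennreal (unit_ball_vol (real s) * (diameter (C i) / 2) ^ s))"

definition hausdorff_outer :: "nat \<Rightarrow> 'a::metric_space set \<Rightarrow> ennreal" where
  "hausdorff_outer s A = (SUP \<delta> \<in> {0<..}. hausdorff_pre s \<delta> A)"

text \<open>\<^const>\<open>lambda_system\<close> is the sigma-algebra of Caratheodory-measurable sets.\<close>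

definition hausdorff_measure :: "nat \<Rightarrow> 'a::metric_space measure" where
  "hausdorff_measure s =
     measure_of UNIV (lambda_system UNIV UNIV (hausdorff_outer s)) (hausdorff_outer s)"

definition surface_measure :: "(real^'n) set \<Rightarrow> (real^'n) measure" where
  "surface_measure \<Gamma> = restrict_space (hausdorff_measure (CARD('n) - 1)) \<Gamma>"

text \<open>The trace operator on \<open>\<Gamma> \<subseteq> frontier D\<close> is the extension by continuity of the restriction map
  \<open>v \<mapsto> v|\<Gamma>\<close> on functions smooth up to the boundary. Its graph is the closure, in
  \<open>H\<^sup>1(D) \<times> L\<^sup>2(\<Gamma>)\<close>, of the graph of the restriction map.\<close>

definition has_trace ::
  "(real^'n) set \<Rightarrow> (real^'n) set \<Rightarrow> (real^'n \<Rightarrow> real) \<Rightarrow> (real^'n \<Rightarrow> real) \<Rightarrow> bool" where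
  "has_trace D \<Gamma> u g \<longleftrightarrow> u \<in> H1_space D \<and>
     (\<exists>v. (\<forall>n. smooth_on UNIV (v n)) \<and>
        L2_tendsto (lebesgue_on D) v u \<and>
        L2_tendsto (lebesgue_on D) (\<lambda>n. grad (v n)) (weak_grad D u) \<and>
        L2_tendsto (surface_measure \<Gamma>) v g)"


section \<open>Geometry\<close>

text \<open>Near the boundary point \<open>x\<close> the set \<open>D\<close> is the part of a ball below the graph of \<open>h\<close>, in
  coordinates whose last axis points in the direction \<open>e\<close>. The function \<open>h\<close>, taken from the
  regularity class \<open>P\<close>, is only evaluated on the hyperplane orthogonal to \<open>e\<close>.\<close>

definition boundary_graph_at ::
  "((real^'n \<Rightarrow> real) \<Rightarrow> bool) \<Rightarrow> (real^'n) set \<Rightarrow> real^'n \<Rightarrow> bool" where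
  "boundary_graph_at P D x \<longleftrightarrow> (\<exists>e h r. norm e = 1 \<and> P h \<and> r > 0 \<and>
     x \<bullet> e = h (x - (x \<bullet> e) *\<^sub>R e) \<and>
     D \<inter> ball x r = {y \<in> ball x r. y \<bullet> e < h (y - (y \<bullet> e) *\<^sub>R e)})"

definition lipschitz_boundary :: "(real^'n) set \<Rightarrow> bool" where
  "lipschitz_boundary D \<longleftrightarrow>
     (\<forall>x \<in> frontier D. boundary_graph_at (\<lambda>h. \<exists>L. L-lipschitz_on UNIV h) D x)"

definition C2_boundary_along :: "(real^'n) set \<Rightarrow> (real^'n) set \<Rightarrow> bool" where
  "C2_boundary_along D \<Gamma> \<longleftrightarrow> (\<forall>x \<in> \<Gamma>. boundary_graph_at (Ck_on 2 UNIV) D x)"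

definition int_vec :: "int^'n \<Rightarrow> real^'n" where
  "int_vec k = (\<chi> i. real_of_int (k $ i))"

definition unit_cell :: "(real^'n) set" where
  "unit_cell = box 0 (\<chi> i. 1)"

text \<open>\<open>\<epsilon>X\<^sup>k\<close>\<close>

definition scaled_copy :: "real \<Rightarrow> (real^'n) set \<Rightarrow> int^'n \<Rightarrow> (real^'n) set" where
  "scaled_copy \<epsilon> X k = (\<lambda>x. \<epsilon> *\<^sub>R (x + int_vec k)) ` X"

definition cell_indices :: "real \<Rightarrow> (real^'n) set \<Rightarrow> (int^'n) set" where
  "cell_indices \<epsilon> \<Omega> = {k. scaled_copy \<epsilon> unit_cell k \<subseteq> \<Omega>}"

definition covered_by_cells :: "real \<Rightarrow> (real^'n) set \<Rightarrow> bool" where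
  "covered_by_cells \<epsilon> \<Omega> \<longleftrightarrow>
     \<Omega> \<subseteq> (\<Union>k \<in> cell_indices \<epsilon> \<Omega>. closure (scaled_copy \<epsilon> unit_cell k))"

definition solid_domain :: "real \<Rightarrow> (real^'n) set \<Rightarrow> (real^'n) set \<Rightarrow> (real^'n) set" where
  "solid_domain \<epsilon> \<Omega> Ys = (\<Union>k \<in> cell_indices \<epsilon> \<Omega>. scaled_copy \<epsilon> Ys k)"

text \<open>The plain union of the open sets \<open>\<epsilon>Y\<^sub>l\<^sup>k\<close> omits the faces between adjacent cells, hence is
  disconnected as soon as there are two cells; the interior of its closure puts these faces back.\<close>

definition perforated_domain :: "real \<Rightarrow> (real^'n) set \<Rightarrow> (real^'n) set \<Rightarrow> (real^'n) set" where
  "perforated_domain \<epsilon> \<Omega> Yl =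
     interior (closure (\<Union>k \<in> cell_indices \<epsilon> \<Omega>. scaled_copy \<epsilon> Yl k))"

definition internal_boundary :: "real \<Rightarrow> (real^'n) set \<Rightarrow> (real^'n) set \<Rightarrow> (real^'n) set" where
  "internal_boundary \<epsilon> \<Omega> Ys = frontier (solid_domain \<epsilon> \<Omega> Ys)"

definition reference_cell :: "(real^'n) set \<Rightarrow> (real^'n) set \<Rightarrow> bool" where
  "reference_cell Yl Ys \<longleftrightarrow>
     open Yl \<and> open Ys \<and> Yl \<subseteq> unit_cell \<and> Ys \<subseteq> unit_cell \<and> Yl \<inter> Ys = {} \<and>
     closure Yl \<union> closure Ys = closure unit_cell \<and>
     emeasure (hausdorff_measure (CARD('n) - 1)) (closure Yl \<inter> closure Ys) \<noteq> 0 \<and>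
     closure Ys \<inter> frontier unit_cell = {} \<and>
     connected Yl"

definition microscopic_geometry ::
  "real \<Rightarrow> (real^'n) set \<Rightarrow> (real^'n) set \<Rightarrow> (real^'n) set \<Rightarrow> bool" where
  "microscopic_geometry \<epsilon> \<Omega> Yl Ys \<longleftrightarrow>
     covered_by_cells \<epsilon> \<Omega> \<and>
     bounded (perforated_domain \<epsilon> \<Omega> Yl) \<and> connected (perforated_domain \<epsilon> \<Omega> Yl) \<and>
     C2_boundary_along (perforated_domain \<epsilon> \<Omega> Yl) (internal_boundary \<epsilon> \<Omega> Ys)"


section \<open>Data\<close>

definition elliptic_coefficient ::
  "real \<Rightarrow> real \<Rightarrow> (real^'n \<Rightarrow> real^'n^'n) \<Rightarrow> bool" where
  "elliptic_coefficient \<gamma>\<^sub>0 \<gamma>\<^sub>1 A \<longleftrightarrow>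
     A \<in> borel_measurable lebesgue \<and> (\<exists>C. AE y in lebesgue. norm (A y) \<le> C) \<and>
     (\<forall>k. AE y in lebesgue. A (y + int_vec k) = A y) \<and>
     (AE y in lebesgue. transpose (A y) = A y) \<and>
     (AE y in lebesgue. \<forall>\<xi>. \<gamma>\<^sub>0 * (norm \<xi>)\<^sup>2 \<le> (\<Sum>i\<in>UNIV. \<Sum>j\<in>UNIV. A y $ i $ j * \<xi> $ i * \<xi> $ j) \<and>
        (\<Sum>i\<in>UNIV. \<Sum>j\<in>UNIV. A y $ i $ j * \<xi> $ i * \<xi> $ j) \<le> \<gamma>\<^sub>1 * (norm \<xi>)\<^sup>2)"

text \<open>For a function of the unknown alone, the Caratheodory condition is continuity.\<close>

definition rate_function :: "real \<Rightarrow> real \<Rightarrow> (real \<Rightarrow> real) \<Rightarrow> bool" where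
  "rate_function \<delta>\<^sub>0 \<delta>\<^sub>1 F \<longleftrightarrow>
     continuous_on UNIV F \<and> (\<exists>L. L-lipschitz_on UNIV F) \<and>
     (AE r in lebesgue. \<exists>F'. (F has_real_derivative F') (at r) \<and> \<delta>\<^sub>0 \<le> F' \<and> F' \<le> \<delta>\<^sub>1)"


section \<open>Weak formulation\<close>

definition V_space :: "(real^'n) set \<Rightarrow> (real^'n) set \<Rightarrow> (real^'n \<Rightarrow> real) set" where
  "V_space D \<Gamma>ext = {v \<in> H1_space D. has_trace D \<Gamma>ext v (\<lambda>_. 0)}"

definition W_space :: "(real^'n) set \<Rightarrow> (real^'n) set \<Rightarrow> (real^'n \<Rightarrow> real) set" where
  "W_space D \<Gamma> = {u \<in> L2_space (lebesgue_on D). \<exists>g \<in> L2_space (surface_measure \<Gamma>). has_trace D \<Gamma> u g}"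

text \<open>As a set, this does not depend on the scaling of the norm by powers of \<open>\<epsilon>\<close>.\<close>

definition Wtilde_space ::
  "(real^'n) set \<Rightarrow> (real^'n) set \<Rightarrow> (real^'n) set \<Rightarrow> (real^'n \<Rightarrow> real) set" where
  "Wtilde_space D \<Gamma> \<Gamma>ext = V_space D \<Gamma>ext \<inter> W_space D \<Gamma>"

text \<open>\<open>D\<close> is the perforated domain, \<open>\<Gamma>\<close> its internal and \<open>\<Gamma>ext\<close> its exterior boundary. In the surface
  integral, \<open>g\<close> and \<open>h\<close> are the traces on \<open>\<Gamma>\<close> of \<open>u\<close> and \<open>\<phi>\<close>.\<close>

definition weak_solution ::
  "(real^'n) set \<Rightarrow> (real^'n) set \<Rightarrow> (real^'n) set \<Rightarrow> real \<Rightarrow> real \<Rightarrow> real \<Rightarrow>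
   (real^'n \<Rightarrow> real^'n^'n) \<Rightarrow> (real \<Rightarrow> real) \<Rightarrow> (real \<Rightarrow> real) \<Rightarrow> (real^'n \<Rightarrow> real) \<Rightarrow>
   (real^'n \<Rightarrow> real) \<Rightarrow> bool" where
  "weak_solution D \<Gamma> \<Gamma>ext \<epsilon> \<alpha> \<beta> A S R f u \<longleftrightarrow>
     u \<in> Wtilde_space D \<Gamma> \<Gamma>ext \<and>
     (\<exists>g. has_trace D \<Gamma> u g \<and>
       (\<forall>\<phi> \<in> Wtilde_space D \<Gamma> \<Gamma>ext. \<forall>h. has_trace D \<Gamma> \<phi> h \<longrightarrow>
         (LINT x|lebesgue_on D. (A ((1/\<epsilon>) *\<^sub>R x) *v weak_grad D u x) \<bullet> weak_grad D \<phi> x)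
         + \<epsilon> powr \<beta> * (LINT x|surface_measure \<Gamma>. S (g x) * h x)
         + \<epsilon> powr \<alpha> * (LINT x|lebesgue_on D. R (u x) * \<phi> x)
         = (LINT x|lebesgue_on D. f x * \<phi> x)))"

end

theory Submission
  imports Defs "HOL-Library.Function_Algebras"
begin

text \<open>The problem is the Euler-Lagrange equation of the energy
  \<open>1/2 a(u, u) + \<epsilon>\<^sup>\<beta> \<integral>\<^bsub>\<Gamma>\<^esub> \<Phi>\<^sub>S(u) + \<epsilon>\<^sup>\<alpha> \<integral>\<^bsub>D\<^esub> \<Phi>\<^sub>R(u) - \<integral>\<^bsub>D\<^esub> f u\<close>, where \<open>\<Phi>\<^sub>S\<close>, \<open>\<Phi>\<^sub>R\<close> are primitives of
  \<open>S\<close>, \<open>R\<close>. Symmetry of \<open>A\<close> makes this the right energy, and ellipticity together with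
  \<open>S', R' \<ge> \<delta>\<^sub>0\<close> makes it uniformly convex, so minimising sequences are Cauchy and the minimiser is the
  only critical point. The energy is minimised over triples of a function, its weak gradient and
  its trace, all regarded as independent data; the triples that occur form a closed subspace of a
  product of \<open>L\<^sup>2\<close> spaces by construction, so that neither a trace theorem nor uniqueness of traces
  is needed. What is needed is that weak gradients are unique, and that the compact \<open>C\<^sup>2\<close> surface
  \<open>\<Gamma>\<close> has finite Hausdorff measure, because \<open>S(0)\<close> need not vanish.\<close>

section \<open>Critical points of uniformly convex functionals\<close>

text \<open>The energy enters only through a quadratic estimate around each point, \<open>E w + B w
  p + c * N p \<le> E (w + p) \<le> E w + B w p + C * N p\<close>. The bound
  \<open>\<delta>\<^sub>0\<close> controls the L^2 norms of the function and of its trace, and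
  \<open>\<gamma>\<^sub>0\<close> that of the gradient, so \<open>N\<close> is the squared seminorm
  of the whole product. It is only a seminorm because functions are representatives. The obstacle to
  working with functions alone is that \<open>weak_grad\<close> is a choice: the gradient chosen for
  a sum agrees with the sum of the chosen gradients only almost everywhere, and
  \<open>has_trace\<close> is stated through it. Triples admit every gradient, and uniqueness of
  weak gradients translates back at the end. The weak formulation asks for some trace of the
  solution and tests with every trace of each test function, which is exactly criticality over
  triples. The lower bound on S' and R' holds only almost everywhere. It becomes a bound on
  increments because Lipschitz maps send null sets to null sets. Pointwise scaling of functions
  turns the triples into a real vector space.\<close>

instantiation "fun" :: (type, real_vector) real_vector
begin

definition "r *\<^sub>R f = (\<lambda>x. r *\<^sub>R f x)"

instance
  by standard (simp_all add: scaleR_fun_def fun_eq_iff scaleR_add_right scaleR_add_left)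

end

lemma scaleR_fun_apply [simp]: "(r *\<^sub>R f) x = r *\<^sub>R f x"
  by (simp add: scaleR_fun_def)

text \<open>The direct method with a quantitative lower bound: two almost minimal points are close
  in \<open>N\<close>, so a minimising sequence converges. \<open>B\<close> is the derivative of
  \<open>E\<close> but may be nonlinear in its first argument. \<open>N\<close> may vanish on
  nonzero vectors, hence the form of the uniqueness claim.\<close>

lemma uniformly_convex_critical_point:
  fixes H :: "'v::real_vector set" and N E :: "'v \<Rightarrow> real" and B :: "'v \<Rightarrow> 'v \<Rightarrow> real"
  assumes H: "subspace H"
    and N_nonneg: "\<And>w. w \<in> H \<Longrightarrow> 0 \<le> N w"
    and N_scale: "\<And>w t. w \<in> H \<Longrightarrow> N (t *\<^sub>R w) = t\<^sup>2 * N w"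
    and N_complete: "\<And>w. (\<And>k::nat. w k \<in> H) \<Longrightarrow>
      (\<And>e. 0 < e \<Longrightarrow> \<exists>K. \<forall>k\<ge>K. \<forall>l\<ge>K. N (w k - w l) < e) \<Longrightarrow>
      \<exists>v\<in>H. (\<lambda>k. N (w k - v)) \<longlonglongrightarrow> 0"
    and B_scale: "\<And>w p t. w \<in> H \<Longrightarrow> p \<in> H \<Longrightarrow> B w (t *\<^sub>R p) = t * B w p"
    and B_bound: "\<And>w. w \<in> H \<Longrightarrow> \<exists>K. \<forall>p\<in>H. \<bar>B w p\<bar> \<le> K * (1 + N p)"
    and c: "c > 0"
    and lower: "\<And>w p. w \<in> H \<Longrightarrow> p \<in> H \<Longrightarrow> E w + B w p + c * N p \<le> E (w + p)"
    and upper: "\<And>w p. w \<in> H \<Longrightarrow> p \<in> H \<Longrightarrow> E (w + p) \<le> E w + B w p + C * N p"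
  shows "\<exists>w\<in>H. (\<forall>p\<in>H. B w p = 0) \<and> (\<forall>w'\<in>H. (\<forall>p\<in>H. B w' p = 0) \<longrightarrow> N (w' - w) = 0)"
proof -
  have H_add: "w + p \<in> H" and H_diff: "w - p \<in> H" if "w \<in> H" "p \<in> H" for w p
    using that H by (auto simp: subspace_add subspace_diff)
  have H_scale: "t *\<^sub>R w \<in> H" if "w \<in> H" for w t
    using that H by (rule subspace_scale[rotated])
  have H_0: "0 \<in> H"
    using H by (simp add: subspace_0)
  \<comment> \<open>Scaling \<open>p\<close> by a free parameter \<open>t\<close> and dividing by
    \<open>t\<close> makes the bound adjustable, as in Young's inequality: either summand can be
    made small at the cost of the other.\<close>
  have B_bound': "\<exists>K>0. \<forall>t>0. \<forall>p\<in>H. \<bar>B w p\<bar> \<le> K / t + K * t * N p" if w: "w \<in> H" for w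
  proof -
    obtain K where K: "\<And>p. p \<in> H \<Longrightarrow> \<bar>B w p\<bar> \<le> K * (1 + N p)"
      using B_bound[OF w] by blast
    define K' where "K' = max K 1"
    have K': "\<bar>B w p\<bar> \<le> K' * (1 + N p)" if "p \<in> H" for p
    proof -
      have "K * (1 + N p) \<le> K' * (1 + N p)"
        using N_nonneg[OF that] by (intro mult_right_mono) (auto simp: K'_def)
      then show ?thesis
        using K[OF that] by (rule order_trans[rotated])
    qed
    have "\<bar>B w p\<bar> \<le> K' / t + K' * t * N p" if "t > 0" "p \<in> H" for t p
    proof -
      have "t * \<bar>B w p\<bar> = \<bar>B w (t *\<^sub>R p)\<bar>"
        using that w by (simp add: B_scale abs_mult)
      also have "\<dots> \<le> K' * (1 + t\<^sup>2 * N p)"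
        using K'[OF H_scale[OF that(2)], of t] that N_scale by simp
      finally show ?thesis
        using that by (simp add: field_simps power2_eq_square)
    qed
    moreover have "K' > 0"
      by (simp add: K'_def)
    ultimately show ?thesis
      by blast
  qed
  have bdd: "bdd_below (E ` H)"
  proof -
    obtain K where K: "K > 0" "\<And>t p. t > 0 \<Longrightarrow> p \<in> H \<Longrightarrow> \<bar>B 0 p\<bar> \<le> K / t + K * t * N p"
      using B_bound'[OF H_0] by blast
    \<comment> \<open>With \<open>t = c / K\<close> the term \<open>K * t * N p\<close> equals
      \<open>c * N p\<close> and is absorbed by the quadratic part of \<open>lower\<close>;
      \<open>K / t\<close> is the constant lost.\<close>
    have "E 0 - K\<^sup>2 / c \<le> E p" if "p \<in> H" for p
      using K(2)[of "c / K" p] lower[OF H_0 that] K(1) c that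
      by (simp add: power2_eq_square)
    then show ?thesis
      by (intro bdd_belowI2)
  qed
  define m where "m = Inf (E ` H)"
  have m_le: "m \<le> E p" if "p \<in> H" for p
    unfolding m_def using that bdd by (simp add: cInf_lower)
  have "\<exists>w\<in>H. E w < m + 1 / real (Suc k)" for k
  proof -
    have "Inf (E ` H) < m + 1 / real (Suc k)"
      by (simp add: m_def)
    then show ?thesis
      using cInf_lessD[of "E ` H"] H_0 by blast
  qed
  then obtain w where w: "\<And>k. w k \<in> H" "\<And>k. E (w k) < m + 1 / real (Suc k)"
    by metis
  have conv: "c / 2 * N (w k - w l) \<le> 1 / real (Suc k) + 1 / real (Suc l)" for k l
  proof -
    \<comment> \<open>\<open>lower\<close> is used at the midpoint \<open>z\<close> with the
      increments \<open>d\<close> and \<open>-d\<close>. In the sum the linear terms cancel, and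
      \<open>E z\<close> is at least \<open>m\<close>.\<close>
    define d where "d = (1/2) *\<^sub>R (w k - w l)"
    define z where "z = w l + d"
    have dz: "d \<in> H" "z \<in> H"
      using w H_add H_diff H_scale by (simp_all add: d_def z_def)
    have "d + d = w k - w l"
      by (simp add: d_def flip: scaleR_add_left)
    then have wk: "w k = z + d" and wl: "w l = z + (-1) *\<^sub>R d"
      by (simp_all add: z_def add.assoc)
    have "E z + B z d + c * N d \<le> E (w k)"
      using lower dz wk by simp
    moreover have "E z - B z d + c * N d \<le> E (w l)"
      using lower[OF dz(2) H_scale[OF dz(1)], of "-1"] wl B_scale[OF dz(2,1), of "-1"]
        N_scale[OF dz(1), of "-1"] by simp
    moreover have "c * N d = c / 4 * N (w k - w l)"
      unfolding d_def using w H_diff by (simp add: N_scale power2_eq_square)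
    ultimately show ?thesis
      using m_le[OF dz(2)] w(2)[of k] w(2)[of l] by linarith
  qed
  have "\<exists>K. \<forall>k\<ge>K. \<forall>l\<ge>K. N (w k - w l) < e" if "e > 0" for e
  proof -
    have "0 < c * e / 4"
      using that c by simp
    then obtain K where K: "1 / real (Suc K) < c * e / 4"
      by (rule nat_approx_posE)
    have "N (w k - w l) < e" if "k \<ge> K" "l \<ge> K" for k l
    proof -
      have "1 / real (Suc k) \<le> 1 / real (Suc K)" "1 / real (Suc l) \<le> 1 / real (Suc K)"
        using that by (simp_all add: frac_le)
      then have "c / 2 * N (w k - w l) < c / 2 * e"
        using conv[of k l] K by simp
      then show ?thesis
        using c by simp
    qed
    then show ?thesis
      by blast
  qed
  then obtain v where v: "v \<in> H" "(\<lambda>k. N (w k - v)) \<longlonglongrightarrow> 0"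
    using N_complete[of w] w(1) by blast
  \<comment> \<open>Lower semicontinuity along the sequence: \<open>lower\<close> at
    \<open>v\<close> bounds \<open>E v\<close> by \<open>E (w k)\<close> up to the linear term,
    which \<open>B_bound'\<close> with \<open>t = K / e\<close> makes at most \<open>e\<close> plus
    a multiple of \<open>N (w k - v)\<close>.\<close>
  have "E v \<le> m"
  proof -
    obtain K where K: "K > 0" "\<And>t p. t > 0 \<Longrightarrow> p \<in> H \<Longrightarrow> \<bar>B v p\<bar> \<le> K / t + K * t * N p"
      using B_bound'[OF v(1)] by blast
    have "E v \<le> m + e" if "e > 0" for e
    proof -
      have le: "E v \<le> m + 1 / real (Suc k) + e + (K * K / e) * N (w k - v)" for k
      proof -
        have d: "w k - v \<in> H"
          using w(1) v(1) H_diff by blast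
        have "E v + B v (w k - v) + c * N (w k - v) \<le> E (w k)"
          using lower[OF v(1) d] by simp
        moreover have "0 \<le> c * N (w k - v)"
          using c N_nonneg[OF d] by simp
        moreover have "\<bar>B v (w k - v)\<bar> \<le> e + (K * K / e) * N (w k - v)"
          using K(2)[of "K / e" "w k - v"] K(1) that d by simp
        ultimately show ?thesis
          using w(2)[of k] by linarith
      qed
      have "(\<lambda>k. m + 1 / real (Suc k) + e + (K * K / e) * N (w k - v))
          \<longlonglongrightarrow> m + 0 + e + (K * K / e) * 0"
        by (intro tendsto_intros v(2) LIMSEQ_Suc[OF lim_1_over_n])
      then show ?thesis
        using le LIMSEQ_le_const by fastforce
    qed
    then show ?thesis
      by (rule field_le_epsilon)
  qed
  have "B v p = 0" if p: "p \<in> H" for p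
  proof -
    have *: "0 \<le> t * B v p + \<bar>C\<bar> * N p * t\<^sup>2" for t
    proof -
      have "E v \<le> E (v + t *\<^sub>R p)"
        using \<open>E v \<le> m\<close> m_le[OF H_add[OF v(1) H_scale[OF p]]] by (rule order_trans)
      also have "\<dots> \<le> E v + t * B v p + C * (t\<^sup>2 * N p)"
        using upper[OF v(1) H_scale[OF p], of t] B_scale[OF v(1) p] N_scale[OF p] by simp
      also have "C * (t\<^sup>2 * N p) \<le> \<bar>C\<bar> * (t\<^sup>2 * N p)"
        using N_nonneg[OF p] by (intro mult_right_mono) auto
      finally show ?thesis
        by (simp add: mult_ac)
    qed
    \<comment> \<open>The increment \<open>t = - B v p / q\<close> would lower the energy if
      \<open>B v p\<close> were nonzero. The summand 1 makes \<open>q\<close> positive and strictly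
      larger than the quadratic coefficient.\<close>
    define q where "q = \<bar>C\<bar> * N p + 1"
    have q: "q > 0" and "\<bar>C\<bar> * N p < q"
      using N_nonneg[OF p] by (simp_all add: q_def add_nonneg_pos)
    have "(B v p)\<^sup>2 / q \<le> \<bar>C\<bar> * N p * ((B v p)\<^sup>2 / q\<^sup>2)"
      using *[of "- B v p / q"] by (simp add: power2_eq_square)
    then have le: "q * (B v p)\<^sup>2 \<le> \<bar>C\<bar> * N p * (B v p)\<^sup>2"
      using q by (simp add: field_simps power2_eq_square)
    show ?thesis
    proof (rule ccontr)
      assume "B v p \<noteq> 0"
      then have "0 < (B v p)\<^sup>2"
        by simp
      from mult_strict_right_mono[OF \<open>\<bar>C\<bar> * N p < q\<close> this] show False
        using le by linarith
    qed
  qed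
  \<comment> \<open>Two critical points: \<open>lower\<close> applied at each of them towards the
    other bounds the two energies against each other in both directions.\<close>
  moreover have "N (w' - v) = 0" if w': "w' \<in> H" "\<And>p. p \<in> H \<Longrightarrow> B w' p = 0" for w'
  proof -
    have d: "w' - v \<in> H" "v - w' \<in> H"
      using v(1) w'(1) H_diff by auto
    have "E v + c * N (w' - v) \<le> E w'"
      using lower[OF v(1) d(1)] \<open>\<And>p. p \<in> H \<Longrightarrow> B v p = 0\<close>[OF d(1)] by simp
    moreover have "E w' + c * N (v - w') \<le> E v"
      using lower[OF w'(1) d(2)] w'(2)[OF d(2)] by simp
    ultimately have "c * N (w' - v) + c * N (v - w') \<le> 0"
      by linarith
    moreover have "0 \<le> c * N (w' - v)" "0 \<le> c * N (v - w')"
      using c N_nonneg d by simp_all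
    ultimately have "c * N (w' - v) = 0"
      by linarith
    then show ?thesis
      using c by simp
  qed
  ultimately show ?thesis
    using v(1) by blast
qed

section \<open>Square-integrable functions\<close>

lemma L2_spaceI [intro?]:
  "u \<in> borel_measurable M \<Longrightarrow> integrable M (\<lambda>x. (norm (u x))\<^sup>2) \<Longrightarrow> u \<in> L2_space M"
  by (simp add: L2_space_def)

lemma L2_space_measurable [measurable_dest]: "u \<in> L2_space M \<Longrightarrow> u \<in> borel_measurable M"
  by (simp add: L2_space_def)

lemma L2_space_integrable: "u \<in> L2_space M \<Longrightarrow> integrable M (\<lambda>x. (norm (u x))\<^sup>2)"
  by (simp add: L2_space_def)

lemma norm_add_power2_le: "(norm (x + y))\<^sup>2 \<le> 2 * (norm x)\<^sup>2 + 2 * (norm y)\<^sup>2"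
  for x y :: "'a::real_inner"
proof -
  have "(norm (x + y))\<^sup>2 + (norm (x - y))\<^sup>2 = 2 * (norm x)\<^sup>2 + 2 * (norm y)\<^sup>2"
    by (simp add: power2_norm_eq_inner inner_simps inner_commute)
  then show ?thesis
    using zero_le_power2[of "norm (x - y)"] by linarith
qed

lemma abs_inner_le_power2: "\<bar>x \<bullet> y\<bar> \<le> (norm x)\<^sup>2 + (norm y)\<^sup>2" for x y :: "'a::real_inner"
proof -
  have "\<bar>x \<bullet> y\<bar> \<le> norm x * norm y"
    by (rule Cauchy_Schwarz_ineq2)
  moreover have "2 * (norm x * norm y) \<le> (norm x)\<^sup>2 + (norm y)\<^sup>2"
    using sum_squares_bound[of "norm x" "norm y"] by (simp add: mult.assoc)
  moreover have "0 \<le> norm x * norm y"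
    by simp
  ultimately show ?thesis
    by linarith
qed

lemma L2_space_add:
  assumes "u \<in> L2_space M" "v \<in> L2_space M"
  shows "(\<lambda>x. u x + v x) \<in> L2_space M"
proof
  note [measurable] = assms[THEN L2_space_measurable]
  show "(\<lambda>x. u x + v x) \<in> borel_measurable M"
    by measurable
  show "integrable M (\<lambda>x. (norm (u x + v x))\<^sup>2)"
  proof (rule Bochner_Integration.integrable_bound)
    show "integrable M (\<lambda>x. 2 * (norm (u x))\<^sup>2 + 2 * (norm (v x))\<^sup>2)"
      using assms[THEN L2_space_integrable] by simp
    show "AE x in M. norm ((norm (u x + v x))\<^sup>2) \<le> norm (2 * (norm (u x))\<^sup>2 + 2 * (norm (v x))\<^sup>2)"
      by (simp add: norm_add_power2_le)
  qed measurable
qed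

lemma L2_space_scaleR:
  assumes "u \<in> L2_space M"
  shows "(\<lambda>x. c *\<^sub>R u x) \<in> L2_space M"
proof
  note [measurable] = assms[THEN L2_space_measurable]
  show "(\<lambda>x. c *\<^sub>R u x) \<in> borel_measurable M"
    by measurable
  show "integrable M (\<lambda>x. (norm (c *\<^sub>R u x))\<^sup>2)"
    using L2_space_integrable[OF assms] by (simp add: power_mult_distrib)
qed

lemma L2_space_diff:
  assumes "u \<in> L2_space M" "v \<in> L2_space M"
  shows "(\<lambda>x. u x - v x) \<in> L2_space M"
  using L2_space_add[OF assms(1) L2_space_scaleR[OF assms(2), of "-1"]] by simp

lemma L2_space_zero: "(\<lambda>_. 0) \<in> L2_space M"
  by (simp add: L2_space_def)

lemma L2_space_const: "finite_measure M \<Longrightarrow> (\<lambda>_. c) \<in> L2_space M"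
  by (simp add: L2_space_def finite_measure.integrable_const)

lemma L2_space_bounded:
  assumes "finite_measure M" "u \<in> borel_measurable M" "\<And>x. x \<in> space M \<Longrightarrow> norm (u x) \<le> C"
  shows "u \<in> L2_space M"
proof
  note [measurable] = assms(2)
  show "integrable M (\<lambda>x. (norm (u x))\<^sup>2)"
  proof (rule finite_measure.integrable_const_bound[OF assms(1)])
    show "AE x in M. norm ((norm (u x))\<^sup>2) \<le> C\<^sup>2"
      using assms(3) by (auto simp: power_mono)
  qed measurable
qed fact

lemma L2_space_integrable_inner:
  assumes "u \<in> L2_space M" "v \<in> L2_space M"
  shows "integrable M (\<lambda>x. u x \<bullet> v x)"
proof (rule Bochner_Integration.integrable_bound)
  note [measurable] = assms[THEN L2_space_measurable]
  show "integrable M (\<lambda>x. (norm (u x))\<^sup>2 + (norm (v x))\<^sup>2)"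
    using assms[THEN L2_space_integrable] by simp
  show "AE x in M. norm (u x \<bullet> v x) \<le> norm ((norm (u x))\<^sup>2 + (norm (v x))\<^sup>2)"
    by (simp add: abs_inner_le_power2)
  show "(\<lambda>x. u x \<bullet> v x) \<in> borel_measurable M"
    by measurable
qed

lemma L2_space_integrable_mult:
  fixes u v :: "'a \<Rightarrow> real"
  assumes "u \<in> L2_space M" "v \<in> L2_space M"
  shows "integrable M (\<lambda>x. u x * v x)"
  using L2_space_integrable_inner[OF assms] by simp

lemma L2_abs_integral_inner_le:
  assumes "u \<in> L2_space M" "v \<in> L2_space M"
  shows "\<bar>LINT x|M. u x \<bullet> v x\<bar> \<le> (LINT x|M. (norm (u x))\<^sup>2) + (LINT x|M. (norm (v x))\<^sup>2)"
proof -
  have "\<bar>LINT x|M. u x \<bullet> v x\<bar> \<le> (LINT x|M. \<bar>u x \<bullet> v x\<bar>)"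
    by (rule integral_abs_bound)
  also have "\<dots> \<le> (LINT x|M. (norm (u x))\<^sup>2 + (norm (v x))\<^sup>2)"
    using assms by (intro integral_mono)
      (simp_all add: L2_space_integrable_inner L2_space_integrable abs_inner_le_power2)
  finally show ?thesis
    using assms by (simp add: L2_space_integrable)
qed

text \<open>Squared distances are kept throughout. The factor 2 takes the place of Minkowski's
  inequality, which is enough for limits equal to 0.\<close>

lemma L2_dist_triangle:
  assumes "u \<in> L2_space M" "v \<in> L2_space M" "w \<in> L2_space M"
  shows "(LINT x|M. (norm (u x - w x))\<^sup>2)
    \<le> 2 * (LINT x|M. (norm (u x - v x))\<^sup>2) + 2 * (LINT x|M. (norm (v x - w x))\<^sup>2)"
proof -
  have "(LINT x|M. (norm (u x - w x))\<^sup>2)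
      \<le> (LINT x|M. 2 * (norm (u x - v x))\<^sup>2 + 2 * (norm (v x - w x))\<^sup>2)"
  proof (rule integral_mono)
    show "(norm (u x - w x))\<^sup>2 \<le> 2 * (norm (u x - v x))\<^sup>2 + 2 * (norm (v x - w x))\<^sup>2" for x
      using norm_add_power2_le[of "u x - v x" "v x - w x"] by simp
  qed (use assms in \<open>simp_all add: L2_space_integrable L2_space_diff\<close>)
  then show ?thesis
    using assms by (simp add: L2_space_integrable L2_space_diff)
qed

section \<open>Convergence and completeness in L^2\<close>

lemma L2_tendsto_cong_limit:
  assumes "L2_tendsto M v u" "AE x in M. u x = u' x" "u' \<in> L2_space M"
  shows "L2_tendsto M v u'"
proof -
  have [measurable]: "\<And>n. v n \<in> borel_measurable M" "u \<in> borel_measurable M" "u' \<in> borel_measurable M"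
    using assms by (auto simp: L2_tendsto_def intro: L2_space_measurable)
  have "(LINT x|M. (norm (v n x - u x))\<^sup>2) = (LINT x|M. (norm (v n x - u' x))\<^sup>2)" for n
    using assms(2) by (intro integral_cong_AE) auto
  then show ?thesis
    using assms by (simp add: L2_tendsto_def)
qed

lemma L2_tendsto_add:
  assumes "L2_tendsto M v u" "L2_tendsto M v' u'"
  shows "L2_tendsto M (\<lambda>n x. v n x + v' n x) (\<lambda>x. u x + u' x)"
proof -
  have L: "v n \<in> L2_space M" "v' n \<in> L2_space M" "u \<in> L2_space M" "u' \<in> L2_space M" for n
    using assms by (auto simp: L2_tendsto_def)
  let ?d = "\<lambda>n. 2 * (LINT x|M. (norm (v n x - u x))\<^sup>2) + 2 * (LINT x|M. (norm (v' n x - u' x))\<^sup>2)"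
  have le: "(LINT x|M. (norm (v n x + v' n x - (u x + u' x)))\<^sup>2) \<le> ?d n" for n
    using L2_dist_triangle[of "\<lambda>x. v n x + v' n x" M "\<lambda>x. u x + v' n x" "\<lambda>x. u x + u' x"] L
    by (simp add: L2_space_add)
  have "?d \<longlonglongrightarrow> 2 * 0 + 2 * 0"
    using assms by (intro tendsto_intros) (simp_all add: L2_tendsto_def)
  then have "?d \<longlonglongrightarrow> 0"
    by simp
  then have "(\<lambda>n. LINT x|M. (norm (v n x + v' n x - (u x + u' x)))\<^sup>2) \<longlonglongrightarrow> 0"
    by (rule Lim_null_comparison[rotated]) (use le in \<open>intro always_eventually allI, simp\<close>)
  then show ?thesis
    using L by (simp add: L2_tendsto_def L2_space_add)
qed

lemma L2_tendsto_scaleR: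
  assumes "L2_tendsto M v u"
  shows "L2_tendsto M (\<lambda>n x. c *\<^sub>R v n x) (\<lambda>x. c *\<^sub>R u x)"
proof -
  have "(LINT x|M. (norm (c *\<^sub>R v n x - c *\<^sub>R u x))\<^sup>2) = c\<^sup>2 * (LINT x|M. (norm (v n x - u x))\<^sup>2)" for n
    by (simp add: power_mult_distrib flip: scaleR_diff_right)
  then show ?thesis
    using assms by (auto simp: L2_tendsto_def L2_space_scaleR tendsto_mult_right_zero)
qed

lemma L2_tendsto_zero: "L2_tendsto M (\<lambda>_ _. 0) (\<lambda>_. 0)"
  by (simp add: L2_tendsto_def L2_space_zero)

lemma L2_tendsto_integral_inner:
  assumes "L2_tendsto M v u" "q \<in> L2_space M"
  shows "(\<lambda>n. LINT x|M. v n x \<bullet> q x) \<longlonglongrightarrow> (LINT x|M. u x \<bullet> q x)"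
proof -
  have L: "v n \<in> L2_space M" "u \<in> L2_space M" for n
    using assms by (auto simp: L2_tendsto_def)
  define X where "X = (LINT x|M. (norm (q x))\<^sup>2)"
  define d where "d n = (LINT x|M. (norm (v n x - u x))\<^sup>2)" for n
  have "X \<ge> 0" "\<And>n. d n \<ge> 0"
    by (simp_all add: X_def d_def)
  have d: "d \<longlonglongrightarrow> 0"
    using assms by (simp add: L2_tendsto_def d_def[abs_def])
  \<comment> \<open>Again a free parameter: scaling \<open>q\<close> by \<open>t\<close> turns the
    additive bound for inner products into one that can be balanced between \<open>d n\<close> and
    \<open>X\<close>.\<close>
  have bound: "\<bar>(LINT x|M. v n x \<bullet> q x) - (LINT x|M. u x \<bullet> q x)\<bar> \<le> d n / t + X * t" if "t > 0" for n t
  proof -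
    have "t * \<bar>LINT x|M. (v n x - u x) \<bullet> q x\<bar> = \<bar>LINT x|M. (v n x - u x) \<bullet> (t *\<^sub>R q x)\<bar>"
      using that by (simp add: abs_mult)
    also have "\<dots> \<le> d n + t\<^sup>2 * X"
      using L2_abs_integral_inner_le[OF L2_space_diff[OF L, of n] L2_space_scaleR[OF assms(2), of t]]
      by (simp add: d_def X_def power_mult_distrib)
    finally have "\<bar>LINT x|M. (v n x - u x) \<bullet> q x\<bar> \<le> d n / t + X * t"
      using that by (simp add: field_simps power2_eq_square)
    moreover have "(LINT x|M. (v n x - u x) \<bullet> q x) = (LINT x|M. v n x \<bullet> q x) - (LINT x|M. u x \<bullet> q x)"
      using L assms(2) by (simp add: inner_diff_left L2_space_integrable_inner)
    ultimately show ?thesis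
      by simp
  qed
  show ?thesis
  proof (rule LIMSEQ_I)
    fix e :: real assume e: "e > 0"
    \<comment> \<open>Makes \<open>X * t\<close> less than \<open>e / 2\<close>, also when
      \<open>X = 0\<close>; the other half is left for \<open>d n / t\<close>.\<close>
    define t where "t = e / (2 * (X + 1))"
    have t: "t > 0" and Xt: "X * t < e / 2 + 0"
      using e \<open>X \<ge> 0\<close> by (simp_all add: t_def field_simps)
    have "eventually (\<lambda>n. d n < t * e / 2) sequentially"
      using order_tendstoD(2)[OF d, of "t * e / 2"] t e by simp
    then obtain N where N: "\<And>n. n \<ge> N \<Longrightarrow> d n < t * e / 2"
      by (auto simp: eventually_sequentially)
    have "norm ((LINT x|M. v n x \<bullet> q x) - (LINT x|M. u x \<bullet> q x)) < e" if "n \<ge> N" for n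
    proof -
      have "d n / t < e / 2"
        using N[OF that] t by (simp add: field_simps)
      then show ?thesis
        using bound[OF t, of n] Xt unfolding real_norm_def by linarith
    qed
    then show "\<exists>N. \<forall>n\<ge>N. norm ((LINT x|M. v n x \<bullet> q x) - (LINT x|M. u x \<bullet> q x)) < e"
      by blast
  qed
qed

text \<open>Riesz-Fischer: a rapidly Cauchy subsequence converges almost everywhere, and Fatou's
  lemma turns the Cauchy estimate for the whole sequence into an estimate against this
  limit.\<close>

lemma L2_complete:
  fixes w :: "nat \<Rightarrow> 'a \<Rightarrow> 'b::euclidean_space"
  assumes L: "\<And>k. w k \<in> L2_space M"
    and Cauchy: "\<And>e. 0 < e \<Longrightarrow> \<exists>K. \<forall>k\<ge>K. \<forall>l\<ge>K. (LINT x|M. (norm (w k x - w l x))\<^sup>2) < e"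
  shows "\<exists>u. L2_tendsto M w u"
proof -
  have [measurable]: "w k \<in> borel_measurable M" for k
    using L by (rule L2_space_measurable)
  have nn: "(\<integral>\<^sup>+x. ennreal ((norm (w k x - w l x))\<^sup>2) \<partial>M) = ennreal (LINT x|M. (norm (w k x - w l x))\<^sup>2)" for k l
    using L by (intro nn_integral_eq_integral) (auto intro!: L2_space_integrable L2_space_diff)
  obtain K where K: "\<And>j k l. k \<ge> K j \<Longrightarrow> l \<ge> K j \<Longrightarrow> (LINT x|M. (norm (w k x - w l x))\<^sup>2) < (1/8) ^ j"
  proof -
    have "\<exists>K. \<forall>k\<ge>K. \<forall>l\<ge>K. (LINT x|M. (norm (w k x - w l x))\<^sup>2) < (1/8) ^ j" for j :: nat
      by (rule Cauchy) simp
    then show ?thesis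
      using that by metis
  qed
  \<comment> \<open>\<open>r k\<close> lies beyond the thresholds of all levels up to
    \<open>k\<close>. Hence \<open>r k\<close> and \<open>r (Suc k)\<close> both exceed
    \<open>K k\<close>, and their squared distance is below \<open>(1/8) ^ k\<close>.\<close>
  define r where "r k = k + Max (K ` {..k})" for k
  have r: "r k \<ge> k" "j \<le> k \<Longrightarrow> r k \<ge> K j" for j k
    by (auto simp: r_def intro!: trans_le_add2 Max_ge)
  define d where "d k x = norm (w (r (Suc k)) x - w (r k) x)" for k x
  have [measurable]: "d k \<in> borel_measurable M" for k
    unfolding d_def by measurable
  \<comment> \<open>The weight 4^k is the square of 2^k. It leaves the summable bound (1/2)^k, and a
    finite weighted sum at \<open>x\<close> forces \<open>d k x\<close> below (1/2)^k
    eventually.\<close>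
  have "(\<integral>\<^sup>+x. (\<Sum>k. ennreal (4 ^ k * (d k x)\<^sup>2)) \<partial>M) = (\<Sum>k. \<integral>\<^sup>+x. ennreal (4 ^ k * (d k x)\<^sup>2) \<partial>M)"
    by (intro nn_integral_suminf) measurable
  also have "\<dots> \<le> (\<Sum>k. ennreal ((1/2) ^ k))"
  proof (intro suminf_le summableI)
    fix k
    have "(\<integral>\<^sup>+x. ennreal (4 ^ k * (d k x)\<^sup>2) \<partial>M) = ennreal (4 ^ k) * (\<integral>\<^sup>+x. ennreal ((d k x)\<^sup>2) \<partial>M)"
      by (simp add: ennreal_mult nn_integral_cmult)
    also have "\<dots> \<le> ennreal (4 ^ k) * ennreal ((1/8) ^ k)"
      using K[of k "r (Suc k)" "r k"] r unfolding d_def nn by (intro mult_left_mono ennreal_leI) auto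
    also have "\<dots> = ennreal ((1/2) ^ k)"
      by (simp add: ennreal_mult[symmetric] power_mult_distrib[symmetric])
    finally show "(\<integral>\<^sup>+x. ennreal (4 ^ k * (d k x)\<^sup>2) \<partial>M) \<le> ennreal ((1/2) ^ k)" .
  qed
  also have "\<dots> < \<infinity>"
    by (subst suminf_ennreal_eq[OF _ geometric_sums]) auto
  finally have "AE x in M. (\<Sum>k. ennreal (4 ^ k * (d k x)\<^sup>2)) \<noteq> \<infinity>"
    by (intro nn_integral_PInf_AE) auto
  then have conv: "AE x in M. convergent (\<lambda>k. w (r k) x)"
  proof eventually_elim
    case (elim x)
    have "summable (\<lambda>k. 4 ^ k * (d k x)\<^sup>2)"
      using elim by (intro summable_suminf_not_top) (auto simp: top_ennreal_def)
    then have "(\<lambda>k. 4 ^ k * (d k x)\<^sup>2) \<longlonglongrightarrow> 0"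
      by (rule summable_LIMSEQ_zero)
    then have "eventually (\<lambda>k. 4 ^ k * (d k x)\<^sup>2 < 1) sequentially"
      by (rule order_tendstoD) simp
    then have "eventually (\<lambda>k. norm (w (r (Suc k)) x - w (r k) x) \<le> (1/2) ^ k) sequentially"
    proof eventually_elim
      case (elim k)
      have "((2::real) ^ k)\<^sup>2 = 4 ^ k"
        by (simp add: power2_eq_square flip: power_mult_distrib)
      then have "(2 ^ k * d k x)\<^sup>2 < 1\<^sup>2"
        using elim by (simp add: power_mult_distrib)
      then have "2 ^ k * d k x < 1"
        by (rule power_less_imp_less_base) simp
      then show ?case
        by (simp add: d_def field_simps)
    qed
    then have "summable (\<lambda>k. w (r (Suc k)) x - w (r k) x)"
      by (rule summable_comparison_test_ev) simp
    then have "convergent (\<lambda>n. \<Sum>k<n. w (r (Suc k)) x - w (r k) x)"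
      by (simp add: summable_iff_convergent)
    then have "convergent (\<lambda>n. w (r n) x - w (r 0) x)"
      by (simp only: sum_lessThan_telescope[of "\<lambda>n. w (r n) x"])
    then show ?case
      by (simp add: convergent_diff_const_right_iff)
  qed
  define u where "u x = lim (\<lambda>k. w (r k) x)" for x
  have [measurable]: "u \<in> borel_measurable M"
    unfolding u_def by measurable
  have lim: "AE x in M. (\<lambda>k. w (r k) x) \<longlonglongrightarrow> u x"
    using conv unfolding u_def by (simp add: convergent_LIMSEQ_iff)
  have fatou: "(\<integral>\<^sup>+x. ennreal ((norm (w k x - u x))\<^sup>2) \<partial>M) \<le> ennreal e"
    if e: "\<forall>l\<ge>N. (LINT x|M. (norm (w k x - w l x))\<^sup>2) < e" for k N e
  proof -
    have "(\<integral>\<^sup>+x. ennreal ((norm (w k x - u x))\<^sup>2) \<partial>M)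
        = (\<integral>\<^sup>+x. liminf (\<lambda>l. ennreal ((norm (w k x - w (r l) x))\<^sup>2)) \<partial>M)"
    proof (intro nn_integral_cong_AE)
      show "AE x in M. ennreal ((norm (w k x - u x))\<^sup>2) = liminf (\<lambda>l. ennreal ((norm (w k x - w (r l) x))\<^sup>2))"
        using lim
      proof eventually_elim
        case (elim x)
        have "(\<lambda>l. ennreal ((norm (w k x - w (r l) x))\<^sup>2)) \<longlonglongrightarrow> ennreal ((norm (w k x - u x))\<^sup>2)"
          by (intro tendsto_ennrealI tendsto_intros elim)
        then show ?case
          by (rule lim_imp_Liminf[OF sequentially_bot, symmetric])
      qed
    qed
    also have "\<dots> \<le> liminf (\<lambda>l. \<integral>\<^sup>+x. ennreal ((norm (w k x - w (r l) x))\<^sup>2) \<partial>M)"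
      by (intro nn_integral_liminf) measurable
    also have "\<dots> \<le> limsup (\<lambda>l. \<integral>\<^sup>+x. ennreal ((norm (w k x - w (r l) x))\<^sup>2) \<partial>M)"
      by (rule Liminf_le_Limsup) simp
    also have "\<dots> \<le> ennreal e"
    proof (rule Limsup_bounded)
      have "(\<integral>\<^sup>+x. ennreal ((norm (w k x - w (r l) x))\<^sup>2) \<partial>M) \<le> ennreal e" if "l \<ge> N" for l
        using e r(1)[of l] that unfolding nn by (intro ennreal_leI less_imp_le) auto
      then show "eventually (\<lambda>l. (\<integral>\<^sup>+x. ennreal ((norm (w k x - w (r l) x))\<^sup>2) \<partial>M) \<le> ennreal e) sequentially"
        by (auto simp: eventually_sequentially)
    qed
    finally show ?thesis .
  qed
  have int: "integrable M (\<lambda>x. (norm (w k x - u x))\<^sup>2)" and le: "(LINT x|M. (norm (w k x - u x))\<^sup>2) \<le> e"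
    if e: "\<forall>l\<ge>N. (LINT x|M. (norm (w k x - w l x))\<^sup>2) < e" for k N e
  proof -
    have "0 \<le> (LINT x|M. (norm (w k x - w N x))\<^sup>2)"
      by simp
    also have "\<dots> < e"
      using e by simp
    finally have "0 \<le> e"
      by simp
    show *: "integrable M (\<lambda>x. (norm (w k x - u x))\<^sup>2)"
      using fatou[OF e] by (intro integrableI_bounded) (auto intro: le_less_trans)
    show "(LINT x|M. (norm (w k x - u x))\<^sup>2) \<le> e"
      using fatou[OF e] \<open>0 \<le> e\<close> by (subst (asm) nn_integral_eq_integral[OF *]) auto
  qed
  obtain N1 where N1: "\<forall>k\<ge>N1. \<forall>l\<ge>N1. (LINT x|M. (norm (w k x - w l x))\<^sup>2) < 1"
    using Cauchy[of 1] by auto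
  \<comment> \<open>The Fatou bound controls only differences; \<open>u\<close> itself is recovered
    by subtracting this one from \<open>w N1\<close>.\<close>
  have "(\<lambda>x. w N1 x - u x) \<in> L2_space M"
    using int[of N1 N1 1] N1 by (intro L2_spaceI) auto
  from L2_space_diff[OF L[of N1] this] have u: "u \<in> L2_space M"
    by simp
  have "(\<lambda>k. LINT x|M. (norm (w k x - u x))\<^sup>2) \<longlonglongrightarrow> 0"
  proof (rule LIMSEQ_I)
    fix e :: real assume "e > 0"
    then obtain N where "\<forall>k\<ge>N. \<forall>l\<ge>N. (LINT x|M. (norm (w k x - w l x))\<^sup>2) < e / 2"
      using Cauchy[of "e / 2"] by auto
    then have "(LINT x|M. (norm (w k x - u x))\<^sup>2) \<le> e / 2" if "k \<ge> N" for k
      using le[of N k "e / 2"] that by auto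
    then show "\<exists>N. \<forall>k\<ge>N. norm ((LINT x|M. (norm (w k x - u x))\<^sup>2) - 0) < e"
      using \<open>e > 0\<close> by (intro exI[of _ N]) force
  qed
  then show ?thesis
    using u L by (auto simp: L2_tendsto_def)
qed

section \<open>Smooth functions and bumps\<close>

lemma partial_deriv_at:
  assumes "(f has_derivative f') (at x)"
  shows "partial_deriv i f x = f' (axis i 1)"
  using frechet_derivative_at[OF assms] by (simp add: partial_deriv_def)

lemma Ck_on_Suc_imp_Ck_on:
  fixes f :: "real^'n \<Rightarrow> real"
  shows "Ck_on (Suc k) UNIV f \<Longrightarrow> Ck_on k UNIV f"
proof (induction k arbitrary: f)
  case 0
  then show ?case
    by (auto intro!: differentiable_imp_continuous_on simp: differentiable_on_def differentiable_at_withinI)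
next
  case (Suc k)
  then show ?case
    by (metis Ck_on.simps(2))
qed

lemma Ck_on_imp_continuous_on: "Ck_on k UNIV f \<Longrightarrow> continuous_on UNIV f"
  for f :: "real^'n \<Rightarrow> real"
proof (induction k)
  case (Suc k)
  from Ck_on_Suc_imp_Ck_on[OF Suc.prems] show ?case
    by (rule Suc.IH)
qed simp

lemma smooth_on_partial_deriv: "smooth_on U f \<Longrightarrow> smooth_on U (partial_deriv i f)"
  unfolding smooth_on_def by (metis Ck_on.simps(2))

lemma smooth_on_differentiable: "smooth_on U f \<Longrightarrow> x \<in> U \<Longrightarrow> f differentiable (at x)"
  unfolding smooth_on_def by (metis Ck_on.simps(2))

lemma smooth_on_continuous_on: "smooth_on U f \<Longrightarrow> continuous_on U f"
  unfolding smooth_on_def by (metis Ck_on.simps(1))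

section \<open>Algebra of C^k functions\<close>

lemma Ck_on_const: "Ck_on k UNIV (\<lambda>_::real^'n. c)"
proof (induction k arbitrary: c)
  case (Suc k)
  have "partial_deriv i (\<lambda>_::real^'n. c) = (\<lambda>_. 0)" for i
    by (rule ext, subst partial_deriv_at) (rule has_derivative_const, simp)
  then show ?case
    using Suc by simp
qed simp

lemma partial_deriv_add:
  fixes f g :: "real^'n \<Rightarrow> real"
  assumes "f differentiable (at x)" "g differentiable (at x)"
  shows "partial_deriv i (\<lambda>x. f x + g x) x = partial_deriv i f x + partial_deriv i g x"
  using partial_deriv_at[OF has_derivative_add[OF assms[THEN frechet_derivative_works[THEN iffD1]]]]
  by (simp add: partial_deriv_def)

lemma partial_deriv_mult:
  fixes f g :: "real^'n \<Rightarrow> real"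
  assumes "f differentiable (at x)" "g differentiable (at x)"
  shows "partial_deriv i (\<lambda>x. f x * g x) x = f x * partial_deriv i g x + partial_deriv i f x * g x"
  using partial_deriv_at[OF has_derivative_mult[OF assms[THEN frechet_derivative_works[THEN iffD1]]]]
  by (simp add: partial_deriv_def)

lemma Ck_on_add:
  fixes f g :: "real^'n \<Rightarrow> real"
  shows "Ck_on k UNIV f \<Longrightarrow> Ck_on k UNIV g \<Longrightarrow> Ck_on k UNIV (\<lambda>x. f x + g x)"
proof (induction k arbitrary: f g)
  case (Suc k)
  have "partial_deriv i (\<lambda>x. f x + g x) = (\<lambda>x. partial_deriv i f x + partial_deriv i g x)" for i
    using Suc.prems by (simp add: partial_deriv_add fun_eq_iff)
  then show ?case
    using Suc by (auto intro: differentiable_add)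
qed (simp add: continuous_on_add)

lemma Ck_on_mult:
  fixes f g :: "real^'n \<Rightarrow> real"
  shows "Ck_on k UNIV f \<Longrightarrow> Ck_on k UNIV g \<Longrightarrow> Ck_on k UNIV (\<lambda>x. f x * g x)"
proof (induction k arbitrary: f g)
  case (Suc k)
  have "partial_deriv i (\<lambda>x. f x * g x) = (\<lambda>x. f x * partial_deriv i g x + partial_deriv i f x * g x)" for i
    using Suc.prems by (simp add: partial_deriv_mult fun_eq_iff)
  moreover have "Ck_on k UNIV f" "Ck_on k UNIV g"
    using Suc.prems by (auto intro: Ck_on_Suc_imp_Ck_on)
  ultimately show ?case
    using Suc by (auto intro!: differentiable_mult Ck_on_add)
qed (simp add: continuous_on_mult)

lemma Ck_on_prod:
  fixes f :: "'a \<Rightarrow> real^'n \<Rightarrow> real"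
  assumes "finite I" "\<And>i. i \<in> I \<Longrightarrow> Ck_on k UNIV (f i)"
  shows "Ck_on k UNIV (\<lambda>x. \<Prod>i\<in>I. f i x)"
  using assms by (induction I rule: finite_induct) (simp_all add: Ck_on_const Ck_on_mult)

lemma smooth_on_add_scale:
  fixes f g :: "real^'n \<Rightarrow> real"
  assumes "smooth_on UNIV f" "smooth_on UNIV g"
  shows "smooth_on UNIV (\<lambda>x. f x + c * g x)"
  using assms unfolding smooth_on_def by (auto intro!: Ck_on_add Ck_on_mult Ck_on_const)

lemma grad_add_scale:
  fixes f g :: "real^'n \<Rightarrow> real"
  assumes "smooth_on UNIV f" "smooth_on UNIV g"
  shows "grad (\<lambda>x. f x + c * g x) x = grad f x + c *\<^sub>R grad g x"
proof -
  have d: "f differentiable (at x)" "g differentiable (at x)"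
    using assms by (auto intro: smooth_on_differentiable)
  have "partial_deriv i (\<lambda>x. c * g x) x = c * partial_deriv i g x" for i
    using partial_deriv_mult[of "\<lambda>_. c" x g i] d partial_deriv_at[OF has_derivative_const, of i c x]
    by simp
  then show ?thesis
    using d by (simp add: grad_def vec_eq_iff partial_deriv_add differentiable_mult)
qed

text \<open>The derivatives of \<open>exp (- 1 / t)\<close> on \<open>t > 0\<close> are of the form \<open>p (1 / t) * exp (- 1 / t)\<close>
  with a polynomial \<open>p\<close>.\<close>

definition flat_exp :: "real poly \<Rightarrow> real \<Rightarrow> real" where
  "flat_exp p t = (if t > 0 then poly p (1 / t) * exp (- 1 / t) else 0)"

lemma tendsto_poly_div_exp: "((\<lambda>y. poly p y * exp (- y)) \<longlongrightarrow> 0) at_top" for p :: "real poly"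
proof -
  have "((\<lambda>y. \<Sum>i\<le>degree p. coeff p i * (y ^ i / exp y)) \<longlongrightarrow> (\<Sum>i\<le>degree p. coeff p i * 0)) at_top"
    by (intro tendsto_intros tendsto_power_div_exp_0)
  then show ?thesis
    by (simp add: poly_altdef sum_distrib_right exp_minus divide_inverse mult.assoc)
qed

text \<open>With y = 1/t one has y' = -y^2, so the product rule gives the factor y^2, written
  \<open>[:0, 0, 1:]\<close>, and the difference p - p'. Closure of the family under differentiation
  is what carries the induction to smoothness.\<close>

lemma flat_exp_has_real_derivative:
  "(flat_exp p has_real_derivative flat_exp ([:0, 0, 1:] * (p - pderiv p)) t) (at t)"
proof (cases t "0::real" rule: linorder_cases)
  case less
  have "((\<lambda>_. 0) has_real_derivative 0) (at t)"
    by simp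
  then have "(flat_exp p has_real_derivative 0) (at t)"
    by (rule has_field_derivative_transform_within_open[where S = "{..<0}"])
      (use less in \<open>auto simp: flat_exp_def\<close>)
  then show ?thesis
    using less by (simp add: flat_exp_def)
next
  case greater
  have "((\<lambda>t. poly p (1 / t) * exp (- 1 / t)) has_real_derivative
      flat_exp ([:0, 0, 1:] * (p - pderiv p)) t) (at t)"
  proof (rule DERIV_cong)
    have "((\<lambda>t. 1 / t) has_real_derivative - (1 / t\<^sup>2)) (at t)"
      using greater by (auto intro!: derivative_eq_intros simp: power2_eq_square)
    from DERIV_mult[OF DERIV_chain2[OF poly_DERIV this] DERIV_chain2[OF DERIV_exp DERIV_minus[OF this]]]
    show "((\<lambda>t. poly p (1 / t) * exp (- 1 / t)) has_real_derivative
        poly (pderiv p) (1 / t) * (- (1 / t\<^sup>2)) * exp (- (1 / t))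
        + exp (- (1 / t)) * (1 / t\<^sup>2) * poly p (1 / t)) (at t)"
      by simp
    show "poly (pderiv p) (1 / t) * (- (1 / t\<^sup>2)) * exp (- (1 / t))
        + exp (- (1 / t)) * (1 / t\<^sup>2) * poly p (1 / t)
        = flat_exp ([:0, 0, 1:] * (p - pderiv p)) t"
      using greater by (simp add: flat_exp_def power2_eq_square algebra_simps)
  qed
  then show ?thesis
    by (rule has_field_derivative_transform_within_open[where S = "{0<..}"])
      (use greater in \<open>auto simp: flat_exp_def\<close>)
next
  case equal
  \<comment> \<open>Dividing by h multiplies the polynomial in 1/h by one more power, hence
    \<open>pCons 0 p\<close>; the exponential still wins.\<close>
  have "((\<lambda>h. flat_exp p h / h) \<longlongrightarrow> 0) (at_right 0)"
  proof -
    have "((\<lambda>h. poly (pCons 0 p) (inverse h) * exp (- inverse h)) \<longlongrightarrow> 0) (at_right 0)"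
      by (rule filterlim_compose[OF tendsto_poly_div_exp filterlim_inverse_at_top_right])
    moreover have "eventually (\<lambda>h::real. h > 0) (at_right 0)"
      by (simp add: eventually_at_right_less)
    then have "eventually (\<lambda>h. poly (pCons 0 p) (inverse h) * exp (- inverse h) = flat_exp p h / h) (at_right 0)"
      by eventually_elim (simp add: flat_exp_def divide_inverse)
    ultimately show ?thesis
      by (rule Lim_transform_eventually)
  qed
  moreover have "((\<lambda>h. flat_exp p h / h) \<longlongrightarrow> 0) (at_left 0)"
  proof (rule Lim_transform_eventually[OF tendsto_const])
    have "eventually (\<lambda>h::real. h < 0) (at_left 0)"
      by (auto simp: eventually_at_filter)
    then show "eventually (\<lambda>h. 0 = flat_exp p h / h) (at_left 0)"
      by eventually_elim (simp add: flat_exp_def)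
  qed
  ultimately have "((\<lambda>h. flat_exp p h / h) \<longlongrightarrow> 0) (at 0)"
    by (simp add: filterlim_split_at)
  then show ?thesis
    using equal by (simp add: DERIV_def flat_exp_def)
qed

lemma Ck_on_flat_exp: "Ck_on k UNIV (\<lambda>x::real^'n. flat_exp p (c * x $ j + d))"
proof (induction k arbitrary: p)
  case 0
  have "continuous_on UNIV (flat_exp p)"
    by (rule DERIV_continuous_on) (rule flat_exp_has_real_derivative[THEN has_field_derivative_at_within])
  then have "continuous_on UNIV (\<lambda>x::real^'n. flat_exp p (c * x $ j + d))"
    by (rule continuous_on_compose2) (auto intro!: continuous_intros)
  then show ?case
    by simp
next
  case (Suc k)
  let ?q = "[:0, 0, 1:] * (p - pderiv p)"
  have der: "((\<lambda>x::real^'n. flat_exp p (c * x $ j + d)) has_derivative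
      (\<lambda>h. flat_exp ?q (c * x $ j + d) * (c * h $ j))) (at x)" for x
  proof -
    have "((\<lambda>x::real^'n. c * x $ j + d) has_derivative (\<lambda>h. c * h $ j)) (at x)"
      by (auto intro!: derivative_eq_intros bounded_linear_imp_has_derivative bounded_linear_vec_nth)
    from has_derivative_compose[OF this has_field_derivative_imp_has_derivative[OF flat_exp_has_real_derivative[of p]]]
    show ?thesis by simp
  qed
  have "partial_deriv i (\<lambda>x::real^'n. flat_exp p (c * x $ j + d))
      = (\<lambda>x. flat_exp ?q (c * x $ j + d) * (c * axis i 1 $ j))" for i
    by (rule ext) (rule partial_deriv_at[OF der])
  then show ?case
    using der Suc by (auto intro!: Ck_on_mult Ck_on_const simp: differentiable_def)
qed

text \<open>The parameter \<open>m\<close> is a steepness: for \<open>m > 0\<close> the function is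
  nonzero exactly on the open box, and each factor exp(-1/(m t)) with t > 0 tends to 1 as
  \<open>m\<close> grows. This approximates the indicator of a box by test functions supported in
  its closure.\<close>

definition box_bump :: "real^'n \<Rightarrow> real^'n \<Rightarrow> real \<Rightarrow> real^'n \<Rightarrow> real" where
  "box_bump a b m x = (\<Prod>j\<in>UNIV. flat_exp 1 (m * (x $ j - a $ j)) * flat_exp 1 (m * (b $ j - x $ j)))"

lemma smooth_on_box_bump: "smooth_on UNIV (box_bump a b m)"
proof -
  have "Ck_on k UNIV (\<lambda>x. flat_exp 1 (m * (x $ j - a $ j)) * flat_exp 1 (m * (b $ j - x $ j)))" for k j
    using Ck_on_mult[OF Ck_on_flat_exp[of k 1 m j "- m * a $ j"] Ck_on_flat_exp[of k 1 "- m" j "m * b $ j"]]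
    by (simp add: algebra_simps)
  then show ?thesis
    unfolding smooth_on_def box_bump_def[abs_def] by (intro allI Ck_on_prod) auto
qed

lemma flat_exp_1_bounds: "0 \<le> flat_exp 1 t" "flat_exp 1 t \<le> 1"
  by (simp_all add: flat_exp_def)

lemma box_bump_bounds: "0 \<le> box_bump a b m x" "box_bump a b m x \<le> 1"
  unfolding box_bump_def
  by (auto intro!: prod_nonneg prod_le_1 mult_nonneg_nonneg mult_le_one flat_exp_1_bounds)

lemma box_bump_support: "m > 0 \<Longrightarrow> box_bump a b m x \<noteq> 0 \<longleftrightarrow> x \<in> box a b"
  by (auto simp: box_bump_def flat_exp_def mem_box_cart zero_less_mult_iff)

lemma test_function_box_bump:
  assumes "m > 0" "box a b \<subseteq> K" "compact K" "K \<subseteq> D"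
  shows "test_function D (box_bump a b m)"
proof -
  have "{x. box_bump a b m x \<noteq> 0} = box a b"
    using assms by (auto simp: box_bump_support)
  moreover have "closure (box a b) \<subseteq> K"
    using assms by (simp add: closure_minimal compact_imp_closed)
  moreover have "compact (closure (box a b))"
    by (simp add: bounded_box)
  ultimately show ?thesis
    using assms smooth_on_box_bump by (auto simp: test_function_def)
qed

lemma box_bump_tendsto: "(\<lambda>n. box_bump a b (real (Suc n)) x) \<longlonglongrightarrow> indicator (box a b) x"
proof (cases "x \<in> box a b")
  case True
  have lim: "(\<lambda>n. flat_exp 1 (real (Suc n) * t)) \<longlonglongrightarrow> 1" if "t > 0" for t
  proof -
    have "(\<lambda>n. exp (- ((1 / t) * (1 / real (Suc n))))) \<longlonglongrightarrow> exp (- ((1 / t) * 0))"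
      by (intro tendsto_intros LIMSEQ_Suc[OF lim_1_over_n])
    then show ?thesis
      using that by (simp add: flat_exp_def mult_ac)
  qed
  have "(\<lambda>n. box_bump a b (real (Suc n)) x) \<longlonglongrightarrow> (\<Prod>j\<in>(UNIV::'a set). 1 * 1)"
    unfolding box_bump_def using True by (intro tendsto_intros lim) (auto simp: mem_box_cart)
  then show ?thesis
    using True by simp
next
  case False
  then have "box_bump a b (real (Suc n)) x = 0" for n
    using box_bump_support[of "real (Suc n)" a b x] by simp
  then show ?thesis
    using False by simp
qed

section \<open>Weak gradients\<close>

text \<open>Bumps take values in [0, 1] and converge pointwise to the indicator of the box, so
  dominated convergence with majorant |f| carries the test identity over. The closed box keeps their
  supports compact inside \<open>D\<close>.\<close>

lemma lebesgue_on_integral_box_eq_0: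
  fixes f :: "real^'n \<Rightarrow> real"
  assumes D: "open D" and f: "integrable (lebesgue_on D) f"
    and test: "\<And>\<psi>. test_function D \<psi> \<Longrightarrow> (LINT x|lebesgue_on D. f x * \<psi> x) = 0"
    and box: "box c d \<subseteq> cbox a b" "cbox a b \<subseteq> D"
  shows "(LINT x|lebesgue_on D. indicator (box c d) x * f x) = 0"
proof -
  have [measurable]: "f \<in> borel_measurable (lebesgue_on D)"
    using f by simp
  have bump [measurable]: "box_bump c d m \<in> borel_measurable (lebesgue_on D)" for m
    using D by (intro continuous_imp_measurable_on_sets_lebesgue
      continuous_on_subset[OF smooth_on_continuous_on[OF smooth_on_box_bump]]) auto
  have [measurable]: "indicat_real (box c d) \<in> borel_measurable (lebesgue_on D)"
    by (intro measurable_restrict_space1 borel_measurable_indicator) auto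
  have "(\<lambda>n. LINT x|lebesgue_on D. f x * box_bump c d (real (Suc n)) x)
      \<longlonglongrightarrow> (LINT x|lebesgue_on D. f x * indicator (box c d) x)"
  proof (rule integral_dominated_convergence)
    show "integrable (lebesgue_on D) (\<lambda>x. \<bar>f x\<bar>)"
      using f by simp
    show "AE x in lebesgue_on D. (\<lambda>n. f x * box_bump c d (real (Suc n)) x) \<longlonglongrightarrow> f x * indicator (box c d) x"
      by (intro AE_I2 tendsto_intros box_bump_tendsto)
    show "AE x in lebesgue_on D. norm (f x * box_bump c d (real (Suc n)) x) \<le> \<bar>f x\<bar>" for n
    proof (intro AE_I2)
      fix x
      show "norm (f x * box_bump c d (real (Suc n)) x) \<le> \<bar>f x\<bar>"
        using box_bump_bounds[of c d "real (Suc n)" x] by (simp add: abs_mult mult_left_le)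
    qed
  qed measurable
  moreover have "(LINT x|lebesgue_on D. f x * box_bump c d (real (Suc n)) x) = 0" for n
    using box by (intro test test_function_box_bump[of _ _ _ "cbox a b"]) auto
  ultimately show ?thesis
    by (simp add: LIMSEQ_const_iff mult.commute)
qed

text \<open>Boxes are an intersection-stable generator of the Borel sets, so a Dynkin argument
  spreads the vanishing integrals to all Borel sets. It is run for a Borel representative
  \<open>G\<close>, since the generated sets are Borel rather than Lebesgue.\<close>

lemma AE_eq_0_if_box_integrals_eq_0:
  fixes F :: "'a::euclidean_space \<Rightarrow> real"
  assumes F: "integrable lebesgue F"
    and supp: "\<And>x. x \<notin> box a b \<Longrightarrow> F x = 0"
    and zero: "\<And>c d. box c d \<subseteq> box a b \<Longrightarrow> (LINT x|lebesgue. indicator (box c d) x * F x) = 0"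
  shows "AE x in lebesgue. F x = 0"
proof -
  obtain G where G [measurable]: "G \<in> borel_measurable lborel" and FG: "AE x in lborel. F x = G x"
    using completion_ex_borel_measurable_real[of F lborel] F by auto
  have FG': "AE x in lebesgue. F x = G x"
    using FG by (rule AE_completion)
  have [measurable]: "F \<in> borel_measurable lebesgue" "G \<in> borel_measurable lebesgue"
    using F by (auto intro: measurable_completion)
  have "integrable lebesgue G"
    using F FG' by (subst integrable_cong_AE[where g = F]) auto
  then have G_int: "integrable lborel G"
    by (simp add: integrable_completion)
  have eq: "(LINT x:A|lborel. G x) = (LINT x|lebesgue. indicator A x * F x)" if [measurable]: "A \<in> sets borel" for A
  proof -
    have [measurable]: "A \<in> sets lebesgue"
      by simp
    have "(LINT x:A|lborel. G x) = (LINT x|lebesgue. indicator A x * G x)"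
      by (simp add: set_lebesgue_integral_def integral_completion)
    also have "\<dots> = (LINT x|lebesgue. indicator A x * F x)"
      using FG' by (intro integral_cong_AE) auto
    finally show ?thesis .
  qed
  \<comment> \<open>Because \<open>F\<close> vanishes outside \<open>box a b\<close>, any box may be
    replaced by its intersection with \<open>box a b\<close>, which is again a box.\<close>
  have box: "(LINT x:box c d|lborel. G x) = 0" for c d
  proof -
    obtain c' d' where cd: "box c d \<inter> box a b = box c' d'"
      using box_Int_box by blast
    have "indicator (box c d) x * F x = indicator (box c' d') x * F x" for x
      using supp[of x] by (auto simp: indicator_def simp flip: cd)
    then have "(LINT x|lebesgue. indicator (box c d) x * F x) = (LINT x|lebesgue. indicator (box c' d') x * F x)"
      by (intro Bochner_Integration.integral_cong refl)
    also have "\<dots> = 0"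
      using cd by (intro zero) blast
    finally show ?thesis
      by (simp add: eq)
  qed
  \<comment> \<open>The complement step of the Dynkin argument subtracts from the total
    integral.\<close>
  have all: "(LINT x|lborel. G x) = 0"
  proof -
    have "(LINT x|lborel. G x) = (LINT x:UNIV|lborel. G x)"
      by (simp add: set_lebesgue_integral_def)
    also have "\<dots> = (LINT x|lebesgue. indicator (box a b) x * F x)"
      using supp by (subst eq) (auto simp: indicator_def intro!: Bochner_Integration.integral_cong)
    also have "\<dots> = 0"
      by (rule zero) simp
    finally show ?thesis .
  qed
  have "(LINT x:A|lborel. G x) = 0" if "A \<in> sets borel" for A
  proof -
    have gen: "sets borel = sigma_sets UNIV (range (\<lambda>(a, b). box a b :: 'a set))"
      by (subst borel_eq_box) (simp add: sets_measure_of)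
    have int: "Int_stable (range (\<lambda>(a, b). box a b :: 'a set))"
    proof (rule Int_stableI)
      fix P Q assume "P \<in> range (\<lambda>(a, b). box a b :: 'a set)" "Q \<in> range (\<lambda>(a, b). box a b :: 'a set)"
      then obtain a b c d where "P = box a b" "Q = box c d"
        by auto
      then obtain p q where "P \<inter> Q = box p q"
        using box_Int_box[of a b c d] by blast
      then show "P \<inter> Q \<in> range (\<lambda>(a, b). box a b :: 'a set)"
        by (auto intro!: image_eqI[of _ _ "(p, q)"])
    qed
    have Pow_UNIV_sub: "range (\<lambda>(a, b). box a b :: 'a set) \<subseteq> Pow UNIV"
      by simp
    have si: "set_integrable lborel B G" if "B \<in> sets borel" for B
      using G_int that unfolding set_integrable_def by (intro integrable_mult_indicator) auto
    have "A \<in> sigma_sets UNIV (range (\<lambda>(a, b). box a b :: 'a set))"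
      using that gen by simp
    then show ?thesis
    proof (induction rule: sigma_sets_induct_disjoint[OF int Pow_UNIV_sub, consumes 1, case_names basic empty compl union])
      case (basic A)
      then show ?case
        by (auto simp: box)
    next
      case empty
      then show ?case
        by (simp add: set_lebesgue_integral_def)
    next
      case (compl A)
      then have A: "A \<in> sets borel"
        by (simp add: gen)
      have "(LINT x:A \<union> (UNIV - A)|lborel. G x) = (LINT x:A|lborel. G x) + (LINT x:UNIV - A|lborel. G x)"
        using A by (intro set_integral_Un si) auto
      then show ?case
        using compl all by (simp add: set_lebesgue_integral_def)
    next
      case (union A)
      then have A: "A i \<in> sets borel" for i
        by (auto simp: gen)
      have "(LINT x:(\<Union>i. A i)|lborel. G x) = (\<Sum>i. (LINT x:A i|lborel. G x))"
        using A union(1) by (intro lebesgue_integral_countable_add si) (auto simp: disjoint_family_on_def)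
      then show ?case
        using union by simp
    qed
  qed
  then have "AE x in lborel. G x = 0"
    using G_int by (intro density_unique_real) (auto simp: set_lebesgue_integral_def)
  then have "AE x in lebesgue. G x = 0"
    by (rule AE_completion)
  with FG' show ?thesis
    by eventually_elim simp
qed

text \<open>An open set is a countable union of closed boxes. On each one the box integrals
  determine \<open>f\<close> in the interior, and the remaining faces are null.\<close>

lemma fundamental_lemma_calculus_of_variations:
  fixes f :: "real^'n \<Rightarrow> real"
  assumes D: "open D" and f: "integrable (lebesgue_on D) f"
    and test: "\<And>\<psi>. test_function D \<psi> \<Longrightarrow> (LINT x|lebesgue_on D. f x * \<psi> x) = 0"
  shows "AE x in lebesgue_on D. f x = 0"
proof -
  obtain \<D> where \<D>: "countable \<D>" "\<D> \<subseteq> Pow D" "\<And>X. X \<in> \<D> \<Longrightarrow> \<exists>a b. X = cbox a b" "\<Union>\<D> = D"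
    using open_countable_Union_open_cbox[OF D] by metis
  have Dsets: "D \<inter> space lebesgue \<in> sets lebesgue"
    using D by simp
  have ind: "integrable lebesgue (\<lambda>x. indicator D x * f x)"
    using f by (simp add: integrable_restrict_space[OF Dsets])
  have "AE x in lebesgue. x \<in> cbox a b \<longrightarrow> f x = 0" if ab: "cbox a b \<subseteq> D" for a b
  proof -
    have sub: "box a b \<subseteq> D"
      using ab box_subset_cbox by blast
    have "AE x in lebesgue. indicator (box a b) x * f x = 0"
    proof (rule AE_eq_0_if_box_integrals_eq_0)
      have "integrable lebesgue (\<lambda>x. indicator (box a b) x *\<^sub>R (indicator D x * f x))"
        using ind by (intro integrable_mult_indicator) auto
      also have "(\<lambda>x. indicator (box a b) x *\<^sub>R (indicator D x * f x)) = (\<lambda>x. indicator (box a b) x * f x)"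
        using sub by (auto simp: indicator_def fun_eq_iff)
      finally show "integrable lebesgue (\<lambda>x. indicator (box a b) x * f x)" .
      fix c d :: "real^'n"
      assume cd: "box c d \<subseteq> box a b"
      have "(LINT x|lebesgue. indicator (box c d) x * (indicator (box a b) x * f x))
          = (LINT x|lebesgue_on D. indicator (box c d) x * f x)"
        using cd sub unfolding integral_restrict_space[OF Dsets]
        by (intro Bochner_Integration.integral_cong) (auto simp: indicator_def)
      also have "\<dots> = 0"
        using cd ab box_subset_cbox[of a b] by (intro lebesgue_on_integral_box_eq_0[OF D f test]) auto
      finally show "(LINT x|lebesgue. indicator (box c d) x * (indicator (box a b) x * f x)) = 0" .
    qed simp
    moreover have "AE x in lebesgue. x \<notin> cbox a b - box a b"
      using negligible_frontier_interval[of a b] by (intro AE_not_in) (simp add: negligible_iff_null_sets)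
    ultimately show ?thesis
      by eventually_elim (auto simp: indicator_def)
  qed
  then have "AE x in lebesgue. x \<in> X \<longrightarrow> f x = 0" if "X \<in> \<D>" for X
    using \<D>(2,3) that by blast
  then have "AE x in lebesgue. \<forall>X\<in>\<D>. x \<in> X \<longrightarrow> f x = 0"
    unfolding AE_ball_countable[OF \<D>(1)] by blast
  then have "AE x in lebesgue. x \<in> D \<longrightarrow> f x = 0"
    by eventually_elim (use \<D>(4) in auto)
  then show ?thesis
    by (simp add: AE_restrict_space_iff[OF Dsets])
qed

section \<open>Weak gradients as a closed linear relation\<close>

lemma continuous_on_imp_L2_space:
  fixes q :: "real^'n \<Rightarrow> real"
  assumes "bounded D" "open D" "continuous_on UNIV q"
  shows "q \<in> L2_space (lebesgue_on D)"
proof -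
  have "compact (q ` closure D)"
    using assms by (intro compact_continuous_image continuous_on_subset[OF assms(3)]) auto
  then obtain C where "\<forall>y\<in>q ` closure D. norm y \<le> C"
    using compact_imp_bounded bounded_iff by metis
  then have C: "norm (q x) \<le> C" if "x \<in> D" for x
    using that closure_subset by blast
  show ?thesis
  proof (rule L2_space_bounded)
    show "finite_measure (lebesgue_on D)"
      using assms by (intro finite_measure_lebesgue_on lmeasurable_open)
    show "q \<in> borel_measurable (lebesgue_on D)"
      using assms by (intro continuous_imp_measurable_on_sets_lebesgue continuous_on_subset[OF assms(3)]) auto
  qed (use C in auto)
qed

lemma test_function_L2_space:
  assumes "bounded D" "open D" "test_function D \<psi>"
  shows "\<psi> \<in> L2_space (lebesgue_on D)" "partial_deriv i \<psi> \<in> L2_space (lebesgue_on D)"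
  using assms
  by (auto simp: test_function_def intro!: continuous_on_imp_L2_space smooth_on_continuous_on smooth_on_partial_deriv)

lemma L2_space_nth: "G \<in> L2_space M \<Longrightarrow> (\<lambda>x. G x $ i) \<in> L2_space M"
  for G :: "'a \<Rightarrow> real^'n"
proof
  assume G: "G \<in> L2_space M"
  note [measurable] = L2_space_measurable[OF G]
  have "(\<lambda>y::real^'n. y $ i) \<in> borel_measurable borel"
    by (intro borel_measurable_continuous_onI continuous_intros)
  from measurable_compose[OF L2_space_measurable[OF G] this]
  show m [measurable]: "(\<lambda>x. G x $ i) \<in> borel_measurable M" .
  show "integrable M (\<lambda>x. (norm (G x $ i))\<^sup>2)"
  proof (rule Bochner_Integration.integrable_bound[OF L2_space_integrable[OF G]])
    show "AE x in M. norm ((norm (G x $ i))\<^sup>2) \<le> norm ((norm (G x))\<^sup>2)"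
      using component_le_norm_cart by (intro AE_I2) (simp add: abs_le_square_iff[symmetric])
  qed measurable
qed

lemma has_weak_gradient_zero: "has_weak_gradient D (\<lambda>_. 0) (\<lambda>_. 0)"
  by (simp add: has_weak_gradient_def)

lemma has_weak_gradient_add_scale:
  assumes D: "bounded D" "open D"
    and L: "u \<in> L2_space (lebesgue_on D)" "u' \<in> L2_space (lebesgue_on D)"
      "G \<in> L2_space (lebesgue_on D)" "G' \<in> L2_space (lebesgue_on D)"
    and W: "has_weak_gradient D u G" "has_weak_gradient D u' G'"
  shows "has_weak_gradient D (\<lambda>x. u x + c * u' x) (\<lambda>x. G x + c *\<^sub>R G' x)"
  unfolding has_weak_gradient_def
proof (intro allI impI)
  fix \<psi> i
  assume \<psi>: "test_function D \<psi>"
  note int = L2_space_integrable_mult[OF L(1) test_function_L2_space(2)[OF D \<psi>]]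
    L2_space_integrable_mult[OF L(2) test_function_L2_space(2)[OF D \<psi>]]
    L2_space_integrable_mult[OF L2_space_nth[OF L(3)] test_function_L2_space(1)[OF D \<psi>]]
    L2_space_integrable_mult[OF L2_space_nth[OF L(4)] test_function_L2_space(1)[OF D \<psi>]]
  show "(LINT x|lebesgue_on D. (u x + c * u' x) * partial_deriv i \<psi> x)
      = - (LINT x|lebesgue_on D. (G x + c *\<^sub>R G' x) $ i * \<psi> x)"
    using W[unfolded has_weak_gradient_def, rule_format, OF \<psi>] int
    by (simp add: distrib_right mult.assoc)
qed

text \<open>A test function and its derivatives lie in L^2 of the bounded set \<open>D\<close>, so
  for a fixed test function both sides of the defining identity are continuous in L^2.\<close>

lemma has_weak_gradient_limit:
  assumes D: "bounded D" "open D"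
    and L: "L2_tendsto (lebesgue_on D) v u" "L2_tendsto (lebesgue_on D) V G"
    and W: "\<And>n. has_weak_gradient D (v n) (V n)"
  shows "has_weak_gradient D u G"
  unfolding has_weak_gradient_def
proof (intro allI impI)
  fix \<psi> i
  assume \<psi>: "test_function D \<psi>"
  have "(\<lambda>n. LINT x|lebesgue_on D. v n x * partial_deriv i \<psi> x)
      \<longlonglongrightarrow> (LINT x|lebesgue_on D. u x * partial_deriv i \<psi> x)"
    using L2_tendsto_integral_inner[OF L(1) test_function_L2_space(2)[OF D \<psi>]] by simp
  moreover have "(\<lambda>n. - (LINT x|lebesgue_on D. V n x $ i * \<psi> x))
      \<longlonglongrightarrow> - (LINT x|lebesgue_on D. G x $ i * \<psi> x)"
  proof -
    \<comment> \<open>Pairing with this vector field extracts the \<open>i\<close>-th component from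
      the vector-valued convergence.\<close>
    have "(\<lambda>x. \<psi> x *\<^sub>R axis i (1::real)) \<in> L2_space (lebesgue_on D)"
    proof
      have "\<psi> \<in> borel_measurable (lebesgue_on D)"
        using test_function_L2_space(1)[OF D \<psi>] by (rule L2_space_measurable)
      then show "(\<lambda>x. \<psi> x *\<^sub>R axis i (1::real)) \<in> borel_measurable (lebesgue_on D)"
        by measurable
      show "integrable (lebesgue_on D) (\<lambda>x. (norm (\<psi> x *\<^sub>R axis i (1::real)))\<^sup>2)"
        using L2_space_integrable[OF test_function_L2_space(1)[OF D \<psi>]] by simp
    qed
    from tendsto_minus[OF L2_tendsto_integral_inner[OF L(2) this]] show ?thesis
      by (simp add: inner_axis mult.commute)
  qed
  moreover have "(LINT x|lebesgue_on D. v n x * partial_deriv i \<psi> x)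
      = - (LINT x|lebesgue_on D. V n x $ i * \<psi> x)" for n
    using W \<psi> by (simp add: has_weak_gradient_def)
  ultimately show "(LINT x|lebesgue_on D. u x * partial_deriv i \<psi> x)
      = - (LINT x|lebesgue_on D. G x $ i * \<psi> x)"
    by (simp add: LIMSEQ_unique)
qed

text \<open>Each component of the difference is orthogonal to all test functions. Boundedness of
  \<open>D\<close> makes L^2 functions integrable, by pairing with the constant 1, so that the
  fundamental lemma applies.\<close>

lemma has_weak_gradient_unique:
  assumes D: "bounded D" "open D"
    and L: "G \<in> L2_space (lebesgue_on D)" "G' \<in> L2_space (lebesgue_on D)"
    and W: "has_weak_gradient D u G" "has_weak_gradient D u G'"
  shows "AE x in lebesgue_on D. G x = G' x"
proof -
  have fin: "finite_measure (lebesgue_on D)"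
    using D by (intro finite_measure_lebesgue_on lmeasurable_open)
  have "AE x in lebesgue_on D. G x $ i - G' x $ i = 0" for i
  proof (rule fundamental_lemma_calculus_of_variations[OF D(2)])
    show "integrable (lebesgue_on D) (\<lambda>x. G x $ i - G' x $ i)"
      using L2_space_integrable_mult[OF L2_space_nth[OF L(1), of i] L2_space_const[OF fin, of 1]]
        L2_space_integrable_mult[OF L2_space_nth[OF L(2), of i] L2_space_const[OF fin, of 1]] by simp
    fix \<psi>
    assume \<psi>: "test_function D \<psi>"
    show "(LINT x|lebesgue_on D. (G x $ i - G' x $ i) * \<psi> x) = 0"
      using L2_space_integrable_mult[OF L2_space_nth[OF L(1), of i] test_function_L2_space(1)[OF D \<psi>]]
        L2_space_integrable_mult[OF L2_space_nth[OF L(2), of i] test_function_L2_space(1)[OF D \<psi>]]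
        W[unfolded has_weak_gradient_def, rule_format, OF \<psi>]
      by (simp add: left_diff_distrib)
  qed
  then have "AE x in lebesgue_on D. \<forall>i\<in>UNIV. G x $ i - G' x $ i = 0"
    by (intro AE_finite_allI) auto
  then show ?thesis
    by eventually_elim (simp add: vec_eq_iff)
qed

section \<open>Hausdorff measure of graphs\<close>

text \<open>A box-counting condition: at every scale \<open>\<delta>\<close> up to 1, a constant
  times \<open>\<delta>\<close> to the power \<open>-s\<close> sets suffice. It implies finite
  Hausdorff measure, and having one scale per cover makes finite unions and grids easy to
  count.\<close>

definition finite_upper_content :: "nat \<Rightarrow> 'a::metric_space set \<Rightarrow> bool" where
  "finite_upper_content s A \<longleftrightarrow> (\<exists>C. \<forall>\<delta>\<in>{0<..1}. \<exists>\<F>. finite \<F> \<and> A \<subseteq> \<Union>\<F> \<and>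
     (\<forall>X\<in>\<F>. bounded X \<and> diameter X \<le> \<delta>) \<and> real (card \<F>) * \<delta> ^ s \<le> C)"

lemma finite_upper_content_empty: "finite_upper_content s {}"
  unfolding finite_upper_content_def by (intro exI[of _ 0] ballI exI[of _ "{}"]) auto

lemma finite_upper_content_subset:
  "finite_upper_content s B \<Longrightarrow> A \<subseteq> B \<Longrightarrow> finite_upper_content s A"
  unfolding finite_upper_content_def by (meson order_trans)

lemma finite_upper_content_Un:
  assumes "finite_upper_content s A" "finite_upper_content s B"
  shows "finite_upper_content s (A \<union> B)"
proof -
  obtain C where C: "\<And>\<delta>. \<delta> \<in> {0<..1} \<Longrightarrow> \<exists>\<F>. finite \<F> \<and> A \<subseteq> \<Union>\<F> \<and>
     (\<forall>X\<in>\<F>. bounded X \<and> diameter X \<le> \<delta>) \<and> real (card \<F>) * \<delta> ^ s \<le> C"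
    using assms(1) unfolding finite_upper_content_def by blast
  obtain C' where C': "\<And>\<delta>. \<delta> \<in> {0<..1} \<Longrightarrow> \<exists>\<F>. finite \<F> \<and> B \<subseteq> \<Union>\<F> \<and>
     (\<forall>X\<in>\<F>. bounded X \<and> diameter X \<le> \<delta>) \<and> real (card \<F>) * \<delta> ^ s \<le> C'"
    using assms(2) unfolding finite_upper_content_def by blast
  show ?thesis
    unfolding finite_upper_content_def
  proof (intro exI[of _ "C + C'"] ballI)
    fix \<delta> :: real
    assume \<delta>: "\<delta> \<in> {0<..1}"
    obtain \<F> where F: "finite \<F>" "A \<subseteq> \<Union>\<F>" "\<forall>X\<in>\<F>. bounded X \<and> diameter X \<le> \<delta>" "real (card \<F>) * \<delta> ^ s \<le> C"
      using C[OF \<delta>] by blast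
    obtain \<G> where G: "finite \<G>" "B \<subseteq> \<Union>\<G>" "\<forall>X\<in>\<G>. bounded X \<and> diameter X \<le> \<delta>" "real (card \<G>) * \<delta> ^ s \<le> C'"
      using C'[OF \<delta>] by blast
    have "real (card (\<F> \<union> \<G>)) * \<delta> ^ s \<le> (real (card \<F>) + real (card \<G>)) * \<delta> ^ s"
      using \<delta> card_Un_le[of \<F> \<G>] by (intro mult_right_mono) auto
    then have "real (card (\<F> \<union> \<G>)) * \<delta> ^ s \<le> C + C'"
      using F(4) G(4) by (simp add: distrib_right)
    then show "\<exists>\<H>. finite \<H> \<and> A \<union> B \<subseteq> \<Union>\<H> \<and>
       (\<forall>X\<in>\<H>. bounded X \<and> diameter X \<le> \<delta>) \<and> real (card \<H>) * \<delta> ^ s \<le> C + C'"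
      using F G by (intro exI[of _ "\<F> \<union> \<G>"]) auto
  qed
qed

lemma finite_upper_content_UN:
  "finite I \<Longrightarrow> (\<And>i. i \<in> I \<Longrightarrow> finite_upper_content s (A i)) \<Longrightarrow> finite_upper_content s (\<Union>i\<in>I. A i)"
  by (induction I rule: finite_induct) (simp_all add: finite_upper_content_empty finite_upper_content_Un)

lemma finite_upper_content_compact:
  assumes "compact \<Gamma>" "\<And>x. x \<in> \<Gamma> \<Longrightarrow> \<exists>r>0. finite_upper_content s (\<Gamma> \<inter> ball x r)"
  shows "finite_upper_content s \<Gamma>"
proof -
  obtain r where r: "\<And>x. x \<in> \<Gamma> \<Longrightarrow> r x > 0" "\<And>x. x \<in> \<Gamma> \<Longrightarrow> finite_upper_content s (\<Gamma> \<inter> ball x (r x))"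
    using assms(2) by metis
  have "\<Gamma> \<subseteq> (\<Union>x\<in>\<Gamma>. ball x (r x))"
    using r(1) by force
  then obtain T where T: "T \<subseteq> \<Gamma>" "finite T" "\<Gamma> \<subseteq> (\<Union>x\<in>T. ball x (r x))"
    using compactE_image[OF assms(1), of \<Gamma> "\<lambda>x. ball x (r x)"] by auto
  have "finite_upper_content s (\<Union>x\<in>T. \<Gamma> \<inter> ball x (r x))"
    using T r(2) by (intro finite_upper_content_UN) auto
  then show ?thesis
    by (rule finite_upper_content_subset) (use T(3) in auto)
qed

text \<open>A covering set of diameter at most \<open>\<delta>\<close> costs at most
  \<open>\<omega> * \<delta> ^ s\<close>, so the count in the hypothesis bounds the total cost by
  \<open>\<omega> * C\<close> uniformly in the scale.\<close>

lemma hausdorff_outer_finite: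
  assumes "finite_upper_content s A"
  shows "hausdorff_outer s A < \<infinity>"
proof -
  define \<omega> where "\<omega> = unit_ball_vol (real s)"
  have \<omega>: "\<omega> \<ge> 0"
    by (simp add: \<omega>_def)
  obtain C where C: "\<And>\<delta>. \<delta> \<in> {0<..1} \<Longrightarrow> \<exists>\<F>. finite \<F> \<and> A \<subseteq> \<Union>\<F> \<and>
     (\<forall>X\<in>\<F>. bounded X \<and> diameter X \<le> \<delta>) \<and> real (card \<F>) * \<delta> ^ s \<le> C"
    using assms(1) unfolding finite_upper_content_def by blast
  have "hausdorff_pre s \<delta> A \<le> ennreal (\<omega> * C)" if "\<delta> > 0" for \<delta>
  proof -
    define \<delta>' where "\<delta>' = min \<delta> 1"
    have \<delta>': "\<delta>' \<in> {0<..1}" "\<delta>' \<le> \<delta>" "\<delta>' > 0"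
      using that by (auto simp: \<delta>'_def)
    obtain \<F> where F: "finite \<F>" "A \<subseteq> \<Union>\<F>" "\<forall>X\<in>\<F>. bounded X \<and> diameter X \<le> \<delta>'"
        "real (card \<F>) * \<delta>' ^ s \<le> C"
      using C[OF \<delta>'(1)] by blast
    obtain h where h: "bij_betw h {0..<card \<F>} \<F>"
      using ex_bij_betw_nat_finite[OF F(1)] by blast
    \<comment> \<open>The finite cover becomes a sequence by padding with empty sets, which
      \<open>hausdorff_pre\<close> charges nothing even for \<open>s = 0\<close>.\<close>
    define c where "c i = (if i < card \<F> then h i else {})" for i
    have hF: "h i \<in> \<F>" if "i < card \<F>" for i
      using h that by (auto simp: bij_betw_def)
    have c: "bounded (c i)" "diameter (c i) \<le> \<delta>'" for i
      using F(3) hF \<delta>' by (auto simp: c_def)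
    have "A \<subseteq> (\<Union>i. c i)"
    proof
      fix x assume "x \<in> A"
      then obtain X where X: "X \<in> \<F>" "x \<in> X"
        using F(2) by auto
      then obtain i where "i < card \<F>" "h i = X"
        using h by (metis atLeastLessThan_iff bij_betw_def imageE)
      then show "x \<in> (\<Union>i. c i)"
        using X by (intro UN_I[of i]) (auto simp: c_def)
    qed
    then have "hausdorff_pre s \<delta> A
        \<le> (\<Sum>i. if c i = {} then 0 else ennreal (unit_ball_vol (real s) * (diameter (c i) / 2) ^ s))"
      unfolding hausdorff_pre_def using c \<delta>' by (intro INF_lower) (auto intro: order_trans)
    also have "\<dots> \<le> (\<Sum>i. if i < card \<F> then ennreal (\<omega> * \<delta>' ^ s) else 0)"
    proof (intro suminf_le summableI)
      fix i
      have "(diameter (c i) / 2) ^ s \<le> \<delta>' ^ s"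
        using c(2)[of i] diameter_ge_0[OF c(1)[of i]] by (intro power_mono) auto
      then have "unit_ball_vol (real s) * (diameter (c i) / 2) ^ s \<le> \<omega> * \<delta>' ^ s"
        using \<omega> unfolding \<omega>_def by (rule mult_left_mono)
      then show "(if c i = {} then 0 else ennreal (unit_ball_vol (real s) * (diameter (c i) / 2) ^ s))
          \<le> (if i < card \<F> then ennreal (\<omega> * \<delta>' ^ s) else 0)"
        by (auto simp: c_def intro!: ennreal_leI)
    qed
    also have "\<dots> = (\<Sum>i<card \<F>. ennreal (\<omega> * \<delta>' ^ s))"
      by (subst suminf_finite[of "{..<card \<F>}"]) auto
    also have "\<dots> = ennreal (\<Sum>i<card \<F>. \<omega> * \<delta>' ^ s)"
      using \<omega> \<delta>' by (intro sum_ennreal) auto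
    also have "\<dots> \<le> ennreal (\<omega> * C)"
    proof (rule ennreal_leI)
      show "(\<Sum>i<card \<F>. \<omega> * \<delta>' ^ s) \<le> \<omega> * C"
        using mult_left_mono[OF F(4) \<omega>] by (simp add: mult_ac)
    qed
    finally show ?thesis .
  qed
  then have "hausdorff_outer s A \<le> ennreal (\<omega> * C)"
    unfolding hausdorff_outer_def by (intro SUP_least) auto
  then show ?thesis
    by (rule le_less_trans) simp
qed

text \<open>The \<open>emeasure\<close> of a \<open>measure_of\<close> is the given set function or
  else 0, so the outer measure is an upper bound in either case.\<close>

lemma finite_measure_surface_measure:
  fixes \<Gamma> :: "(real^'n) set"
  assumes "finite_upper_content (CARD('n) - 1) \<Gamma>"
  shows "finite_measure (surface_measure \<Gamma>)"
proof (rule finite_measureI)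
  let ?M = "hausdorff_measure (CARD('n) - 1) :: (real^'n) measure"
  have "emeasure (surface_measure \<Gamma>) X \<le> emeasure ?M X" for X
    unfolding surface_measure_def restrict_space_def by (subst emeasure_measure_of_conv) auto
  also have "emeasure ?M X \<le> hausdorff_outer (CARD('n) - 1) X" for X
    unfolding hausdorff_measure_def by (subst emeasure_measure_of_conv) auto
  finally have "emeasure (surface_measure \<Gamma>) \<Gamma> < \<infinity>"
    using hausdorff_outer_finite[OF assms] by (meson le_less_trans)
  moreover have "space ?M = UNIV"
    unfolding hausdorff_measure_def by (rule space_measure_of) simp
  then have "space (surface_measure \<Gamma>) = \<Gamma>"
    by (simp add: surface_measure_def space_restrict_space)
  ultimately show "emeasure (surface_measure \<Gamma>) (space (surface_measure \<Gamma>)) \<noteq> \<infinity>"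
    by simp
qed

text \<open>\<open>q\<close> plays the role of an inverse chart: the set is controlled by all but one of the
  coordinates of \<open>q\<close>, so it is covered by about \<open>\<delta> ^ (1 - CARD('n))\<close> cells of size \<open>\<delta>\<close>.\<close>

lemma finite_upper_content_parametrised:
  fixes G :: "(real^'n) set" and q :: "real^'n \<Rightarrow> real^'n"
  assumes K: "K > 0" and R: "R > 0"
    and dist: "\<And>y y'. y \<in> G \<Longrightarrow> y' \<in> G \<Longrightarrow> dist y y' \<le> K * (\<Sum>j\<in>UNIV - {i}. \<bar>q y $ j - q y' $ j\<bar>)"
    and bound: "\<And>y j. y \<in> G \<Longrightarrow> \<bar>q y $ j\<bar> \<le> R"
  shows "finite_upper_content (CARD('n) - 1) G"
  unfolding finite_upper_content_def
proof (intro exI[of _ "(2 * R * K * (real (CARD('n) - 1) + 1) + 3) ^ (CARD('n) - 1)"] ballI)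
  define s where "s = CARD('n) - 1"
  have cardJ: "card (UNIV - {i}) = s"
    by (simp add: s_def)
  fix \<delta> :: real
  assume \<delta>: "\<delta> \<in> {0<..1}"
  \<comment> \<open>Within a grid cell of side \<open>\<eta>\<close> the \<open>s\<close>
    coordinates contribute at most \<open>K * s * \<eta>\<close>, which is below
    \<open>\<delta>\<close>. The summand 1 keeps the denominator positive for
    \<open>s = 0\<close>.\<close>
  define \<eta> where "\<eta> = \<delta> / (K * (real s + 1))"
  have \<eta>: "\<eta> > 0"
    using \<delta> K by (simp add: \<eta>_def)
  define N where "N = \<lceil>R / \<eta>\<rceil>"
  define m where "m y = (\<lambda>j\<in>UNIV - {i}. \<lfloor>q y $ j / \<eta>\<rfloor>)" for y
  define P where "P = (UNIV - {i}) \<rightarrow>\<^sub>E {- N..N}"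
  define cell where "cell p = {y \<in> G. m y = p}" for p
  have "0 < R / \<eta>"
    using R \<eta> by simp
  then have "N \<ge> 0"
    unfolding N_def by linarith
  have mP: "m y \<in> P" if "y \<in> G" for y
  proof -
    have "- N \<le> \<lfloor>q y $ j / \<eta>\<rfloor> \<and> \<lfloor>q y $ j / \<eta>\<rfloor> \<le> N" for j
    proof -
      have "\<bar>q y $ j / \<eta>\<bar> \<le> R / \<eta>"
        using bound[OF that, of j] \<eta> by (simp add: divide_right_mono)
      then have "\<bar>q y $ j / \<eta>\<bar> \<le> of_int N"
        unfolding N_def by linarith
      then show ?thesis
        by linarith
    qed
    then show ?thesis
      by (auto simp: m_def P_def)
  qed
  have finP: "finite P"
    unfolding P_def by (intro finite_PiE) auto
  have diam: "dist y y' \<le> \<delta>" if "y \<in> cell p" "y' \<in> cell p" for p y y'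
  proof -
    have "\<bar>q y $ j - q y' $ j\<bar> \<le> \<eta>" if "j \<in> UNIV - {i}" for j
    proof -
      have "\<lfloor>q y $ j / \<eta>\<rfloor> = \<lfloor>q y' $ j / \<eta>\<rfloor>"
        using \<open>y \<in> cell p\<close> \<open>y' \<in> cell p\<close> that
        unfolding cell_def m_def by (metis (mono_tags, lifting) mem_Collect_eq restrict_apply')
      then have "\<bar>q y $ j / \<eta> - q y' $ j / \<eta>\<bar> \<le> 1"
        by linarith
      then have "\<bar>q y $ j - q y' $ j\<bar> / \<eta> \<le> 1"
        using \<eta> by (simp flip: diff_divide_distrib)
      then show ?thesis
        using \<eta> by (simp add: field_simps)
    qed
    then have "(\<Sum>j\<in>UNIV - {i}. \<bar>q y $ j - q y' $ j\<bar>) \<le> real s * \<eta>"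
      using sum_bounded_above[of "UNIV - {i}" "\<lambda>j. \<bar>q y $ j - q y' $ j\<bar>" \<eta>] cardJ by simp
    then have "K * (\<Sum>j\<in>UNIV - {i}. \<bar>q y $ j - q y' $ j\<bar>) \<le> K * (real s * \<eta>)"
      using K by (intro mult_left_mono) auto
    moreover have "dist y y' \<le> K * (\<Sum>j\<in>UNIV - {i}. \<bar>q y $ j - q y' $ j\<bar>)"
      using that by (intro dist) (auto simp: cell_def)
    ultimately have "dist y y' \<le> K * (real s * \<eta>)"
      by (rule order_trans[rotated])
    also have "\<dots> = \<delta> * (real s / (real s + 1))"
      using K by (simp add: \<eta>_def)
    also have "\<dots> \<le> \<delta>"
      using \<delta> by (intro mult_left_le) auto
    finally show ?thesis .
  qed
  have "bounded (cell p) \<and> diameter (cell p) \<le> \<delta>" for p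
  proof
    show "bounded (cell p)"
      using diam unfolding bounded_two_points by blast
    show "diameter (cell p) \<le> \<delta>"
      using \<delta> diam by (intro diameter_le) (auto simp: dist_norm)
  qed
  moreover have "G \<subseteq> \<Union> (cell ` P)"
    using mP by (auto simp: cell_def)
  moreover have "real (card (cell ` P)) * \<delta> ^ s \<le> (2 * R * K * (real s + 1) + 3) ^ s"
  proof -
    have "card (cell ` P) \<le> card P"
      using finP by (rule card_image_le)
    also have "card P = nat (2 * N + 1) ^ s"
      unfolding P_def by (subst card_PiE) (auto simp: cardJ)
    finally have "real (card (cell ` P)) * \<delta> ^ s \<le> real (nat (2 * N + 1)) ^ s * \<delta> ^ s"
      using \<delta> by (intro mult_right_mono) (auto simp flip: of_nat_power)
    also have "\<dots> = ((2 * of_int N + 1) * \<delta>) ^ s"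
      using \<open>N \<ge> 0\<close> by (simp add: power_mult_distrib)
    also have "\<dots> \<le> (2 * R * K * (real s + 1) + 3) ^ s"
    proof (rule power_mono)
      \<comment> \<open>Origin of the constant: there are \<open>2 * N + 1\<close> grid intervals
        per axis, at most \<open>2 * R / \<eta> + 3\<close>. Multiplying by \<open>\<delta>\<close>,
        which is at most 1, gives the base of the power.\<close>
      have "of_int N \<le> R / \<eta> + 1"
        unfolding N_def by linarith
      then have "(2 * of_int N + 1) * \<delta> \<le> (2 * (R / \<eta> + 1) + 1) * \<delta>"
        using \<delta> by (intro mult_right_mono) auto
      also have "\<dots> = 2 * R * K * (real s + 1) + 3 * \<delta>"
        using \<delta> K by (simp add: \<eta>_def field_simps)
      also have "\<dots> \<le> 2 * R * K * (real s + 1) + 3"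
        using \<delta> by simp
      finally show "(2 * of_int N + 1) * \<delta> \<le> 2 * R * K * (real s + 1) + 3" .
      show "0 \<le> (2 * real_of_int N + 1) * \<delta>"
        using \<open>N \<ge> 0\<close> \<delta> by simp
    qed
    finally show ?thesis .
  qed
  ultimately show "\<exists>\<F>. finite \<F> \<and> G \<subseteq> \<Union>\<F> \<and> (\<forall>X\<in>\<F>. bounded X \<and> diameter X \<le> \<delta>) \<and>
      real (card \<F>) * \<delta> ^ (CARD('n) - 1) \<le> (2 * R * K * (real (CARD('n) - 1) + 1) + 3) ^ (CARD('n) - 1)"
    using finP unfolding s_def by (intro exI[of _ "cell ` P"]) auto
qed


text \<open>Continuous partial derivatives are bounded on the compact set and bound the operator
  norm of the derivative; convexity then allows the mean value inequality. The absolute value in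
  \<open>L\<close> keeps it nonnegative even when \<open>S\<close> is empty.\<close>

lemma Ck_on_imp_lipschitz:
  fixes h :: "real^'n \<Rightarrow> real"
  assumes h: "Ck_on (Suc k) UNIV h" and S: "compact S" "convex S"
  obtains L where "L \<ge> 0" "\<And>x y. x \<in> S \<Longrightarrow> y \<in> S \<Longrightarrow> \<bar>h x - h y\<bar> \<le> L * norm (x - y)"
proof -
  have C1: "Ck_on k UNIV (partial_deriv i h)" for i
    using h by simp
  have cont: "continuous_on UNIV (partial_deriv i h)" for i
    using C1[of i] by (rule Ck_on_imp_continuous_on)
  have "\<exists>M. \<forall>x\<in>S. \<bar>partial_deriv i h x\<bar> \<le> M" for i
  proof -
    have "compact (partial_deriv i h ` S)"
      using S by (intro compact_continuous_image continuous_on_subset[OF cont]) auto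
    then obtain M where "\<forall>y\<in>partial_deriv i h ` S. norm y \<le> M"
      using compact_imp_bounded bounded_iff by blast
    then show ?thesis
      by auto
  qed
  then obtain M where M: "\<And>i x. x \<in> S \<Longrightarrow> \<bar>partial_deriv i h x\<bar> \<le> M i"
    by metis
  define L where "L = \<bar>\<Sum>i\<in>UNIV. M i\<bar>"
  have "onorm (frechet_derivative h (at x)) \<le> L" if x: "x \<in> S" for x
  proof (rule onorm_le)
    fix v :: "real^'n"
    have "h differentiable (at x)"
      using h by simp
    then have lin: "linear (frechet_derivative h (at x))"
      by (rule linear_frechet_derivative)
    have "frechet_derivative h (at x) v = frechet_derivative h (at x) (\<Sum>i\<in>UNIV. v $ i *\<^sub>R axis i 1)"
      using basis_expansion[of v] by (simp add: scalar_mult_eq_scaleR)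
    also have "\<dots> = (\<Sum>i\<in>UNIV. v $ i * partial_deriv i h x)"
      by (simp add: linear_sum[OF lin] linear_cmul[OF lin] partial_deriv_def)
    finally have "norm (frechet_derivative h (at x) v) \<le> (\<Sum>i\<in>UNIV. \<bar>v $ i * partial_deriv i h x\<bar>)"
      by simp
    also have "\<dots> \<le> (\<Sum>i\<in>UNIV. norm v * M i)"
    proof (rule sum_mono)
      fix i
      show "\<bar>v $ i * partial_deriv i h x\<bar> \<le> norm v * M i"
        unfolding abs_mult using M[OF x, of i] component_le_norm_cart[of v i] by (intro mult_mono) auto
    qed
    also have "\<dots> \<le> L * norm v"
      unfolding L_def sum_distrib_left[symmetric] by (simp add: mult.commute mult_left_mono)
    finally show "norm (frechet_derivative h (at x) v) \<le> L * norm v" .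
  qed
  moreover have "(h has_derivative frechet_derivative h (at x)) (at x within S)" for x
  proof -
    have "h differentiable (at x)"
      using h by simp
    then show ?thesis
      by (rule has_derivative_at_withinI[OF frechet_derivative_works[THEN iffD1]])
  qed
  ultimately have "\<bar>h x - h y\<bar> \<le> L * norm (x - y)" if "x \<in> S" "y \<in> S" for x y
    using differentiable_bound[OF S(2), of h "\<lambda>x. frechet_derivative h (at x)" L x y] that by simp
  then show ?thesis
    using that[of L] by (simp add: L_def)
qed

text \<open>\<open>q\<close> projects along \<open>e\<close> onto the orthogonal hyperplane. Instead
  of rotating the axes, one drops an index \<open>i\<close> with \<open>e $ i\<close> nonzero:
  orthogonality to \<open>e\<close> recovers this coordinate of a difference of projections from the
  others.\<close>

lemma finite_upper_content_graph:
  fixes G :: "(real^'n) set"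
  assumes e: "norm e = 1" and h: "Ck_on (Suc k) UNIV h" and "bounded G"
    and graph: "\<And>y. y \<in> G \<Longrightarrow> y \<bullet> e = h (y - (y \<bullet> e) *\<^sub>R e)"
  shows "finite_upper_content (CARD('n) - 1) G"
proof -
  obtain R0 where R0: "R0 > 0" "\<And>y. y \<in> G \<Longrightarrow> norm y \<le> R0"
    using \<open>bounded G\<close> bounded_pos by blast
  define q where "q y = y - (y \<bullet> e) *\<^sub>R e" for y
  have q_norm: "norm (q y) \<le> 2 * R0" if "y \<in> G" for y
  proof -
    have "norm (q y) \<le> norm y + \<bar>y \<bullet> e\<bar>"
      using norm_triangle_ineq4[of y "(y \<bullet> e) *\<^sub>R e"] e by (simp add: q_def)
    also have "\<bar>y \<bullet> e\<bar> \<le> norm y"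
      using Cauchy_Schwarz_ineq2[of y e] e by simp
    finally show ?thesis
      using R0(2)[OF that] by simp
  qed
  obtain L where L: "L \<ge> 0"
    "\<And>x y. x \<in> cball 0 (2 * R0) \<Longrightarrow> y \<in> cball 0 (2 * R0) \<Longrightarrow> \<bar>h x - h y\<bar> \<le> L * norm (x - y)"
    using Ck_on_imp_lipschitz[OF h compact_cball convex_cball] by blast
  have "e \<noteq> 0"
    using e by auto
  then obtain i where i: "e $ i \<noteq> 0"
    by (auto simp: vec_eq_iff)
  \<comment> \<open>The second factor passes from the retained coordinates to the whole projection,
    the first from the projection to the point on the graph.\<close>
  define K where "K = (1 + L) * (1 + 1 / \<bar>e $ i\<bar>)"
  show ?thesis
  proof (rule finite_upper_content_parametrised)
    show "K > 0"
      using L(1) i by (simp add: K_def add_pos_nonneg)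
    show "2 * R0 > 0"
      using R0 by simp
    show "\<bar>q y $ j\<bar> \<le> 2 * R0" if "y \<in> G" for y j
      using component_le_norm_cart[of "q y" j] q_norm[OF that] by simp
    fix y y'
    assume y: "y \<in> G" "y' \<in> G"
    define z where "z = q y - q y'"
    define S where "S = (\<Sum>j\<in>UNIV - {i}. \<bar>z $ j\<bar>)"
    have "S \<ge> 0"
      by (simp add: S_def sum_nonneg)
    have "e \<bullet> e = 1"
      using e by (simp add: dot_square_norm)
    then have "z \<bullet> e = 0"
      by (simp add: z_def q_def inner_diff_left)
    then have "z $ i * e $ i = - (\<Sum>j\<in>UNIV - {i}. z $ j * e $ j)"
      by (simp add: inner_vec_def sum.remove[of UNIV i])
    then have "\<bar>z $ i\<bar> * \<bar>e $ i\<bar> = \<bar>\<Sum>j\<in>UNIV - {i}. z $ j * e $ j\<bar>"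
      by (metis abs_minus_cancel abs_mult)
    also have "\<dots> \<le> (\<Sum>j\<in>UNIV - {i}. \<bar>z $ j * e $ j\<bar>)"
      by (rule sum_abs)
    also have "\<dots> \<le> S"
      unfolding S_def
    proof (rule sum_mono)
      fix j
      show "\<bar>z $ j * e $ j\<bar> \<le> \<bar>z $ j\<bar>"
        using component_le_norm_cart[of e j] e by (simp add: abs_mult mult_left_le)
    qed
    finally have "\<bar>z $ i\<bar> \<le> S / \<bar>e $ i\<bar>"
      using i by (simp add: field_simps)
    then have "norm z \<le> S * (1 + 1 / \<bar>e $ i\<bar>)"
      using norm_le_l1_cart[of z] by (simp add: S_def sum.remove[of UNIV i] distrib_left)
    moreover have "norm (y - y') \<le> norm z + L * norm z"
    proof -
      have "y - y' = z + (y \<bullet> e - y' \<bullet> e) *\<^sub>R e"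
        by (simp add: z_def q_def algebra_simps)
      then have "norm (y - y') \<le> norm z + \<bar>y \<bullet> e - y' \<bullet> e\<bar>"
        using norm_triangle_ineq[of z "(y \<bullet> e - y' \<bullet> e) *\<^sub>R e"] e by simp
      moreover have "\<bar>y \<bullet> e - y' \<bullet> e\<bar> \<le> L * norm z"
        using L(2)[of "q y" "q y'"] y q_norm graph by (simp add: z_def q_def)
      ultimately show ?thesis
        by simp
    qed
    ultimately have "norm (y - y') \<le> (1 + L) * (S * (1 + 1 / \<bar>e $ i\<bar>))"
      using L(1) mult_left_mono[of "norm z" "S * (1 + 1 / \<bar>e $ i\<bar>)" "1 + L"] by (simp add: distrib_right)
    then show "dist y y' \<le> K * (\<Sum>j\<in>UNIV - {i}. \<bar>q y $ j - q y' $ j\<bar>)"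
      by (simp add: dist_norm K_def S_def z_def mult_ac)
  qed
qed

text \<open>Moving from \<open>y\<close> by a small amount in direction \<open>-e\<close> leaves the
  projection unchanged and lowers the height, so it leads strictly below the graph and hence into
  \<open>D\<close>.\<close>

lemma boundary_graph_at_imp_frontier:
  fixes D :: "(real^'n) set"
  assumes "boundary_graph_at P D y"
  shows "y \<notin> D" "y \<in> closure D"
proof -
  obtain e h r where e: "norm e = 1" and r: "r > 0" and y: "y \<bullet> e = h (y - (y \<bullet> e) *\<^sub>R e)"
    and D: "D \<inter> ball y r = {z \<in> ball y r. z \<bullet> e < h (z - (z \<bullet> e) *\<^sub>R e)}"
    using assms unfolding boundary_graph_at_def by blast
  have ee: "e \<bullet> e = 1"
    using e by (simp add: dot_square_norm)
  show "y \<notin> D"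
  proof
    assume "y \<in> D"
    then have "y \<in> D \<inter> ball y r"
      using r by simp
    then show False
      using y unfolding D by simp
  qed
  show "y \<in> closure D"
    unfolding closure_approachable
  proof (intro allI impI)
    fix t :: real
    assume t: "t > 0"
    define t' where "t' = min t r / 2"
    have t': "t' > 0" "t' < t" "t' < r"
      using t r by (auto simp: t'_def)
    define z where "z = y - t' *\<^sub>R e"
    have d: "dist z y = t'"
      using e t' by (simp add: z_def dist_norm)
    have "z \<bullet> e = y \<bullet> e - t'"
      by (simp add: z_def inner_diff_left ee)
    moreover from this have "z - (z \<bullet> e) *\<^sub>R e = y - (y \<bullet> e) *\<^sub>R e"
      by (simp add: z_def algebra_simps)
    ultimately have "z \<in> D \<inter> ball y r"
      unfolding D using y d t' by (simp add: dist_commute)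
    then show "\<exists>z\<in>D. dist z y < t"
      using d t' by auto
  qed
qed

text \<open>The hypothesis gives each point of \<open>\<Gamma>\<close> its own chart and does not
  say that nearby points of \<open>\<Gamma>\<close> lie on the same graph. That follows because
  every such point is outside \<open>D\<close> but in its closure, which in the chart at
  \<open>x\<close> gives the two inequalities.\<close>

lemma finite_upper_content_C2_boundary:
  fixes D \<Gamma> :: "(real^'n) set"
  assumes "compact \<Gamma>" and C2: "C2_boundary_along D \<Gamma>"
  shows "finite_upper_content (CARD('n) - 1) \<Gamma>"
proof (rule finite_upper_content_compact[OF \<open>compact \<Gamma>\<close>])
  fix x assume x: "x \<in> \<Gamma>"
  obtain e h r where e: "norm e = 1" and h: "Ck_on 2 UNIV h" and r: "r > 0"
    and D: "D \<inter> ball x r = {z \<in> ball x r. z \<bullet> e < h (z - (z \<bullet> e) *\<^sub>R e)}"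
    using C2 x unfolding C2_boundary_along_def boundary_graph_at_def by blast
  have h1: "Ck_on (Suc (Suc 0)) UNIV h"
    using h by (simp add: numeral_2_eq_2)
  then have cont: "continuous_on UNIV h"
    by (rule Ck_on_imp_continuous_on)
  have "y \<bullet> e = h (y - (y \<bullet> e) *\<^sub>R e)" if y: "y \<in> \<Gamma> \<inter> ball x r" for y
  proof (rule order_antisym)
    have "y \<notin> D" "y \<in> closure D"
      using C2 y boundary_graph_at_imp_frontier unfolding C2_boundary_along_def by blast+
    have "y \<notin> {z \<in> ball x r. z \<bullet> e < h (z - (z \<bullet> e) *\<^sub>R e)}"
      unfolding D[symmetric] using \<open>y \<notin> D\<close> by blast
    then show "h (y - (y \<bullet> e) *\<^sub>R e) \<le> y \<bullet> e"
      using y by simp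
    let ?Z = "{z. z \<bullet> e \<le> h (z - (z \<bullet> e) *\<^sub>R e)}"
    have "continuous_on UNIV (\<lambda>z. h (z - (z \<bullet> e) *\<^sub>R e))"
      by (rule continuous_on_compose2[OF cont]) (auto intro!: continuous_intros)
    then have "closed ?Z"
      by (intro closed_Collect_le continuous_intros)
    moreover have "ball x r \<inter> D \<subseteq> ?Z"
      unfolding Int_commute[of _ D] D by auto
    moreover have "y \<in> closure (ball x r \<inter> D)"
      using open_Int_closure_subset[of "ball x r" D] y \<open>y \<in> closure D\<close> by auto
    ultimately show "y \<bullet> e \<le> h (y - (y \<bullet> e) *\<^sub>R e)"
      using closure_minimal by blast
  qed
  then have "finite_upper_content (CARD('n) - 1) (\<Gamma> \<inter> ball x r)"
    by (intro finite_upper_content_graph[OF e h1]) auto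
  then show "\<exists>r>0. finite_upper_content (CARD('n) - 1) (\<Gamma> \<inter> ball x r)"
    using r by blast
qed

section \<open>Primitives of rate functions\<close>

text \<open>Minus the Cantor function shows that a derivative bound almost everywhere says nothing
  about increments by itself. For Lipschitz \<open>F\<close> the image of the exceptional null set
  is null, whereas a violated inequality would make this image contain a nondegenerate
  interval.\<close>

lemma AE_deriv_ge_imp_increment_ge:
  fixes F :: "real \<Rightarrow> real"
  assumes lip: "L-lipschitz_on UNIV F"
    and deriv: "AE r in lebesgue. \<exists>F'. (F has_real_derivative F') (at r) \<and> \<delta> \<le> F'"
    and "a \<le> b"
  shows "\<delta> * (b - a) \<le> F b - F a"
proof (rule ccontr)
  assume neg: "\<not> \<delta> * (b - a) \<le> F b - F a"
  with \<open>a \<le> b\<close> have ab: "a < b"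
    by (cases "a = b") auto
  have "(F b - F a) / (b - a) < \<delta>"
    using neg ab by (simp add: field_simps)
  \<comment> \<open>A slope strictly between the mean slope and \<open>\<delta>\<close>: after
    subtracting it, \<open>K\<close> decreases from \<open>a\<close> to \<open>b\<close> but has
    positive derivative off \<open>N\<close>.\<close>
  then obtain c where c: "(F b - F a) / (b - a) < c" "c < \<delta>"
    using dense by blast
  define K where "K x = F x - c * x" for x
  have Kba: "K b < K a"
    using c(1) ab by (simp add: K_def field_simps)
  have lipK: "\<bar>K y - K x\<bar> \<le> (L + \<bar>c\<bar>) * \<bar>y - x\<bar>" for x y
  proof -
    have "K y - K x = (F y - F x) - c * (y - x)"
      by (simp add: K_def algebra_simps)
    then have "\<bar>K y - K x\<bar> \<le> \<bar>F y - F x\<bar> + \<bar>c\<bar> * \<bar>y - x\<bar>"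
      by (metis abs_triangle_ineq4 abs_mult)
    then show ?thesis
      using lipschitz_onD[OF lip, of y x] by (simp add: dist_real_def algebra_simps)
  qed
  have contF: "continuous_on UNIV F"
    using lip by (rule lipschitz_on_continuous_on)
  have contK: "continuous_on S K" for S
    unfolding K_def[abs_def] by (intro continuous_intros continuous_on_subset[OF contF]) auto
  obtain N where N_sub: "{r \<in> space lebesgue. \<not> (\<exists>F'. (F has_real_derivative F') (at r) \<and> \<delta> \<le> F')} \<subseteq> N"
    and N_null: "emeasure lebesgue N = 0" "N \<in> sets lebesgue"
    using deriv by (rule AE_E)
  have N: "\<exists>F'. (F has_real_derivative F') (at r) \<and> \<delta> \<le> F'" if "r \<notin> N" for r
    using N_sub that unfolding space_completion space_lborel space_borel by blast
  txt \<open>The largest solution of \<open>K x = y\<close> in \<open>[a, b]\<close> cannot be a point with \<open>K' x > 0\<close>.\<close>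
  have "{K b<..<K a} \<subseteq> K ` N"
  proof
    fix y assume y: "y \<in> {K b<..<K a}"
    \<comment> \<open>Taking values at least \<open>y\<close> puts the point \<open>x + h\<close> of
      the contradiction into the set; the intermediate value theorem shows that its maximum
      \<open>x\<close> still satisfies \<open>K x = y\<close>.\<close>
    let ?S = "{a..b} \<inter> K -` {y..}"
    have "compact ?S"
      using continuous_closed_preimage[OF contK closed_atLeastAtMost closed_atLeast, of a b y]
      by (metis compact_eq_bounded_closed bounded_closed_interval bounded_Int)
    moreover have "a \<in> ?S"
      using y ab by auto
    ultimately obtain x where x: "x \<in> ?S" "\<forall>z\<in>?S. z \<le> x"
      using compact_attains_sup[of ?S] by blast
    obtain z where "x \<le> z" "z \<le> b" "K z = y"
      using IVT2'[of K b y x] x y contK by force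
    then have "K x = y"
      using x by (metis IntI atLeastAtMost_iff atLeast_iff order_antisym order_refl order_trans vimageI IntD1)
    moreover have "x < b"
      using x(1) y \<open>K x = y\<close> by (auto simp: order_le_less)
    have "x \<in> N"
    proof (rule ccontr)
      assume "x \<notin> N"
      then obtain F' where F': "(F has_real_derivative F') (at x)" "\<delta> \<le> F'"
        using N by blast
      have "(K has_real_derivative F' - c) (at x)"
        unfolding K_def[abs_def] by (auto intro!: derivative_eq_intros F'(1))
      then obtain d where d: "d > 0" "\<And>h. 0 < h \<Longrightarrow> h < d \<Longrightarrow> K x < K (x + h)"
        using DERIV_pos_inc_right[of K "F' - c" x] F'(2) c by auto
      define h where "h = min (d / 2) (b - x)"
      have h: "0 < h" "h < d" "x + h \<le> b"
        using d(1) \<open>x < b\<close> by (auto simp: h_def)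
      then have "x + h \<in> ?S"
        using d(2)[of h] \<open>K x = y\<close> x(1) by auto
      then show False
        using x(2) h(1) by force
    qed
    ultimately show "y \<in> K ` N"
      by blast
  qed
  moreover have "negligible (K ` N)"
  proof (rule negligible_locally_Lipschitz_image)
    show "negligible N"
      using N_null by (simp add: negligible_iff_null_sets null_sets_def)
    show "\<exists>T B. open T \<and> x \<in> T \<and> (\<forall>y\<in>N \<inter> T. norm (K y - K x) \<le> B * norm (y - x))" for x
      using lipK by (intro exI[of _ UNIV] exI[of _ "L + \<bar>c\<bar>"]) auto
  qed simp
  ultimately have "negligible (box (K b) (K a))"
    by (auto intro: negligible_subset)
  then have "box (K b) (K a) = {}"
    by (simp only: negligible_interval)
  then show False
    using Kba by simp
qed

lemma ge_at_0_if_deriv_sign: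
  fixes k :: "real \<Rightarrow> real"
  assumes k: "\<And>t. (k has_real_derivative k' t) (at t)"
    and sign: "\<And>t. 0 \<le> t \<Longrightarrow> 0 \<le> k' t" "\<And>t. t \<le> 0 \<Longrightarrow> k' t \<le> 0"
  shows "k 0 \<le> k s"
proof (cases "0 \<le> s")
  case True
  then show ?thesis
  proof (rule DERIV_nonneg_imp_nondecreasing)
    show "\<exists>y. (k has_real_derivative y) (at t) \<and> 0 \<le> y" if "0 \<le> t" for t
      using k[of t] sign(1)[OF that] by blast
  qed
next
  case False
  then have "s \<le> 0"
    by simp
  then show ?thesis
  proof (rule DERIV_nonpos_imp_nonincreasing)
    show "\<exists>y. (k has_real_derivative y) (at t) \<and> y \<le> 0" if "t \<le> 0" for t
      using k[of t] sign(2)[OF that] by blast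
  qed
qed

text \<open>Second-order Taylor bounds for a primitive of \<open>F\<close>, which is only Lipschitz.
  Subtracting tangent and parabola leaves a remainder whose derivative has the sign of the
  increment, by the increment bound for the lower estimate and the Lipschitz bound for the upper
  one.\<close>

lemma rate_function_primitive:
  assumes F: "rate_function \<delta>\<^sub>0 \<delta>\<^sub>1 F"
  obtains \<Phi> L where "L \<ge> 0" "\<And>r s. \<bar>F r - F s\<bar> \<le> L * \<bar>r - s\<bar>" "continuous_on UNIV \<Phi>"
    "\<And>r s. \<Phi> r + F r * s + \<delta>\<^sub>0 / 2 * s\<^sup>2 \<le> \<Phi> (r + s)"
    "\<And>r s. \<Phi> (r + s) \<le> \<Phi> r + F r * s + L / 2 * s\<^sup>2"
proof -
  obtain L where lip: "L-lipschitz_on UNIV F"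
    using F by (auto simp: rate_function_def)
  have L: "L \<ge> 0" "\<bar>F r - F s\<bar> \<le> L * \<bar>r - s\<bar>" for r s
    using lipschitz_on_nonneg[OF lip] lipschitz_onD[OF lip, of r s] by (auto simp: dist_real_def)
  have "AE r in lebesgue. \<exists>F'. (F has_real_derivative F') (at r) \<and> \<delta>\<^sub>0 \<le> F'"
    using F unfolding rate_function_def by (auto elim: eventually_mono)
  note inc = AE_deriv_ge_imp_increment_ge[OF lip this]
  have "isCont F x" for x
    using F by (simp add: rate_function_def continuous_on_eq_continuous_at)
  then obtain \<Phi> where \<Phi>: "\<And>x. (\<Phi> has_real_derivative F x) (at x)"
    using einterval_antiderivative[of "-\<infinity>" "\<infinity>" F] by (auto simp: has_real_derivative_iff_has_vector_derivative)
  have der: "((\<lambda>t. \<Phi> (r + t)) has_real_derivative F (r + t)) (at t)" for r t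
  proof -
    have "((\<lambda>t. r + t) has_real_derivative 1) (at t)"
      by (auto intro!: derivative_eq_intros)
    from DERIV_chain2[OF \<Phi> this] show ?thesis
      by simp
  qed
  have lower: "\<Phi> r + F r * s + \<delta>\<^sub>0 / 2 * s\<^sup>2 \<le> \<Phi> (r + s)" for r s
  proof -
    have "\<Phi> (r + 0) - F r * 0 - \<delta>\<^sub>0 / 2 * 0\<^sup>2 \<le> \<Phi> (r + s) - F r * s - \<delta>\<^sub>0 / 2 * s\<^sup>2"
    proof (rule ge_at_0_if_deriv_sign)
      show "((\<lambda>t. \<Phi> (r + t) - F r * t - \<delta>\<^sub>0 / 2 * t\<^sup>2) has_real_derivative
          F (r + t) - F r - \<delta>\<^sub>0 * t) (at t)" for t
        by (auto intro!: derivative_eq_intros der)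
      show "0 \<le> F (r + t) - F r - \<delta>\<^sub>0 * t" if "0 \<le> t" for t
        using inc[of r "r + t"] that by simp
      show "F (r + t) - F r - \<delta>\<^sub>0 * t \<le> 0" if "t \<le> 0" for t
        using inc[of "r + t" r] that by simp
    qed
    then show ?thesis
      by simp
  qed
  have upper: "\<Phi> (r + s) \<le> \<Phi> r + F r * s + L / 2 * s\<^sup>2" for r s
  proof -
    have "L / 2 * 0\<^sup>2 + F r * 0 - \<Phi> (r + 0) \<le> L / 2 * s\<^sup>2 + F r * s - \<Phi> (r + s)"
    proof (rule ge_at_0_if_deriv_sign)
      show "((\<lambda>t. L / 2 * t\<^sup>2 + F r * t - \<Phi> (r + t)) has_real_derivative
          L * t + F r - F (r + t)) (at t)" for t
        by (auto intro!: derivative_eq_intros der)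
      show "0 \<le> L * t + F r - F (r + t)" if "0 \<le> t" for t
        using L(2)[of "r + t" r] that by simp
      show "L * t + F r - F (r + t) \<le> 0" if "t \<le> 0" for t
        using L(2)[of "r + t" r] that by simp
    qed
    then show ?thesis
      by simp
  qed
  have "continuous_on UNIV \<Phi>"
    using \<Phi> by (meson DERIV_continuous_on has_field_derivative_at_within)
  then show ?thesis
    using that L lower upper by blast
qed

section \<open>Convex energies\<close>

lemma borel_measurable_matrix_form [measurable (raw)]:
  fixes M :: "'a \<Rightarrow> real^'n^'n"
  assumes [measurable]: "M \<in> borel_measurable \<mu>" "G \<in> borel_measurable \<mu>" "P \<in> borel_measurable \<mu>"
  shows "(\<lambda>x. (M x *v G x) \<bullet> P x) \<in> borel_measurable \<mu>"
proof -
  have nth: "(\<lambda>x. F x $ i) \<in> borel_measurable \<mu>" if "F \<in> borel_measurable \<mu>" for i and F :: "'a \<Rightarrow> real^'n"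
    using that by (rule measurable_compose) (intro borel_measurable_continuous_onI continuous_intros)
  have [measurable]: "(\<lambda>x. M x $ i $ j) \<in> borel_measurable \<mu>" for i j
    using assms(1) by (rule measurable_compose) (intro borel_measurable_continuous_onI continuous_intros)
  note [measurable] = nth[OF assms(2)] nth[OF assms(3)]
  show ?thesis
    unfolding inner_vec_def matrix_vector_mult_def by simp
qed

text \<open>The preimage of the exceptional set under scaling is its image under the inverse
  scaling, a Lipschitz image of a null set. This transfers the assumptions on the coefficient to the
  rescaled one.\<close>

lemma AE_lebesgue_scale:
  fixes P :: "'a::euclidean_space \<Rightarrow> bool"
  assumes "AE y in lebesgue. P y" "c \<noteq> 0"
  shows "AE x in lebesgue. P (c *\<^sub>R x)"
proof -
  obtain N where N_sub: "{y \<in> space lebesgue. \<not> P y} \<subseteq> N"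
    and N: "emeasure lebesgue N = 0" "N \<in> sets lebesgue"
    using assms(1) by (rule AE_E)
  have "negligible ((\<lambda>y. inverse c *\<^sub>R y) ` N)"
  proof (rule negligible_locally_Lipschitz_image)
    show "negligible N"
      using N by (simp add: negligible_iff_null_sets null_sets_def)
    show "\<exists>T B. open T \<and> x \<in> T \<and>
        (\<forall>y\<in>N \<inter> T. norm (inverse c *\<^sub>R y - inverse c *\<^sub>R x) \<le> B * norm (y - x))" for x
      by (intro exI[of _ UNIV] exI[of _ "\<bar>inverse c\<bar>"]) (simp flip: scaleR_diff_right)
  qed simp
  then have "AE x in lebesgue. x \<notin> (\<lambda>y. inverse c *\<^sub>R y) ` N"
    by (intro AE_not_in) (simp add: negligible_iff_null_sets)
  then show ?thesis
  proof eventually_elim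
    case (elim x)
    have "c *\<^sub>R x \<notin> N"
    proof
      assume "c *\<^sub>R x \<in> N"
      then have "inverse c *\<^sub>R (c *\<^sub>R x) \<in> (\<lambda>y. inverse c *\<^sub>R y) ` N"
        by (rule imageI)
      then show False
        using elim assms(2) by simp
    qed
    then show ?case
      using N_sub by auto
  qed
qed

definition symmetric_elliptic_on ::
  "'a measure \<Rightarrow> real \<Rightarrow> real \<Rightarrow> ('a \<Rightarrow> real^'n^'n) \<Rightarrow> bool" where
  "symmetric_elliptic_on \<mu> \<gamma>\<^sub>0 \<gamma>\<^sub>1 M \<longleftrightarrow> M \<in> borel_measurable \<mu> \<and>
     (AE x in \<mu>. \<forall>\<xi> \<eta>. (M x *v \<xi>) \<bullet> \<eta> = (M x *v \<eta>) \<bullet> \<xi>) \<and>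
     (AE x in \<mu>. \<forall>\<xi>. \<gamma>\<^sub>0 * (norm \<xi>)\<^sup>2 \<le> (M x *v \<xi>) \<bullet> \<xi> \<and> (M x *v \<xi>) \<bullet> \<xi> \<le> \<gamma>\<^sub>1 * (norm \<xi>)\<^sup>2)"

lemma symmetric_elliptic_on_rescaled:
  fixes A :: "real^'n \<Rightarrow> real^'n^'n"
  assumes A: "elliptic_coefficient \<gamma>\<^sub>0 \<gamma>\<^sub>1 A" and "c \<noteq> 0" and D: "D \<in> sets lebesgue"
  shows "symmetric_elliptic_on (lebesgue_on D) \<gamma>\<^sub>0 \<gamma>\<^sub>1 (\<lambda>x. A (c *\<^sub>R x))"
proof -
  have form: "(B *v \<xi>) \<bullet> \<xi> = (\<Sum>i\<in>UNIV. \<Sum>j\<in>UNIV. B $ i $ j * \<xi> $ i * \<xi> $ j)"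
    for B :: "real^'n^'n" and \<xi>
    by (simp add: inner_vec_def matrix_vector_mult_def sum_distrib_left sum_distrib_right mult_ac)
  have symm: "(B *v \<xi>) \<bullet> \<eta> = (B *v \<eta>) \<bullet> \<xi>" if "transpose B = B" for B :: "real^'n^'n" and \<xi> \<eta>
  proof -
    have "(B *v \<xi>) \<bullet> \<eta> = (transpose B *v \<xi>) \<bullet> \<eta>"
      using that by simp
    also have "\<dots> = \<xi> \<bullet> (B *v \<eta>)"
      by (simp only: transpose_matrix_vector dot_lmul_matrix)
    finally show ?thesis
      by (simp add: inner_commute)
  qed
  have AE_on: "AE x in lebesgue_on D. P (c *\<^sub>R x)" if "AE y in lebesgue. P y" for P
    using AE_lebesgue_scale[OF that \<open>c \<noteq> 0\<close>] D
    by (subst AE_restrict_space_iff) (auto elim: eventually_mono)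
  have meas: "A \<in> borel_measurable lebesgue"
    and AE_symm: "AE y in lebesgue. transpose (A y) = A y"
    and AE_form: "AE y in lebesgue. \<forall>\<xi>. \<gamma>\<^sub>0 * (norm \<xi>)\<^sup>2 \<le> (\<Sum>i\<in>UNIV. \<Sum>j\<in>UNIV. A y $ i $ j * \<xi> $ i * \<xi> $ j) \<and>
        (\<Sum>i\<in>UNIV. \<Sum>j\<in>UNIV. A y $ i $ j * \<xi> $ i * \<xi> $ j) \<le> \<gamma>\<^sub>1 * (norm \<xi>)\<^sup>2"
    using A by (auto simp: elliptic_coefficient_def)
  show ?thesis
    unfolding symmetric_elliptic_on_def
  proof (intro conjI)
    show "(\<lambda>x. A (c *\<^sub>R x)) \<in> borel_measurable (lebesgue_on D)"
      using measurable_compose[OF lebesgue_measurable_scaling meas, of c]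
      by (rule measurable_restrict_space1)
    show "AE x in lebesgue_on D. \<forall>\<xi> \<eta>. (A (c *\<^sub>R x) *v \<xi>) \<bullet> \<eta> = (A (c *\<^sub>R x) *v \<eta>) \<bullet> \<xi>"
      using AE_on[OF AE_symm] by eventually_elim (blast intro: symm)
    show "AE x in lebesgue_on D. \<forall>\<xi>. \<gamma>\<^sub>0 * (norm \<xi>)\<^sup>2 \<le> (A (c *\<^sub>R x) *v \<xi>) \<bullet> \<xi>
        \<and> (A (c *\<^sub>R x) *v \<xi>) \<bullet> \<xi> \<le> \<gamma>\<^sub>1 * (norm \<xi>)\<^sup>2"
      using AE_on[OF AE_form] unfolding form .
  qed
qed

section \<open>Quadratic elliptic energies\<close>

context
  fixes \<mu> :: "'a measure" and \<gamma>\<^sub>0 \<gamma>\<^sub>1 :: real and M :: "'a \<Rightarrow> real^'n^'n"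
  assumes ell: "symmetric_elliptic_on \<mu> \<gamma>\<^sub>0 \<gamma>\<^sub>1 M" and \<gamma>: "\<gamma>\<^sub>0 > 0" "\<gamma>\<^sub>1 > 0"
begin

lemma elliptic_measurable [measurable]: "M \<in> borel_measurable \<mu>"
  using ell by (simp add: symmetric_elliptic_on_def)

lemma elliptic_form_abs_le:
  "AE x in \<mu>. \<forall>\<xi> \<eta>. \<bar>(M x *v \<xi>) \<bullet> \<eta>\<bar> \<le> \<gamma>\<^sub>1 * ((norm \<xi>)\<^sup>2 + (norm \<eta>)\<^sup>2)"
proof -
  have "AE x in \<mu>. \<forall>\<xi> \<eta>. (M x *v \<xi>) \<bullet> \<eta> = (M x *v \<eta>) \<bullet> \<xi>"
    "AE x in \<mu>. \<forall>\<xi>. \<gamma>\<^sub>0 * (norm \<xi>)\<^sup>2 \<le> (M x *v \<xi>) \<bullet> \<xi> \<and> (M x *v \<xi>) \<bullet> \<xi> \<le> \<gamma>\<^sub>1 * (norm \<xi>)\<^sup>2"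
    using ell by (simp_all add: symmetric_elliptic_on_def)
  then show ?thesis
  proof eventually_elim
    case (elim x)
    show ?case
    proof (intro allI)
      fix \<xi> \<eta> :: "real^'n"
      have "0 \<le> (M x *v \<zeta>) \<bullet> \<zeta>" for \<zeta>
        using elim(2) \<gamma> by (meson mult_nonneg_nonneg less_imp_le zero_le_power2 order_trans)
      \<comment> \<open>Polarisation: nonnegativity at the sum and at the difference bounds twice
        the mixed term, of either sign, by the two diagonal terms.\<close>
      from this[of "\<xi> + \<eta>"] this[of "\<xi> - \<eta>"]
      have "2 * \<bar>(M x *v \<xi>) \<bullet> \<eta>\<bar> \<le> (M x *v \<xi>) \<bullet> \<xi> + (M x *v \<eta>) \<bullet> \<eta>"
        using elim(1)[rule_format, of \<eta> \<xi>]
        by (simp add: matrix_vector_right_distrib matrix_vector_mult_diff_distrib inner_simps)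
      also have "\<dots> \<le> \<gamma>\<^sub>1 * ((norm \<xi>)\<^sup>2 + (norm \<eta>)\<^sup>2)"
        using elim(2)[rule_format, of \<xi>] elim(2)[rule_format, of \<eta>] by (simp add: distrib_left)
      finally show "\<bar>(M x *v \<xi>) \<bullet> \<eta>\<bar> \<le> \<gamma>\<^sub>1 * ((norm \<xi>)\<^sup>2 + (norm \<eta>)\<^sup>2)"
        by linarith
    qed
  qed
qed

lemma elliptic_form_integrable:
  assumes "G \<in> L2_space \<mu>" "P \<in> L2_space \<mu>"
  shows "integrable \<mu> (\<lambda>x. (M x *v G x) \<bullet> P x)"
proof (rule Bochner_Integration.integrable_bound)
  note [measurable] = assms[THEN L2_space_measurable]
  show "integrable \<mu> (\<lambda>x. \<gamma>\<^sub>1 * ((norm (G x))\<^sup>2 + (norm (P x))\<^sup>2))"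
    using assms[THEN L2_space_integrable] by simp
  show "AE x in \<mu>. norm ((M x *v G x) \<bullet> P x) \<le> norm (\<gamma>\<^sub>1 * ((norm (G x))\<^sup>2 + (norm (P x))\<^sup>2))"
    using elliptic_form_abs_le
  proof eventually_elim
    case (elim x)
    then have "\<bar>(M x *v G x) \<bullet> P x\<bar> \<le> \<gamma>\<^sub>1 * ((norm (G x))\<^sup>2 + (norm (P x))\<^sup>2)"
      by blast
    also have "\<dots> \<le> \<bar>\<gamma>\<^sub>1 * ((norm (G x))\<^sup>2 + (norm (P x))\<^sup>2)\<bar>"
      by (rule abs_ge_self)
    finally show ?case
      by simp
  qed
  show "(\<lambda>x. (M x *v G x) \<bullet> P x) \<in> borel_measurable \<mu>"
    by measurable
qed

lemma elliptic_form_integral_abs_le: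
  assumes "G \<in> L2_space \<mu>" "P \<in> L2_space \<mu>"
  shows "\<bar>LINT x|\<mu>. (M x *v G x) \<bullet> P x\<bar>
    \<le> \<gamma>\<^sub>1 * ((LINT x|\<mu>. (norm (G x))\<^sup>2) + (LINT x|\<mu>. (norm (P x))\<^sup>2))"
proof -
  have "\<bar>LINT x|\<mu>. (M x *v G x) \<bullet> P x\<bar> \<le> (LINT x|\<mu>. \<bar>(M x *v G x) \<bullet> P x\<bar>)"
    by (rule integral_abs_bound)
  also have "\<dots> \<le> (LINT x|\<mu>. \<gamma>\<^sub>1 * ((norm (G x))\<^sup>2 + (norm (P x))\<^sup>2))"
  proof (rule integral_mono_AE)
    show "AE x in \<mu>. \<bar>(M x *v G x) \<bullet> P x\<bar> \<le> \<gamma>\<^sub>1 * ((norm (G x))\<^sup>2 + (norm (P x))\<^sup>2)"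
      using elliptic_form_abs_le by eventually_elim blast
  qed (use assms in \<open>simp_all add: elliptic_form_integrable L2_space_integrable\<close>)
  finally show ?thesis
    using assms by (simp add: L2_space_integrable)
qed

text \<open>The expansion is exact: symmetry merges the two mixed terms into one, and only the
  energy of \<open>P\<close> has to be estimated by ellipticity.\<close>

lemma elliptic_energy_bounds:
  assumes "G \<in> L2_space \<mu>" "P \<in> L2_space \<mu>"
  defines "e \<equiv> \<lambda>G. (LINT x|\<mu>. (M x *v G x) \<bullet> G x) / 2"
  shows "e G + (LINT x|\<mu>. (M x *v G x) \<bullet> P x) + \<gamma>\<^sub>0 / 2 * (LINT x|\<mu>. (norm (P x))\<^sup>2) \<le> e (\<lambda>x. G x + P x)"
    and "e (\<lambda>x. G x + P x) \<le> e G + (LINT x|\<mu>. (M x *v G x) \<bullet> P x) + \<gamma>\<^sub>1 / 2 * (LINT x|\<mu>. (norm (P x))\<^sup>2)"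
proof -
  note [measurable] = assms(1,2)[THEN L2_space_measurable]
  note int = elliptic_form_integrable
  have "(LINT x|\<mu>. (M x *v (G x + P x)) \<bullet> (G x + P x))
      = (LINT x|\<mu>. (M x *v G x) \<bullet> G x + 2 * ((M x *v G x) \<bullet> P x) + (M x *v P x) \<bullet> P x)"
  proof (rule integral_cong_AE)
    have "AE x in \<mu>. \<forall>\<xi> \<eta>. (M x *v \<xi>) \<bullet> \<eta> = (M x *v \<eta>) \<bullet> \<xi>"
      using ell by (simp add: symmetric_elliptic_on_def)
    then show "AE x in \<mu>. (M x *v (G x + P x)) \<bullet> (G x + P x)
        = (M x *v G x) \<bullet> G x + 2 * ((M x *v G x) \<bullet> P x) + (M x *v P x) \<bullet> P x"
    proof eventually_elim
      case (elim x)
      then show ?case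
        using elim[rule_format, of "P x" "G x"]
        by (simp add: matrix_vector_right_distrib inner_add_left inner_add_right)
    qed
  qed measurable
  also have "\<dots> = (LINT x|\<mu>. (M x *v G x) \<bullet> G x) + 2 * (LINT x|\<mu>. (M x *v G x) \<bullet> P x)
      + (LINT x|\<mu>. (M x *v P x) \<bullet> P x)"
    using assms(1,2) by (simp add: int)
  finally have eq: "e (\<lambda>x. G x + P x) = e G + (LINT x|\<mu>. (M x *v G x) \<bullet> P x) + e P"
    by (simp add: e_def)
  have AE: "AE x in \<mu>. \<forall>\<xi>. \<gamma>\<^sub>0 * (norm \<xi>)\<^sup>2 \<le> (M x *v \<xi>) \<bullet> \<xi> \<and> (M x *v \<xi>) \<bullet> \<xi> \<le> \<gamma>\<^sub>1 * (norm \<xi>)\<^sup>2"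
    using ell by (simp add: symmetric_elliptic_on_def)
  have "(LINT x|\<mu>. \<gamma>\<^sub>0 * (norm (P x))\<^sup>2) \<le> (LINT x|\<mu>. (M x *v P x) \<bullet> P x)"
    using assms(2) AE by (intro integral_mono_AE) (auto simp: int L2_space_integrable elim: eventually_mono)
  moreover have "(LINT x|\<mu>. (M x *v P x) \<bullet> P x) \<le> (LINT x|\<mu>. \<gamma>\<^sub>1 * (norm (P x))\<^sup>2)"
    using assms(2) AE by (intro integral_mono_AE) (auto simp: int L2_space_integrable elim: eventually_mono)
  ultimately show "e G + (LINT x|\<mu>. (M x *v G x) \<bullet> P x) + \<gamma>\<^sub>0 / 2 * (LINT x|\<mu>. (norm (P x))\<^sup>2) \<le> e (\<lambda>x. G x + P x)"
    "e (\<lambda>x. G x + P x) \<le> e G + (LINT x|\<mu>. (M x *v G x) \<bullet> P x) + \<gamma>\<^sub>1 / 2 * (LINT x|\<mu>. (norm (P x))\<^sup>2)"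
    unfolding eq by (simp_all add: e_def)
qed

end

text \<open>Lipschitz functions grow linearly, and finiteness of the measure makes the constant
  \<open>F 0\<close> square-integrable. For the surface term this is where the finite measure of
  \<open>\<Gamma>\<close> enters.\<close>

lemma L2_space_lipschitz_compose:
  fixes F :: "real \<Rightarrow> real"
  assumes \<mu>: "finite_measure \<mu>" and u: "u \<in> L2_space \<mu>"
    and F: "\<And>r s. \<bar>F r - F s\<bar> \<le> L * \<bar>r - s\<bar>" "continuous_on UNIV F"
  shows "(\<lambda>x. F (u x)) \<in> L2_space \<mu>"
proof
  note [measurable] = u[THEN L2_space_measurable] borel_measurable_continuous_onI[OF F(2)]
  show "(\<lambda>x. F (u x)) \<in> borel_measurable \<mu>"
    by measurable
  show "integrable \<mu> (\<lambda>x. (norm (F (u x)))\<^sup>2)"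
  proof (rule Bochner_Integration.integrable_bound)
    show "integrable \<mu> (\<lambda>x. 2 * L\<^sup>2 * (norm (u x))\<^sup>2 + 2 * (F 0)\<^sup>2)"
      using L2_space_integrable[OF u]
      by (intro Bochner_Integration.integrable_add integrable_mult_right finite_measure.integrable_const[OF \<mu>])
    show "AE x in \<mu>. norm ((norm (F (u x)))\<^sup>2) \<le> norm (2 * L\<^sup>2 * (norm (u x))\<^sup>2 + 2 * (F 0)\<^sup>2)"
    proof (intro AE_I2)
      fix x
      have "(F (u x))\<^sup>2 \<le> 2 * (F (u x) - F 0)\<^sup>2 + 2 * (F 0)\<^sup>2"
        using norm_add_power2_le[of "F (u x) - F 0" "F 0"] by simp
      also have "\<bar>F (u x) - F 0\<bar> \<le> \<bar>L * u x\<bar>"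
        using F(1)[of "u x" 0] mult_right_mono[OF abs_ge_self[of L] abs_ge_zero[of "u x"]]
        by (simp add: abs_mult)
      then have "(F (u x) - F 0)\<^sup>2 \<le> L\<^sup>2 * (u x)\<^sup>2"
        by (metis abs_le_square_iff power_mult_distrib)
      finally show "norm ((norm (F (u x)))\<^sup>2) \<le> norm (2 * L\<^sup>2 * (norm (u x))\<^sup>2 + 2 * (F 0)\<^sup>2)"
        by simp
    qed
  qed measurable
qed

text \<open>The pointwise Taylor bounds are integrated. Read at base point 0, they also show that
  \<open>\<Phi>\<close> grows at most quadratically, which gives the required integrability.\<close>

lemma convex_potential_bounds:
  fixes F \<Phi> :: "real \<Rightarrow> real" and u p :: "'a \<Rightarrow> real"
  assumes \<mu>: "finite_measure \<mu>" and u: "u \<in> L2_space \<mu>" and p: "p \<in> L2_space \<mu>"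
    and F: "\<And>r s. \<bar>F r - F s\<bar> \<le> L * \<bar>r - s\<bar>" "continuous_on UNIV F"
    and \<Phi>: "continuous_on UNIV \<Phi>" "\<And>r s. \<Phi> r + F r * s + c / 2 * s\<^sup>2 \<le> \<Phi> (r + s)"
      "\<And>r s. \<Phi> (r + s) \<le> \<Phi> r + F r * s + L / 2 * s\<^sup>2"
  shows "(LINT x|\<mu>. \<Phi> (u x)) + (LINT x|\<mu>. F (u x) * p x) + c / 2 * (LINT x|\<mu>. (norm (p x))\<^sup>2)
      \<le> (LINT x|\<mu>. \<Phi> (u x + p x))"
    and "(LINT x|\<mu>. \<Phi> (u x + p x))
      \<le> (LINT x|\<mu>. \<Phi> (u x)) + (LINT x|\<mu>. F (u x) * p x) + L / 2 * (LINT x|\<mu>. (norm (p x))\<^sup>2)"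
proof -
  have int_\<Phi>: "integrable \<mu> (\<lambda>x. \<Phi> (v x))" if v: "v \<in> L2_space \<mu>" for v
  proof (rule Bochner_Integration.integrable_bound)
    note [measurable] = v[THEN L2_space_measurable] borel_measurable_continuous_onI[OF \<Phi>(1)]
    have "integrable \<mu> v"
      using L2_space_integrable_mult[OF v L2_space_const[OF \<mu>, of 1]] by simp
    then show "integrable \<mu> (\<lambda>x. \<bar>\<Phi> 0\<bar> + \<bar>F 0\<bar> * \<bar>v x\<bar> + (\<bar>c\<bar> / 2 + \<bar>L\<bar> / 2) * (norm (v x))\<^sup>2)"
      using L2_space_integrable[OF v]
      by (intro Bochner_Integration.integrable_add integrable_mult_right integrable_abs
        finite_measure.integrable_const[OF \<mu>])
    show "AE x in \<mu>. norm (\<Phi> (v x))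
        \<le> norm (\<bar>\<Phi> 0\<bar> + \<bar>F 0\<bar> * \<bar>v x\<bar> + (\<bar>c\<bar> / 2 + \<bar>L\<bar> / 2) * (norm (v x))\<^sup>2)"
    proof (intro AE_I2)
      fix x
      have "\<Phi> 0 + F 0 * v x + c / 2 * (v x)\<^sup>2 \<le> \<Phi> (v x)" "\<Phi> (v x) \<le> \<Phi> 0 + F 0 * v x + L / 2 * (v x)\<^sup>2"
        using \<Phi>(2)[of 0 "v x"] \<Phi>(3)[of 0 "v x"] by simp_all
      moreover have "\<bar>F 0 * v x\<bar> = \<bar>F 0\<bar> * \<bar>v x\<bar>" "\<bar>c / 2 * (v x)\<^sup>2\<bar> = \<bar>c\<bar> / 2 * (v x)\<^sup>2"
          "\<bar>L / 2 * (v x)\<^sup>2\<bar> = \<bar>L\<bar> / 2 * (v x)\<^sup>2"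
        by (simp_all add: abs_mult)
      ultimately have "\<bar>\<Phi> (v x)\<bar> \<le> \<bar>\<Phi> 0\<bar> + \<bar>F 0\<bar> * \<bar>v x\<bar> + (\<bar>c\<bar> / 2 * (v x)\<^sup>2 + \<bar>L\<bar> / 2 * (v x)\<^sup>2)"
        by linarith
      then show "norm (\<Phi> (v x)) \<le> norm (\<bar>\<Phi> 0\<bar> + \<bar>F 0\<bar> * \<bar>v x\<bar> + (\<bar>c\<bar> / 2 + \<bar>L\<bar> / 2) * (norm (v x))\<^sup>2)"
        by (simp add: distrib_right)
    qed
    show "(\<lambda>x. \<Phi> (v x)) \<in> borel_measurable \<mu>"
      by measurable
  qed
  have int_F: "integrable \<mu> (\<lambda>x. F (u x) * p x)"
    by (rule L2_space_integrable_mult[OF L2_space_lipschitz_compose[OF \<mu> u F] p])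
  note int = int_\<Phi>[OF u] int_\<Phi>[OF L2_space_add[OF u p]] int_F L2_space_integrable[OF p]
  have "(LINT x|\<mu>. \<Phi> (u x) + F (u x) * p x + c / 2 * (norm (p x))\<^sup>2) \<le> (LINT x|\<mu>. \<Phi> (u x + p x))"
    using int \<Phi>(2) by (intro integral_mono Bochner_Integration.integrable_add integrable_mult_right) simp_all
  then show "(LINT x|\<mu>. \<Phi> (u x)) + (LINT x|\<mu>. F (u x) * p x) + c / 2 * (LINT x|\<mu>. (norm (p x))\<^sup>2)
      \<le> (LINT x|\<mu>. \<Phi> (u x + p x))"
    using int by simp
  have "(LINT x|\<mu>. \<Phi> (u x + p x)) \<le> (LINT x|\<mu>. \<Phi> (u x) + F (u x) * p x + L / 2 * (norm (p x))\<^sup>2)"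
    using int \<Phi>(3) by (intro integral_mono Bochner_Integration.integrable_add integrable_mult_right) simp_all
  then show "(LINT x|\<mu>. \<Phi> (u x + p x))
      \<le> (LINT x|\<mu>. \<Phi> (u x)) + (LINT x|\<mu>. F (u x) * p x) + L / 2 * (LINT x|\<mu>. (norm (p x))\<^sup>2)"
    using int by simp
qed

text \<open>The derivative of the energy at the first triple in the direction of the second;
  equivalently, left minus right side of the weak formulation with function, gradient and trace
  decoupled. \<open>a\<close> weights the volume reaction and \<open>b\<close> the surface
  reaction.\<close>

definition residual ::
  "'a measure \<Rightarrow> 'b measure \<Rightarrow> ('a \<Rightarrow> real^'n^'n) \<Rightarrow> (real \<Rightarrow> real) \<Rightarrow> (real \<Rightarrow> real) \<Rightarrow> ('a \<Rightarrow> real) \<Rightarrow>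
    real \<Rightarrow> real \<Rightarrow> ('a \<Rightarrow> real) \<times> ('a \<Rightarrow> real^'n) \<times> ('b \<Rightarrow> real) \<Rightarrow>
    ('a \<Rightarrow> real) \<times> ('a \<Rightarrow> real^'n) \<times> ('b \<Rightarrow> real) \<Rightarrow> real" where
  "residual \<mu> \<nu> M S R f a b = (\<lambda>(u, G, g) (\<phi>, \<Psi>, h).
      (LINT x|\<mu>. (M x *v G x) \<bullet> \<Psi> x) + b * (LINT x|\<nu>. S (g x) * h x)
      + a * (LINT x|\<mu>. R (u x) * \<phi> x) - (LINT x|\<mu>. f x * \<phi> x))"

text \<open>The analytic core, freed from geometry: two finite measure spaces and a closed subspace
  of triples. Completeness for \<open>N\<close> follows componentwise from that of L^2, and
  closedness of \<open>H\<close> keeps the limit inside.\<close>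

lemma semilinear_variational_problem:
  fixes \<mu> :: "'a measure" and \<nu> :: "'b measure" and M :: "'a \<Rightarrow> real^'n^'n"
    and H :: "(('a \<Rightarrow> real) \<times> ('a \<Rightarrow> real^'n) \<times> ('b \<Rightarrow> real)) set"
  assumes \<mu>: "finite_measure \<mu>" and \<nu>: "finite_measure \<nu>"
    and ell: "symmetric_elliptic_on \<mu> \<gamma>\<^sub>0 \<gamma>\<^sub>1 M" and \<gamma>: "\<gamma>\<^sub>0 > 0" "\<gamma>\<^sub>1 > 0"
    and \<delta>: "\<delta>\<^sub>0 > 0" and S: "rate_function \<delta>\<^sub>0 \<delta>\<^sub>1 S" and R: "rate_function \<delta>\<^sub>0 \<delta>\<^sub>1 R"
    and ab: "a > 0" "b > 0" and f: "f \<in> L2_space \<mu>"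
    and H: "subspace H"
    and H_L2: "\<And>u G g. (u, G, g) \<in> H \<Longrightarrow> u \<in> L2_space \<mu> \<and> G \<in> L2_space \<mu> \<and> g \<in> L2_space \<nu>"
    and H_closed: "\<And>u G g u' G' g'. (\<And>k::nat. (u k, G k, g k) \<in> H) \<Longrightarrow> L2_tendsto \<mu> u u' \<Longrightarrow>
      L2_tendsto \<mu> G G' \<Longrightarrow> L2_tendsto \<nu> g g' \<Longrightarrow> (u', G', g') \<in> H"
  shows "\<exists>w\<in>H. (\<forall>p\<in>H. residual \<mu> \<nu> M S R f a b w p = 0) \<and>
    (\<forall>w'\<in>H. (\<forall>p\<in>H. residual \<mu> \<nu> M S R f a b w' p = 0) \<longrightarrow> (AE x in \<mu>. fst w' x = fst w x))"
proof -
  obtain \<Phi>S LS where LS: "LS \<ge> 0" and S': "\<And>r s. \<bar>S r - S s\<bar> \<le> LS * \<bar>r - s\<bar>"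
      "continuous_on UNIV \<Phi>S" "\<And>r s. \<Phi>S r + S r * s + \<delta>\<^sub>0 / 2 * s\<^sup>2 \<le> \<Phi>S (r + s)"
      "\<And>r s. \<Phi>S (r + s) \<le> \<Phi>S r + S r * s + LS / 2 * s\<^sup>2"
    by (rule rate_function_primitive[OF S]) (rule that; assumption)
  obtain \<Phi>R LR where LR: "LR \<ge> 0" and R': "\<And>r s. \<bar>R r - R s\<bar> \<le> LR * \<bar>r - s\<bar>"
      "continuous_on UNIV \<Phi>R" "\<And>r s. \<Phi>R r + R r * s + \<delta>\<^sub>0 / 2 * s\<^sup>2 \<le> \<Phi>R (r + s)"
      "\<And>r s. \<Phi>R (r + s) \<le> \<Phi>R r + R r * s + LR / 2 * s\<^sup>2"
    by (rule rate_function_primitive[OF R]) (rule that; assumption)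
  have contS: "continuous_on UNIV S" and contR: "continuous_on UNIV R"
    using S R by (auto simp: rate_function_def)
  have SL: "(\<lambda>x. S (g x)) \<in> L2_space \<nu>" if "g \<in> L2_space \<nu>" for g
    using L2_space_lipschitz_compose[OF \<nu> that S'(1) contS] .
  have RL: "(\<lambda>x. R (u x)) \<in> L2_space \<mu>" if "u \<in> L2_space \<mu>" for u
    using L2_space_lipschitz_compose[OF \<mu> that R'(1) contR] .
  define N :: "('a \<Rightarrow> real) \<times> ('a \<Rightarrow> real^'n) \<times> ('b \<Rightarrow> real) \<Rightarrow> real" where
    "N = (\<lambda>(u, G, g). (LINT x|\<mu>. (norm (u x))\<^sup>2) + (LINT x|\<mu>. (norm (G x))\<^sup>2) + (LINT x|\<nu>. (norm (g x))\<^sup>2))"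
  define E :: "('a \<Rightarrow> real) \<times> ('a \<Rightarrow> real^'n) \<times> ('b \<Rightarrow> real) \<Rightarrow> real" where
    "E = (\<lambda>(u, G, g). (LINT x|\<mu>. (M x *v G x) \<bullet> G x) / 2 + b * (LINT x|\<nu>. \<Phi>S (g x))
      + a * (LINT x|\<mu>. \<Phi>R (u x)) - (LINT x|\<mu>. f x * u x))"
  let ?B = "residual \<mu> \<nu> M S R f a b"
  have N: "N (u, G, g) = (LINT x|\<mu>. (norm (u x))\<^sup>2) + (LINT x|\<mu>. (norm (G x))\<^sup>2) + (LINT x|\<nu>. (norm (g x))\<^sup>2)" for u G g
    by (simp add: N_def)
  have B: "?B (u, G, g) (\<phi>, \<Psi>, h) = (LINT x|\<mu>. (M x *v G x) \<bullet> \<Psi> x) + b * (LINT x|\<nu>. S (g x) * h x)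
      + a * (LINT x|\<mu>. R (u x) * \<phi> x) - (LINT x|\<mu>. f x * \<phi> x)" for u G g \<phi> \<Psi> h
    by (simp add: residual_def)
  have E: "E (u, G, g) = (LINT x|\<mu>. (M x *v G x) \<bullet> G x) / 2 + b * (LINT x|\<nu>. \<Phi>S (g x))
      + a * (LINT x|\<mu>. \<Phi>R (u x)) - (LINT x|\<mu>. f x * u x)" for u G g
    by (simp add: E_def)
  \<comment> \<open>The three components of \<open>N\<close> receive different quadratic
    coefficients; \<open>c\<close> and \<open>C\<close> are the smallest lower and the largest upper
    one. Positivity of \<open>c\<close> is the uniform convexity.\<close>
  define c where "c = min (\<gamma>\<^sub>0 / 2) (min (b * (\<delta>\<^sub>0 / 2)) (a * (\<delta>\<^sub>0 / 2)))"
  define C where "C = max (\<gamma>\<^sub>1 / 2) (max (b * (LS / 2)) (a * (LR / 2)))"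
  have "c > 0"
    using \<gamma> \<delta> ab by (simp add: c_def)
  have bounds: "E w + ?B w p + c * N p \<le> E (w + p)" "E (w + p) \<le> E w + ?B w p + C * N p"
    if wp: "w \<in> H" "p \<in> H" for w p
  proof -
    obtain u G g where w: "w = (u, G, g)"
      by (cases w)
    obtain \<phi> \<Psi> h where p: "p = (\<phi>, \<Psi>, h)"
      by (cases p)
    have L: "u \<in> L2_space \<mu>" "G \<in> L2_space \<mu>" "g \<in> L2_space \<nu>"
        "\<phi> \<in> L2_space \<mu>" "\<Psi> \<in> L2_space \<mu>" "h \<in> L2_space \<nu>"
      using H_L2[OF wp(1)[unfolded w]] H_L2[OF wp(2)[unfolded p]] by simp_all
    note e = elliptic_energy_bounds[OF ell \<gamma> L(2,5)]
    note s = convex_potential_bounds[OF \<nu> L(3,6) S'(1) contS S'(2-4)]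
    note r = convex_potential_bounds[OF \<mu> L(1,4) R'(1) contR R'(2-4)]
    have lin: "(LINT x|\<mu>. f x * (u x + \<phi> x)) = (LINT x|\<mu>. f x * u x) + (LINT x|\<mu>. f x * \<phi> x)"
      using L f by (simp add: distrib_left L2_space_integrable_mult)
    have nn: "0 \<le> (LINT x|\<mu>. (norm (\<phi> x))\<^sup>2)" "0 \<le> (LINT x|\<mu>. (norm (\<Psi> x))\<^sup>2)" "0 \<le> (LINT x|\<nu>. (norm (h x))\<^sup>2)"
      by simp_all
    have wp_eq: "(u, G, g) + (\<phi>, \<Psi>, h) = (\<lambda>x. u x + \<phi> x, \<lambda>x. G x + \<Psi> x, \<lambda>x. g x + h x)"
      by (simp add: plus_fun_def)
    have cC: "c \<le> \<gamma>\<^sub>0 / 2" "c \<le> b * (\<delta>\<^sub>0 / 2)" "c \<le> a * (\<delta>\<^sub>0 / 2)" "\<gamma>\<^sub>1 / 2 \<le> C" "b * (LS / 2) \<le> C" "a * (LR / 2) \<le> C"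
      by (simp_all add: c_def C_def)
    note mono = cC(1)[THEN mult_right_mono, OF nn(2)] cC(2)[THEN mult_right_mono, OF nn(3)]
      cC(3)[THEN mult_right_mono, OF nn(1)] cC(4)[THEN mult_right_mono, OF nn(2)]
      cC(5)[THEN mult_right_mono, OF nn(3)] cC(6)[THEN mult_right_mono, OF nn(1)]
    have s': "b * (LINT x|\<nu>. \<Phi>S (g x)) + b * (LINT x|\<nu>. S (g x) * h x) + b * (\<delta>\<^sub>0 / 2) * (LINT x|\<nu>. (norm (h x))\<^sup>2)
        \<le> b * (LINT x|\<nu>. \<Phi>S (g x + h x))"
      "b * (LINT x|\<nu>. \<Phi>S (g x + h x))
        \<le> b * (LINT x|\<nu>. \<Phi>S (g x)) + b * (LINT x|\<nu>. S (g x) * h x) + b * (LS / 2) * (LINT x|\<nu>. (norm (h x))\<^sup>2)"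
      using mult_left_mono[OF s(1) less_imp_le[OF ab(2)]] mult_left_mono[OF s(2) less_imp_le[OF ab(2)]]
      by (simp_all only: distrib_left mult.assoc)
    have r': "a * (LINT x|\<mu>. \<Phi>R (u x)) + a * (LINT x|\<mu>. R (u x) * \<phi> x) + a * (\<delta>\<^sub>0 / 2) * (LINT x|\<mu>. (norm (\<phi> x))\<^sup>2)
        \<le> a * (LINT x|\<mu>. \<Phi>R (u x + \<phi> x))"
      "a * (LINT x|\<mu>. \<Phi>R (u x + \<phi> x))
        \<le> a * (LINT x|\<mu>. \<Phi>R (u x)) + a * (LINT x|\<mu>. R (u x) * \<phi> x) + a * (LR / 2) * (LINT x|\<mu>. (norm (\<phi> x))\<^sup>2)"
      using mult_left_mono[OF r(1) less_imp_le[OF ab(1)]] mult_left_mono[OF r(2) less_imp_le[OF ab(1)]]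
      by (simp_all only: distrib_left mult.assoc)
    have lower: "(e + s + r - l) + (m + s1 + r1 - l1) + (c1 + c2 + c3) \<le> e' + s' + r' - (l + l1)"
      if "e + m + d2 \<le> e'" "s + s1 + d3 \<le> s'" "r + r1 + d1 \<le> r'" "c2 \<le> d2" "c3 \<le> d3" "c1 \<le> d1"
      for e m e' s s1 s' r r1 r' l l1 c1 c2 c3 d1 d2 d3 :: real
      using that by linarith
    have upper: "e' + s' + r' - (l + l1) \<le> (e + s + r - l) + (m + s1 + r1 - l1) + (c1 + c2 + c3)"
      if "e' \<le> e + m + d2" "s' \<le> s + s1 + d3" "r' \<le> r + r1 + d1" "d2 \<le> c2" "d3 \<le> c3" "d1 \<le> c1"
      for e m e' s s1 s' r r1 r' l l1 c1 c2 c3 d1 d2 d3 :: real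
      using that by linarith
    show "E w + ?B w p + c * N p \<le> E (w + p)"
      unfolding w p wp_eq E B N lin unfolding distrib_left by (rule lower[OF e(1) s'(1) r'(1) mono(1-3)])
    show "E (w + p) \<le> E w + ?B w p + C * N p"
      unfolding w p wp_eq E B N lin unfolding distrib_left by (rule upper[OF e(2) s'(2) r'(2) mono(4-6)])
  qed
  have "\<exists>w\<in>H. (\<forall>p\<in>H. ?B w p = 0) \<and> (\<forall>w'\<in>H. (\<forall>p\<in>H. ?B w' p = 0) \<longrightarrow> N (w' - w) = 0)"
  proof (rule uniformly_convex_critical_point[OF H, where E = E and c = c and C = C])
    show "0 \<le> N w" for w
      by (cases w) (simp add: N)
    show "N (t *\<^sub>R w) = t\<^sup>2 * N w" for w t
      by (cases w) (simp add: N power_mult_distrib distrib_left)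
    show "?B w (t *\<^sub>R p) = t * ?B w p" for w p t
    proof -
      obtain u G g where w: "w = (u, G, g)"
        by (cases w)
      obtain \<phi> \<Psi> h where p: "p = (\<phi>, \<Psi>, h)"
        by (cases p)
      have "(LINT x|\<mu>. (M x *v G x) \<bullet> (t *\<^sub>R \<Psi> x)) = t * (LINT x|\<mu>. (M x *v G x) \<bullet> \<Psi> x)"
        by simp
      moreover have scale: "(LINT x|K. F x * (t * q x)) = t * (LINT x|K. F x * q x)"
        for K :: "'c measure" and F q
        unfolding mult.left_commute[of _ t] by simp
      ultimately show ?thesis
        unfolding w p by (simp add: B scale) (simp add: algebra_simps)
    qed
    show "\<exists>K. \<forall>p\<in>H. \<bar>?B w p\<bar> \<le> K * (1 + N p)" if "w \<in> H" for w
    proof -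
      obtain u G g where w: "w = (u, G, g)"
        by (cases w)
      have L: "u \<in> L2_space \<mu>" "G \<in> L2_space \<mu>" "g \<in> L2_space \<nu>"
        using H_L2[OF that[unfolded w]] by simp_all
      \<comment> \<open>Collects the parts independent of \<open>p\<close> when each product is
        bounded by a sum of squares.\<close>
      define k where "k = \<gamma>\<^sub>1 * (LINT x|\<mu>. (norm (G x))\<^sup>2) + b * (LINT x|\<nu>. (norm (S (g x)))\<^sup>2)
        + a * (LINT x|\<mu>. (norm (R (u x)))\<^sup>2) + (LINT x|\<mu>. (norm (f x))\<^sup>2)"
      have "k \<ge> 0"
        using \<gamma> ab unfolding k_def by (intro add_nonneg_nonneg mult_nonneg_nonneg) auto
      have "\<bar>?B w p\<bar> \<le> (k + \<gamma>\<^sub>1 + b + a + 1) * (1 + N p)" if "p \<in> H" for p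
      proof -
        obtain \<phi> \<Psi> h where p: "p = (\<phi>, \<Psi>, h)"
          by (cases p)
        have L': "\<phi> \<in> L2_space \<mu>" "\<Psi> \<in> L2_space \<mu>" "h \<in> L2_space \<nu>"
          using H_L2[OF that[unfolded p]] by simp_all
        let ?\<phi> = "LINT x|\<mu>. (norm (\<phi> x))\<^sup>2" and ?\<Psi> = "LINT x|\<mu>. (norm (\<Psi> x))\<^sup>2" and ?h = "LINT x|\<nu>. (norm (h x))\<^sup>2"
        have nn: "0 \<le> ?\<phi>" "0 \<le> ?\<Psi>" "0 \<le> ?h"
          by simp_all
        have 1: "\<bar>LINT x|\<mu>. (M x *v G x) \<bullet> \<Psi> x\<bar> \<le> \<gamma>\<^sub>1 * (LINT x|\<mu>. (norm (G x))\<^sup>2) + \<gamma>\<^sub>1 * ?\<Psi>"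
          using elliptic_form_integral_abs_le[OF ell \<gamma> L(2) L'(2)] by (simp add: distrib_left)
        have "\<bar>LINT x|\<nu>. S (g x) * h x\<bar> \<le> (LINT x|\<nu>. (norm (S (g x)))\<^sup>2) + ?h"
          using L2_abs_integral_inner_le[OF SL[OF L(3)] L'(3)] by simp
        from mult_left_mono[OF this, of b]
        have 2: "\<bar>b * (LINT x|\<nu>. S (g x) * h x)\<bar> \<le> b * (LINT x|\<nu>. (norm (S (g x)))\<^sup>2) + b * ?h"
          using ab by (simp add: abs_mult distrib_left)
        have "\<bar>LINT x|\<mu>. R (u x) * \<phi> x\<bar> \<le> (LINT x|\<mu>. (norm (R (u x)))\<^sup>2) + ?\<phi>"
          using L2_abs_integral_inner_le[OF RL[OF L(1)] L'(1)] by simp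
        from mult_left_mono[OF this, of a]
        have 3: "\<bar>a * (LINT x|\<mu>. R (u x) * \<phi> x)\<bar> \<le> a * (LINT x|\<mu>. (norm (R (u x)))\<^sup>2) + a * ?\<phi>"
          using ab by (simp add: abs_mult distrib_left)
        have 4: "\<bar>LINT x|\<mu>. f x * \<phi> x\<bar> \<le> (LINT x|\<mu>. (norm (f x))\<^sup>2) + ?\<phi>"
          using L2_abs_integral_inner_le[OF f L'(1)] by simp
        have "\<bar>?B w p\<bar> \<le> k + \<gamma>\<^sub>1 * ?\<Psi> + b * ?h + a * ?\<phi> + ?\<phi>"
          unfolding w p B k_def using 1 2 3 4 by linarith
        moreover have "\<gamma>\<^sub>1 * ?\<Psi> \<le> \<gamma>\<^sub>1 * N p" "b * ?h \<le> b * N p" "a * ?\<phi> \<le> a * N p" "?\<phi> \<le> N p"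
          unfolding p N using nn \<gamma> ab by (simp_all add: mult_left_mono)
        moreover have "0 \<le> N p"
          unfolding p N using nn by simp
        ultimately have "\<bar>?B w p\<bar> \<le> k + (\<gamma>\<^sub>1 + b + a + 1) * N p"
          by (simp add: distrib_right)
        also have "k \<le> k * (1 + N p)"
          using \<open>0 \<le> N p\<close> \<open>k \<ge> 0\<close> by (simp add: distrib_left)
        also have "(\<gamma>\<^sub>1 + b + a + 1) * N p \<le> (\<gamma>\<^sub>1 + b + a + 1) * (1 + N p)"
          using \<gamma> ab by (intro mult_left_mono) auto
        finally show ?thesis
          by (simp add: distrib_right)
      qed
      then show ?thesis
        by blast
    qed
    show "\<exists>v\<in>H. (\<lambda>k. N (w k - v)) \<longlonglongrightarrow> 0"
      if wH: "\<And>k::nat. w k \<in> H" and Cauchy: "\<And>e. 0 < e \<Longrightarrow> \<exists>K. \<forall>k\<ge>K. \<forall>l\<ge>K. N (w k - w l) < e" for w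
    proof -
      define u where "u k = fst (w k)" for k
      define G where "G k = fst (snd (w k))" for k
      define g where "g k = snd (snd (w k))" for k
      have w: "w k = (u k, G k, g k)" for k
        by (simp add: u_def G_def g_def)
      have L: "u k \<in> L2_space \<mu>" "G k \<in> L2_space \<mu>" "g k \<in> L2_space \<nu>" for k
        using H_L2[OF wH[of k, unfolded w]] by simp_all
      have Nd: "N (w k - (u', G', g')) = (LINT x|\<mu>. (norm (u k x - u' x))\<^sup>2) + (LINT x|\<mu>. (norm (G k x - G' x))\<^sup>2)
          + (LINT x|\<nu>. (norm (g k x - g' x))\<^sup>2)" for k u' G' g'
        by (simp add: w N)
      have le: "(LINT x|\<mu>. (norm (u k x - u l x))\<^sup>2) \<le> N (w k - w l)" "(LINT x|\<mu>. (norm (G k x - G l x))\<^sup>2) \<le> N (w k - w l)"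
        "(LINT x|\<nu>. (norm (g k x - g l x))\<^sup>2) \<le> N (w k - w l)" for k l
        unfolding w[of l] Nd by simp_all
      have "\<exists>K. \<forall>k\<ge>K. \<forall>l\<ge>K. (LINT x|\<mu>. (norm (u k x - u l x))\<^sup>2) < e" if e: "0 < e" for e
        using Cauchy[OF e] le_less_trans[OF le(1)] by blast
      from L2_complete[OF L(1) this] obtain u' where u': "L2_tendsto \<mu> u u'"
        by blast
      have "\<exists>K. \<forall>k\<ge>K. \<forall>l\<ge>K. (LINT x|\<mu>. (norm (G k x - G l x))\<^sup>2) < e" if e: "0 < e" for e
        using Cauchy[OF e] le_less_trans[OF le(2)] by blast
      from L2_complete[OF L(2) this] obtain G' where G': "L2_tendsto \<mu> G G'"
        by blast
      have "\<exists>K. \<forall>k\<ge>K. \<forall>l\<ge>K. (LINT x|\<nu>. (norm (g k x - g l x))\<^sup>2) < e" if e: "0 < e" for e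
        using Cauchy[OF e] le_less_trans[OF le(3)] by blast
      from L2_complete[OF L(3) this] obtain g' where g': "L2_tendsto \<nu> g g'"
        by blast
      have "(\<lambda>k. N (w k - (u', G', g'))) \<longlonglongrightarrow> 0 + 0 + 0"
        unfolding Nd using u' G' g' by (intro tendsto_add) (simp_all add: L2_tendsto_def)
      moreover have "(u', G', g') \<in> H"
        using wH unfolding w by (rule H_closed[OF _ u' G' g'])
      ultimately show ?thesis
        by auto
    qed
  qed (fact \<open>c > 0\<close>, fact bounds(1), fact bounds(2))
  then obtain w where w: "w \<in> H" "\<And>p. p \<in> H \<Longrightarrow> ?B w p = 0"
      "\<And>w'. w' \<in> H \<Longrightarrow> (\<And>p. p \<in> H \<Longrightarrow> ?B w' p = 0) \<Longrightarrow> N (w' - w) = 0"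
    by blast
  have "AE x in \<mu>. fst w' x = fst w x" if w': "w' \<in> H" "\<And>p. p \<in> H \<Longrightarrow> ?B w' p = 0" for w'
  proof -
    have "w' - w \<in> H"
      using H w(1) w'(1) by (simp add: subspace_diff)
    moreover have "w' - w = (fst w' - fst w, fst (snd w') - fst (snd w), snd (snd w') - snd (snd w))"
      by (simp add: prod_eq_iff)
    ultimately have
      "(fst w' - fst w, fst (snd w') - fst (snd w), snd (snd w') - snd (snd w)) \<in> H"
      by simp
    from H_L2[OF this] have L: "(\<lambda>x. fst w' x - fst w x) \<in> L2_space \<mu>"
      by (simp add: fun_diff_def)
    have "N (w' - w) = 0"
      using w(3) w' by blast
    moreover have "(LINT x|\<mu>. (norm (fst w' x - fst w x))\<^sup>2) \<le> N (w' - w)"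
      by (cases w'; cases w) (simp add: N)
    ultimately have "(LINT x|\<mu>. (norm (fst w' x - fst w x))\<^sup>2) = 0"
      by (intro antisym) simp_all
    then have "AE x in \<mu>. (norm (fst w' x - fst w x))\<^sup>2 = 0"
      using integral_nonneg_eq_0_iff_AE[OF L2_space_integrable[OF L]] by simp
    then show ?thesis
      by eventually_elim simp
  qed
  then show ?thesis
    using w(1,2) by blast
qed

section \<open>Traces and the microscopic problem\<close>

text \<open>\<open>has_trace\<close> with a free \<open>G\<close> in place of the chosen weak
  gradient. In this form the relation is linear on the nose, not just up to null sets.\<close>

definition trace_limit ::
  "(real^'n) set \<Rightarrow> (real^'n) set \<Rightarrow> (real^'n \<Rightarrow> real) \<Rightarrow> (real^'n \<Rightarrow> real^'n) \<Rightarrow> (real^'n \<Rightarrow> real) \<Rightarrow> bool" where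
  "trace_limit D \<Gamma> u G g \<longleftrightarrow> (\<exists>v. (\<forall>n. smooth_on UNIV (v n)) \<and> L2_tendsto (lebesgue_on D) v u \<and>
     L2_tendsto (lebesgue_on D) (\<lambda>n. grad (v n)) G \<and> L2_tendsto (surface_measure \<Gamma>) v g)"

lemma has_trace_iff_trace_limit:
  "has_trace D \<Gamma> u g \<longleftrightarrow> u \<in> H1_space D \<and> trace_limit D \<Gamma> u (weak_grad D u) g"
  by (simp add: has_trace_def trace_limit_def)

lemma trace_limit_L2:
  assumes "trace_limit D \<Gamma> u G g"
  shows "u \<in> L2_space (lebesgue_on D)" "G \<in> L2_space (lebesgue_on D)" "g \<in> L2_space (surface_measure \<Gamma>)"
  using assms by (auto simp: trace_limit_def L2_tendsto_def)

lemma trace_limit_zero: "trace_limit D \<Gamma> (\<lambda>_. 0) (\<lambda>_. 0) (\<lambda>_. 0)"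
  for D \<Gamma> :: "(real^'n) set"
proof -
  have "grad (\<lambda>_::real^'n. 0 :: real) = (\<lambda>_. 0)"
    by (simp add: fun_eq_iff grad_def vec_eq_iff partial_deriv_at[OF has_derivative_const])
  then show ?thesis
    unfolding trace_limit_def
    by (intro exI[of _ "\<lambda>_ _. 0"]) (simp add: smooth_on_def Ck_on_const L2_tendsto_zero)
qed

lemma trace_limit_add_scale:
  assumes "trace_limit D \<Gamma> u G g" "trace_limit D \<Gamma> u' G' g'"
  shows "trace_limit D \<Gamma> (\<lambda>x. u x + c * u' x) (\<lambda>x. G x + c *\<^sub>R G' x) (\<lambda>x. g x + c * g' x)"
proof -
  obtain v where v: "\<And>n. smooth_on UNIV (v n)" "L2_tendsto (lebesgue_on D) v u"
    "L2_tendsto (lebesgue_on D) (\<lambda>n. grad (v n)) G" "L2_tendsto (surface_measure \<Gamma>) v g"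
    using assms(1) unfolding trace_limit_def by blast
  obtain v' where v': "\<And>n. smooth_on UNIV (v' n)" "L2_tendsto (lebesgue_on D) v' u'"
    "L2_tendsto (lebesgue_on D) (\<lambda>n. grad (v' n)) G'" "L2_tendsto (surface_measure \<Gamma>) v' g'"
    using assms(2) unfolding trace_limit_def by blast
  have "grad (\<lambda>x. v n x + c * v' n x) = (\<lambda>x. grad (v n) x + c *\<^sub>R grad (v' n) x)" for n
    using v(1) v'(1) by (simp add: fun_eq_iff grad_add_scale)
  then show ?thesis
    unfolding trace_limit_def
    using v(1) v'(1) L2_tendsto_add[OF v(2) L2_tendsto_scaleR[OF v'(2), of c]]
      L2_tendsto_add[OF v(3) L2_tendsto_scaleR[OF v'(3), of c]]
      L2_tendsto_add[OF v(4) L2_tendsto_scaleR[OF v'(4), of c]]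
    by (intro exI[of _ "\<lambda>n x. v n x + c * v' n x"]) (simp add: smooth_on_add_scale)
qed

lemma L2_tendsto_diagonal:
  assumes u: "L2_tendsto M u u'" and v: "\<And>k. v k \<in> L2_space M"
    and near: "\<And>k::nat. (LINT x|M. (norm (v k x - u k x))\<^sup>2) < 1 / real (Suc k)"
  shows "L2_tendsto M v u'"
proof -
  have L: "u k \<in> L2_space M" "u' \<in> L2_space M" for k
    using u by (auto simp: L2_tendsto_def)
  let ?d = "\<lambda>k. 2 * (1 / real (Suc k)) + 2 * (LINT x|M. (norm (u k x - u' x))\<^sup>2)"
  have le: "(LINT x|M. (norm (v k x - u' x))\<^sup>2) \<le> ?d k" for k
    using L2_dist_triangle[OF v[of k] L(1)[of k] L(2)] near[of k] by linarith
  have "?d \<longlonglongrightarrow> 2 * 0 + 2 * 0"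
    using u by (intro tendsto_intros LIMSEQ_Suc[OF lim_1_over_n]) (simp add: L2_tendsto_def)
  then have "?d \<longlonglongrightarrow> 0"
    by simp
  then have "(\<lambda>k. LINT x|M. (norm (v k x - u' x))\<^sup>2) \<longlonglongrightarrow> 0"
    by (rule Lim_null_comparison[rotated]) (use le in \<open>intro always_eventually allI, simp\<close>)
  then show ?thesis
    using v L by (simp add: L2_tendsto_def)
qed

text \<open>A closure is closed: from the sequence approximating the \<open>k\<close>-th triple one
  picks a member within 1/(k+1) in squared distance, and these members approximate the limit
  triple.\<close>

lemma trace_limit_closed:
  assumes tr: "\<And>k. trace_limit D \<Gamma> (u k) (G k) (g k)"
    and lim: "L2_tendsto (lebesgue_on D) u u'" "L2_tendsto (lebesgue_on D) G G'"
      "L2_tendsto (surface_measure \<Gamma>) g g'"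
  shows "trace_limit D \<Gamma> u' G' g'"
proof -
  define near where "near k v \<longleftrightarrow> smooth_on UNIV v \<and> v \<in> L2_space (lebesgue_on D) \<and>
      grad v \<in> L2_space (lebesgue_on D) \<and> v \<in> L2_space (surface_measure \<Gamma>) \<and>
      (LINT x|lebesgue_on D. (norm (v x - u k x))\<^sup>2) < 1 / real (Suc k) \<and>
      (LINT x|lebesgue_on D. (norm (grad v x - G k x))\<^sup>2) < 1 / real (Suc k) \<and>
      (LINT x|surface_measure \<Gamma>. (norm (v x - g k x))\<^sup>2) < 1 / real (Suc k)" for k v
  have "\<exists>v. near k v" for k
  proof -
    obtain v where v: "\<And>n. smooth_on UNIV (v n)" "L2_tendsto (lebesgue_on D) v (u k)"
      "L2_tendsto (lebesgue_on D) (\<lambda>n. grad (v n)) (G k)" "L2_tendsto (surface_measure \<Gamma>) v (g k)"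
      using tr[of k] unfolding trace_limit_def by blast
    have pos: "0 < 1 / real (Suc k)"
      by simp
    \<comment> \<open>One index must meet all three tolerances, since a single smooth function
      approximates value, gradient and trace.\<close>
    have "eventually (\<lambda>n. (LINT x|lebesgue_on D. (norm (v n x - u k x))\<^sup>2) < 1 / real (Suc k) \<and>
      (LINT x|lebesgue_on D. (norm (grad (v n) x - G k x))\<^sup>2) < 1 / real (Suc k) \<and>
      (LINT x|surface_measure \<Gamma>. (norm (v n x - g k x))\<^sup>2) < 1 / real (Suc k)) sequentially"
      using v(2-4) by (intro eventually_conj order_tendstoD(2)[OF _ pos]) (simp_all add: L2_tendsto_def)
    from eventually_happens'[OF sequentially_bot this] obtain n where
      "(LINT x|lebesgue_on D. (norm (v n x - u k x))\<^sup>2) < 1 / real (Suc k) \<and>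
      (LINT x|lebesgue_on D. (norm (grad (v n) x - G k x))\<^sup>2) < 1 / real (Suc k) \<and>
      (LINT x|surface_measure \<Gamma>. (norm (v n x - g k x))\<^sup>2) < 1 / real (Suc k)"
      by (rule exE)
    then have "near k (v n)"
      using v unfolding near_def L2_tendsto_def by blast
    then show "\<exists>v. near k v"
      by (rule exI[of "near k" "v n"])
  qed
  then obtain v where "\<And>k. near k (v k)"
    by metis
  then have v: "\<And>k. smooth_on UNIV (v k)" "\<And>k. v k \<in> L2_space (lebesgue_on D)"
      "\<And>k. grad (v k) \<in> L2_space (lebesgue_on D)" "\<And>k. v k \<in> L2_space (surface_measure \<Gamma>)"
      "\<And>k. (LINT x|lebesgue_on D. (norm (v k x - u k x))\<^sup>2) < 1 / real (Suc k)"
      "\<And>k. (LINT x|lebesgue_on D. (norm (grad (v k) x - G k x))\<^sup>2) < 1 / real (Suc k)"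
      "\<And>k. (LINT x|surface_measure \<Gamma>. (norm (v k x - g k x))\<^sup>2) < 1 / real (Suc k)"
    unfolding near_def by blast+
  show ?thesis
    unfolding trace_limit_def
    using v(1) L2_tendsto_diagonal[OF lim(1) v(2,5)] L2_tendsto_diagonal[OF lim(2) v(3,6)]
      L2_tendsto_diagonal[OF lim(3) v(4,7)] by blast
qed

text \<open>The gradient and the trace are carried as data: this makes the set closed in a product of
  \<open>L\<^sup>2\<close> spaces without appeal to a trace theorem.\<close>

definition trace_triples ::
  "(real^'n) set \<Rightarrow> (real^'n) set \<Rightarrow> (real^'n) set \<Rightarrow>
    ((real^'n \<Rightarrow> real) \<times> (real^'n \<Rightarrow> real^'n) \<times> (real^'n \<Rightarrow> real)) set" where
  "trace_triples D \<Gamma> \<Gamma>ext = {(u, G, g). has_weak_gradient D u G \<and>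
     trace_limit D \<Gamma> u G g \<and> trace_limit D \<Gamma>ext u G (\<lambda>_. 0)}"

lemma trace_triples_L2:
  assumes "(u, G, g) \<in> trace_triples D \<Gamma> \<Gamma>ext"
  shows "u \<in> L2_space (lebesgue_on D) \<and> G \<in> L2_space (lebesgue_on D) \<and> g \<in> L2_space (surface_measure \<Gamma>)"
  using assms trace_limit_L2 unfolding trace_triples_def by blast

lemma subspace_trace_triples:
  assumes D: "bounded D" "open D"
  shows "subspace (trace_triples D \<Gamma> \<Gamma>ext)"
proof -
  have zero: "0 \<in> trace_triples D \<Gamma> \<Gamma>ext"
    by (simp add: trace_triples_def zero_prod_def zero_fun_def has_weak_gradient_zero trace_limit_zero)
  have add_scale: "w + c *\<^sub>R w' \<in> trace_triples D \<Gamma> \<Gamma>ext"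
    if w: "w \<in> trace_triples D \<Gamma> \<Gamma>ext" and w': "w' \<in> trace_triples D \<Gamma> \<Gamma>ext" for w w' c
  proof -
    obtain u G g where ugg: "w = (u, G, g)"
      by (cases w)
    obtain u' G' g' where ugg': "w' = (u', G', g')"
      by (cases w')
    note L = trace_triples_L2[OF w[unfolded ugg]] trace_triples_L2[OF w'[unfolded ugg']]
    have "has_weak_gradient D (\<lambda>x. u x + c * u' x) (\<lambda>x. G x + c *\<^sub>R G' x)"
      using w w' L unfolding ugg ugg' trace_triples_def by (intro has_weak_gradient_add_scale[OF D]) auto
    moreover have "trace_limit D \<Gamma> (\<lambda>x. u x + c * u' x) (\<lambda>x. G x + c *\<^sub>R G' x) (\<lambda>x. g x + c * g' x)"
      using w w' unfolding ugg ugg' trace_triples_def by (intro trace_limit_add_scale) auto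
    moreover have "trace_limit D \<Gamma>ext u G (\<lambda>_. 0)" "trace_limit D \<Gamma>ext u' G' (\<lambda>_. 0)"
      using w w' unfolding ugg ugg' trace_triples_def by auto
    from trace_limit_add_scale[OF this, of c]
    have "trace_limit D \<Gamma>ext (\<lambda>x. u x + c * u' x) (\<lambda>x. G x + c *\<^sub>R G' x) (\<lambda>_. 0)"
      by simp
    ultimately show ?thesis
      by (simp add: ugg ugg' trace_triples_def plus_fun_def scaleR_fun_def)
  qed
  show ?thesis
    unfolding subspace_def
    using zero add_scale[of _ _ 1] add_scale[OF zero] by auto
qed

lemma trace_triples_closed:
  assumes D: "bounded D" "open D"
    and mem: "\<And>k::nat. (u k, G k, g k) \<in> trace_triples D \<Gamma> \<Gamma>ext"
    and lim: "L2_tendsto (lebesgue_on D) u u'" "L2_tendsto (lebesgue_on D) G G'"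
      "L2_tendsto (surface_measure \<Gamma>) g g'"
  shows "(u', G', g') \<in> trace_triples D \<Gamma> \<Gamma>ext"
proof -
  have mem': "has_weak_gradient D (u k) (G k)" "trace_limit D \<Gamma> (u k) (G k) (g k)"
    "trace_limit D \<Gamma>ext (u k) (G k) (\<lambda>_. 0)" for k
    using mem[of k] by (simp_all add: trace_triples_def)
  show ?thesis
    using has_weak_gradient_limit[OF D lim(1,2) mem'(1)] trace_limit_closed[OF mem'(2) lim]
      trace_limit_closed[OF mem'(3) lim(1,2) L2_tendsto_zero]
    by (simp add: trace_triples_def)
qed

section \<open>From triples back to the weak formulation\<close>

lemma weak_grad_properties:
  assumes "u \<in> H1_space D"
  shows "weak_grad D u \<in> L2_space (lebesgue_on D)" "has_weak_gradient D u (weak_grad D u)"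
proof -
  have "\<exists>G. G \<in> L2_space (lebesgue_on D) \<and> has_weak_gradient D u G"
    using assms by (auto simp: H1_space_def)
  from someI_ex[OF this]
  show "weak_grad D u \<in> L2_space (lebesgue_on D)" "has_weak_gradient D u (weak_grad D u)"
    unfolding weak_grad_def by blast+
qed

lemma trace_triplesI:
  assumes "u \<in> Wtilde_space D \<Gamma> \<Gamma>ext" "has_trace D \<Gamma> u g"
  shows "(u, weak_grad D u, g) \<in> trace_triples D \<Gamma> \<Gamma>ext"
  using assms weak_grad_properties(2)[of u D]
  by (simp add: trace_triples_def Wtilde_space_def V_space_def has_trace_iff_trace_limit)

text \<open>Uniqueness identifies \<open>G\<close> with the chosen weak gradient off a null set, and
  L^2 limits do not see null sets. So the approximating sequences of the triple witness traces in
  the sense of \<open>has_trace\<close>.\<close>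

lemma trace_triplesD:
  assumes D: "bounded D" "open D" and mem: "(u, G, g) \<in> trace_triples D \<Gamma> \<Gamma>ext"
  shows "u \<in> Wtilde_space D \<Gamma> \<Gamma>ext" "has_trace D \<Gamma> u g"
    "weak_grad D u \<in> L2_space (lebesgue_on D)" "AE x in lebesgue_on D. weak_grad D u x = G x"
proof -
  note L = trace_triples_L2[OF mem]
  have W: "has_weak_gradient D u G" "trace_limit D \<Gamma> u G g" "trace_limit D \<Gamma>ext u G (\<lambda>_. 0)"
    using mem by (simp_all add: trace_triples_def)
  have H1: "u \<in> H1_space D"
    using L W(1) by (auto simp: H1_space_def)
  note wg = weak_grad_properties[OF H1]
  show "weak_grad D u \<in> L2_space (lebesgue_on D)"
    by (rule wg(1))
  show AE: "AE x in lebesgue_on D. weak_grad D u x = G x"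
    using L by (intro has_weak_gradient_unique[OF D wg(1) _ wg(2) W(1)]) simp
  then have AE': "AE x in lebesgue_on D. G x = weak_grad D u x"
    by eventually_elim simp
  have "trace_limit D \<Gamma>' u (weak_grad D u) k" if "trace_limit D \<Gamma>' u G k" for \<Gamma>' k
    using that L2_tendsto_cong_limit[OF _ AE' wg(1)] unfolding trace_limit_def by blast
  then have tr: "has_trace D \<Gamma> u g" "has_trace D \<Gamma>ext u (\<lambda>_. 0)"
    using W(2,3) H1 by (auto simp: has_trace_iff_trace_limit)
  then show "has_trace D \<Gamma> u g"
    by simp
  show "u \<in> Wtilde_space D \<Gamma> \<Gamma>ext"
    using L H1 tr by (auto simp: Wtilde_space_def V_space_def W_space_def)
qed

text \<open>The existential trace in \<open>weak_solution\<close> becomes the third component of the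
  solution triple, and the universal one that of the test triple. Gradients may be exchanged under
  the integral because they agree almost everywhere.\<close>

lemma weak_solution_iff_trace_triples:
  fixes A :: "real^'n \<Rightarrow> real^'n^'n"
  assumes D: "bounded D" "open D"
    and M: "(\<lambda>x. A ((1 / \<epsilon>) *\<^sub>R x)) \<in> borel_measurable (lebesgue_on D)"
  shows "weak_solution D \<Gamma> \<Gamma>ext \<epsilon> \<alpha> \<beta> A S R f u \<longleftrightarrow>
    (\<exists>G g. (u, G, g) \<in> trace_triples D \<Gamma> \<Gamma>ext \<and> (\<forall>p \<in> trace_triples D \<Gamma> \<Gamma>ext.
      residual (lebesgue_on D) (surface_measure \<Gamma>) (\<lambda>x. A ((1 / \<epsilon>) *\<^sub>R x)) S R f
        (\<epsilon> powr \<alpha>) (\<epsilon> powr \<beta>) (u, G, g) p = 0))" (is "_ \<longleftrightarrow> (\<exists>G g. _ \<and> ?eq G g)")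
proof
  have cong: "(LINT x|lebesgue_on D. (A ((1 / \<epsilon>) *\<^sub>R x) *v G x) \<bullet> \<Psi> x)
      = (LINT x|lebesgue_on D. (A ((1 / \<epsilon>) *\<^sub>R x) *v G' x) \<bullet> \<Psi>' x)"
    if "G \<in> L2_space (lebesgue_on D)" "\<Psi> \<in> L2_space (lebesgue_on D)"
      "G' \<in> L2_space (lebesgue_on D)" "\<Psi>' \<in> L2_space (lebesgue_on D)"
      "AE x in lebesgue_on D. G x = G' x" "AE x in lebesgue_on D. \<Psi> x = \<Psi>' x" for G \<Psi> G' \<Psi>'
  proof (rule integral_cong_AE)
    note [measurable] = that(1-4)[THEN L2_space_measurable] M
    show "(\<lambda>x. (A ((1 / \<epsilon>) *\<^sub>R x) *v G x) \<bullet> \<Psi> x) \<in> borel_measurable (lebesgue_on D)"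
      "(\<lambda>x. (A ((1 / \<epsilon>) *\<^sub>R x) *v G' x) \<bullet> \<Psi>' x) \<in> borel_measurable (lebesgue_on D)"
      by measurable
    show "AE x in lebesgue_on D. (A ((1 / \<epsilon>) *\<^sub>R x) *v G x) \<bullet> \<Psi> x = (A ((1 / \<epsilon>) *\<^sub>R x) *v G' x) \<bullet> \<Psi>' x"
      using that(5,6) by eventually_elim simp
  qed
  {
    assume "weak_solution D \<Gamma> \<Gamma>ext \<epsilon> \<alpha> \<beta> A S R f u"
    then obtain g where u: "u \<in> Wtilde_space D \<Gamma> \<Gamma>ext" "has_trace D \<Gamma> u g"
      and eq: "\<And>\<phi> h. \<phi> \<in> Wtilde_space D \<Gamma> \<Gamma>ext \<Longrightarrow> has_trace D \<Gamma> \<phi> h \<Longrightarrow>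
         (LINT x|lebesgue_on D. (A ((1/\<epsilon>) *\<^sub>R x) *v weak_grad D u x) \<bullet> weak_grad D \<phi> x)
         + \<epsilon> powr \<beta> * (LINT x|surface_measure \<Gamma>. S (g x) * h x)
         + \<epsilon> powr \<alpha> * (LINT x|lebesgue_on D. R (u x) * \<phi> x)
         = (LINT x|lebesgue_on D. f x * \<phi> x)"
      unfolding weak_solution_def by blast
    have mem: "(u, weak_grad D u, g) \<in> trace_triples D \<Gamma> \<Gamma>ext"
      using u by (rule trace_triplesI)
    have "?eq (weak_grad D u) g"
    proof
      fix q
      assume q: "q \<in> trace_triples D \<Gamma> \<Gamma>ext"
      obtain \<phi> \<Psi> h where q_eq: "q = (\<phi>, \<Psi>, h)"
        by (cases q)
      note p = q[unfolded q_eq]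
      note pD = trace_triplesD[OF D p]
      have "(LINT x|lebesgue_on D. (A ((1/\<epsilon>) *\<^sub>R x) *v weak_grad D u x) \<bullet> weak_grad D \<phi> x)
          = (LINT x|lebesgue_on D. (A ((1/\<epsilon>) *\<^sub>R x) *v weak_grad D u x) \<bullet> \<Psi> x)"
        using trace_triples_L2[OF mem] trace_triples_L2[OF p] pD(3,4) by (intro cong) auto
      then show "residual (lebesgue_on D) (surface_measure \<Gamma>) (\<lambda>x. A ((1 / \<epsilon>) *\<^sub>R x)) S R f
          (\<epsilon> powr \<alpha>) (\<epsilon> powr \<beta>) (u, weak_grad D u, g) q = 0"
        using eq[OF pD(1,2)] by (simp add: residual_def q_eq)
    qed
    then show "\<exists>G g. (u, G, g) \<in> trace_triples D \<Gamma> \<Gamma>ext \<and> ?eq G g"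
      using mem by blast
  next
    assume "\<exists>G g. (u, G, g) \<in> trace_triples D \<Gamma> \<Gamma>ext \<and> ?eq G g"
    then obtain G g where mem: "(u, G, g) \<in> trace_triples D \<Gamma> \<Gamma>ext" and eq: "?eq G g"
      by blast
    note uD = trace_triplesD[OF D mem]
    have "(LINT x|lebesgue_on D. (A ((1/\<epsilon>) *\<^sub>R x) *v weak_grad D u x) \<bullet> weak_grad D \<phi> x)
         + \<epsilon> powr \<beta> * (LINT x|surface_measure \<Gamma>. S (g x) * h x)
         + \<epsilon> powr \<alpha> * (LINT x|lebesgue_on D. R (u x) * \<phi> x)
         = (LINT x|lebesgue_on D. f x * \<phi> x)"
      if \<phi>: "\<phi> \<in> Wtilde_space D \<Gamma> \<Gamma>ext" "has_trace D \<Gamma> \<phi> h" for \<phi> h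
    proof -
      have p: "(\<phi>, weak_grad D \<phi>, h) \<in> trace_triples D \<Gamma> \<Gamma>ext"
        using \<phi> by (rule trace_triplesI)
      have "(LINT x|lebesgue_on D. (A ((1/\<epsilon>) *\<^sub>R x) *v weak_grad D u x) \<bullet> weak_grad D \<phi> x)
          = (LINT x|lebesgue_on D. (A ((1/\<epsilon>) *\<^sub>R x) *v G x) \<bullet> weak_grad D \<phi> x)"
        using trace_triples_L2[OF mem] trace_triples_L2[OF p] uD(3,4) by (intro cong) auto
      then show ?thesis
        using bspec[OF eq p] by (simp add: residual_def)
    qed
    then show "weak_solution D \<Gamma> \<Gamma>ext \<epsilon> \<alpha> \<beta> A S R f u"
      unfolding weak_solution_def using uD(1,2) by blast
  }
qed

theorem theorem3p5:
  fixes \<Omega> Yl Ys :: "(real^'n) set"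
    and A :: "real^'n \<Rightarrow> real^'n^'n"
    and S R :: "real \<Rightarrow> real"
    and f :: "real^'n \<Rightarrow> real"
    and \<alpha> \<beta> \<epsilon> \<gamma>\<^sub>0 \<gamma>\<^sub>1 \<delta>\<^sub>0 \<delta>\<^sub>1 :: real
  defines "D \<equiv> perforated_domain \<epsilon> \<Omega> Yl"
    and "\<Gamma> \<equiv> internal_boundary \<epsilon> \<Omega> Ys"
    and "\<Gamma>ext \<equiv> frontier \<Omega>"
  assumes "bounded \<Omega>" and "open \<Omega>" and "connected \<Omega>" and "lipschitz_boundary \<Omega>"
    and "reference_cell Yl Ys"
    and "\<gamma>\<^sub>0 > 0" and "\<gamma>\<^sub>1 > 0" and "elliptic_coefficient \<gamma>\<^sub>0 \<gamma>\<^sub>1 A"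
    and "\<delta>\<^sub>0 > 0" and "\<delta>\<^sub>1 > 0" and "rate_function \<delta>\<^sub>0 \<delta>\<^sub>1 S" and "rate_function \<delta>\<^sub>0 \<delta>\<^sub>1 R"
    and "\<epsilon> > 0" and "microscopic_geometry \<epsilon> \<Omega> Yl Ys"
    and "smooth_on \<Omega> f" and "f \<in> L2_space (lebesgue_on D)"
  shows "\<exists>u. weak_solution D \<Gamma> \<Gamma>ext \<epsilon> \<alpha> \<beta> A S R f u \<and>
           (\<forall>v. weak_solution D \<Gamma> \<Gamma>ext \<epsilon> \<alpha> \<beta> A S R f v \<longrightarrow> (AE x in lebesgue_on D. v x = u x))"
proof -
  have D: "bounded D" "open D"
    using \<open>microscopic_geometry \<epsilon> \<Omega> Yl Ys\<close>
    by (simp_all add: D_def microscopic_geometry_def perforated_domain_def)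
  \<comment> \<open>Compactness of \<open>\<Gamma>\<close>: the solid part is made of pieces of
    cells contained in the bounded set \<open>\<Omega>\<close>, so its frontier is closed and
    bounded.\<close>
  have "Ys \<subseteq> unit_cell"
    using \<open>reference_cell Yl Ys\<close> by (simp add: reference_cell_def)
  then have "scaled_copy \<epsilon> Ys k \<subseteq> scaled_copy \<epsilon> unit_cell k" for k
    by (simp add: scaled_copy_def image_mono)
  then have "solid_domain \<epsilon> \<Omega> Ys \<subseteq> \<Omega>"
    unfolding solid_domain_def cell_indices_def by blast
  then have "bounded (closure (solid_domain \<epsilon> \<Omega> Ys))"
    using \<open>bounded \<Omega>\<close> by (intro bounded_closure) (rule bounded_subset)
  then have "bounded \<Gamma>"
    by (rule bounded_subset) (simp add: \<Gamma>_def internal_boundary_def frontier_def)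
  then have "compact \<Gamma>"
    by (simp add: compact_eq_bounded_closed \<Gamma>_def internal_boundary_def)
  moreover have "C2_boundary_along D \<Gamma>"
    using \<open>microscopic_geometry \<epsilon> \<Omega> Yl Ys\<close> by (simp add: microscopic_geometry_def D_def \<Gamma>_def)
  ultimately have fin_\<Gamma>: "finite_measure (surface_measure \<Gamma>)"
    by (intro finite_measure_surface_measure finite_upper_content_C2_boundary)
  have fin_D: "finite_measure (lebesgue_on D)"
    using D by (intro finite_measure_lebesgue_on lmeasurable_open)
  have "D \<in> sets lebesgue" "1 / \<epsilon> \<noteq> 0"
    using D \<open>\<epsilon> > 0\<close> by simp_all
  then have ell: "symmetric_elliptic_on (lebesgue_on D) \<gamma>\<^sub>0 \<gamma>\<^sub>1 (\<lambda>x. A ((1 / \<epsilon>) *\<^sub>R x))"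
    by (intro symmetric_elliptic_on_rescaled \<open>elliptic_coefficient \<gamma>\<^sub>0 \<gamma>\<^sub>1 A\<close>)
  have M: "(\<lambda>x. A ((1 / \<epsilon>) *\<^sub>R x)) \<in> borel_measurable (lebesgue_on D)"
    using ell unfolding symmetric_elliptic_on_def by (rule conjunct1)
  have pos: "\<epsilon> powr \<alpha> > 0" "\<epsilon> powr \<beta> > 0"
    using \<open>\<epsilon> > 0\<close> by simp_all
  let ?H = "trace_triples D \<Gamma> \<Gamma>ext"
  let ?B = "residual (lebesgue_on D) (surface_measure \<Gamma>) (\<lambda>x. A ((1 / \<epsilon>) *\<^sub>R x)) S R f
      (\<epsilon> powr \<alpha>) (\<epsilon> powr \<beta>)"
  have "\<exists>w\<in>?H. (\<forall>p\<in>?H. ?B w p = 0) \<and>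
      (\<forall>w'\<in>?H. (\<forall>p\<in>?H. ?B w' p = 0) \<longrightarrow> (AE x in lebesgue_on D. fst w' x = fst w x))"
    by (rule semilinear_variational_problem[OF fin_D fin_\<Gamma> ell \<open>\<gamma>\<^sub>0 > 0\<close> \<open>\<gamma>\<^sub>1 > 0\<close> \<open>\<delta>\<^sub>0 > 0\<close>
      \<open>rate_function \<delta>\<^sub>0 \<delta>\<^sub>1 S\<close> \<open>rate_function \<delta>\<^sub>0 \<delta>\<^sub>1 R\<close> pos \<open>f \<in> L2_space (lebesgue_on D)\<close>
      subspace_trace_triples[OF D] trace_triples_L2 trace_triples_closed[OF D]])
  then obtain w where "w \<in> ?H" and *: "(\<forall>p\<in>?H. ?B w p = 0) \<and>
      (\<forall>w'\<in>?H. (\<forall>p\<in>?H. ?B w' p = 0) \<longrightarrow> (AE x in lebesgue_on D. fst w' x = fst w x))"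
    by (rule bexE)
  note w = \<open>w \<in> ?H\<close> conjunct1[OF *] and uniq = conjunct2[OF *]
  obtain u G g where ugg: "w = (u, G, g)"
    by (cases w)
  note iff = weak_solution_iff_trace_triples[OF D M]
  show ?thesis
  proof (intro exI[of _ u] conjI allI impI)
    show "weak_solution D \<Gamma> \<Gamma>ext \<epsilon> \<alpha> \<beta> A S R f u"
      unfolding iff using w unfolding ugg by (intro exI conjI)
    fix v
    assume "weak_solution D \<Gamma> \<Gamma>ext \<epsilon> \<alpha> \<beta> A S R f v"
    then obtain G' g' where v: "(v, G', g') \<in> ?H \<and> (\<forall>p\<in>?H. ?B (v, G', g') p = 0)"
      unfolding iff by (elim exE)
    from mp[OF bspec[OF uniq conjunct1[OF v]] conjunct2[OF v]] show "AE x in lebesgue_on D. v x = u x"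
      by (simp add: ugg)
  qed
qed

end
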